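(* Let $f,g:\mathbb{N}\to\mathbb{U}$ be multiplicative functions. Let $P,Q\in\mathbb{Z}[x]$ be two irreducible polynomials such that $\operatorname{res}(P,Q)\ne0$. Then, for all sufficiently large $x$, $$\frac1x\sum_{n\le x}f(P(n))\,g(Q(n))=\prod_{p\le x}M_p(f(P),g(Q))+\mathrm{Error}(f(P),g(Q),x),$$ where $$\mathrm{Error}(f(P),g(Q),x)\ll \mathbb{D}_P(1,f;\log x;x)+\mathbb{D}_Q(1,g;\log x;x)+\frac{1}{\log\log x},$$ with an implied constant which may depend on $P$ and $Q$.
   Context: $\mathbb{U}=\{z\in\mathbb{C}:|z|\le1\}$; $p$ denotes primes; sums over $n\le x$ run over positive integers; $\operatorname{res}(P,Q)$ is the resultant. $f(P(n))$ is understood as $f(|P(n)|)$ (and likewise $g(Q(n))$), the finitely many $n$ with $P(n)Q(n)=0$ being omitted. For a prime $p$, $f_p$ is the multiplicative function with $f_p(p^k)=f(p^k)$ and $f_p(q^k)=1$ for primes $q\ne p$ and all $k\ge1$; $g_p$ is defined likewise. The local correlation is $$M_p(f(P),g(Q))=\lim_{x\to\infty}\frac1x\sum_{n\le x}f_p(P(n))\,g_p(Q(n)).$$ For $P\in\mathbb{Z}[x]$ let $N_P(x)=\{p^k:\ p \text{ prime},\ k\ge1,\ p\ge x,\ \exists\, n\le x \text{ with } p^k\| P(n)\}$, where $p^k\|m$ means $p^k\mid m$ and $p^{k+1}\nmid m$. Then $$\mathbb{D}_P(f,g;y;x)=\left(\sum_{y\le p\le x}\frac{1-\operatorname{Re}(f(p)\overline{g(p)})}{p}+\sum_{p^k\in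 N_P(x)}\frac{1-\operatorname{Re}(f(p^k)\overline{g(p^k)})}{x}\right)^{1/2}.$$ *)

theory Defs
  imports "HOL-Analysis.Analysis" "Subresultants.Resultant_Prelim"
begin

text \<open>
  Arithmetic functions live on the positive integers. They are represented by functions on
  \<^typ>\<open>nat\<close> whose value at 0 is unconstrained and never used.
\<close>

definition multiplicative :: "(nat \<Rightarrow> complex) \<Rightarrow> bool" where
  "multiplicative f \<longleftrightarrow>
     f 1 = 1 \<and> (\<forall>m n. m > 0 \<longrightarrow> n > 0 \<longrightarrow> coprime m n \<longrightarrow> f (m * n) = f m * f n)"

definition unit_disc_valued :: "(nat \<Rightarrow> complex) \<Rightarrow> bool" where
  "unit_disc_valued f \<longleftrightarrow> (\<forall>n>0. norm (f n) \<le> 1)"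

text \<open>
  The \<open>p\<close>-component \<open>f\<^sub>p\<close>. The lemmas after the definition show that, for multiplicative \<open>f\<close>,
  it is the multiplicative function that agrees with \<open>f\<close> on the powers of \<open>p\<close> and equals 1 on
  the powers of all other primes.
\<close>

definition local_component :: "(nat \<Rightarrow> complex) \<Rightarrow> nat \<Rightarrow> nat \<Rightarrow> complex" where
  "local_component f p n = f (p ^ multiplicity p n)"

lemma local_component_prime_power_same:
  assumes "prime p"
  shows "local_component f p (p ^ k) = f (p ^ k)"
  using assms by (simp add: local_component_def prime_nat_iff)

lemma local_component_prime_power_other:
  assumes "multiplicative f" "prime p" "prime q" "q \<noteq> p"
  shows "local_component f p (q ^ k) = 1"
  using assms
  by (simp add: local_component_def multiplicative_def multiplicity_distinct_prime_power)

lemma multiplicative_local_component: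
  assumes f: "multiplicative f" and p: "prime p"
  shows "multiplicative (local_component f p)"
  unfolding multiplicative_def
proof (intro conjI allI impI)
  show "local_component f p 1 = 1"
    using f by (simp add: local_component_def multiplicative_def)
next
  fix m n :: nat
  assume mn: "m > 0" "n > 0" "coprime m n"
  have add: "multiplicity p (m * n) = multiplicity p m + multiplicity p n"
    using mn p by (simp add: prime_elem_multiplicity_mult_distrib)
  have "\<not> p dvd m \<or> \<not> p dvd n"
    using mn(3) p by (meson coprime_common_divisor not_prime_unit)
  then have "multiplicity p m = 0 \<or> multiplicity p n = 0"
    by (auto simp: not_dvd_imp_multiplicity_0)
  then show "local_component f p (m * n) = local_component f p m * local_component f p n"
    using f by (auto simp: local_component_def add multiplicative_def)
qed

text \<open>
  The mean value of \<open>f(|P(n)|) g(|Q(n)|)\<close> over the positive integers \<open>n \<le> x\<close>, where the terms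
  with \<open>P(n) Q(n) = 0\<close> are omitted from the sum.
\<close>

definition correlation_mean ::
  "(nat \<Rightarrow> complex) \<Rightarrow> int poly \<Rightarrow> (nat \<Rightarrow> complex) \<Rightarrow> int poly \<Rightarrow> real \<Rightarrow> complex" where
  "correlation_mean f P g Q x =
     (1 / complex_of_real x) *
     (\<Sum>n | 1 \<le> n \<and> real n \<le> x \<and> poly P (int n) * poly Q (int n) \<noteq> 0.
        f (nat \<bar>poly P (int n)\<bar>) * g (nat \<bar>poly Q (int n)\<bar>))"

definition local_correlation ::
  "nat \<Rightarrow> (nat \<Rightarrow> complex) \<Rightarrow> int poly \<Rightarrow> (nat \<Rightarrow> complex) \<Rightarrow> int poly \<Rightarrow> complex" where
  "local_correlation p f P g Q =
     Lim at_top (correlation_mean (local_component f p) P (local_component g p) Q)"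

definition large_prime_powers :: "int poly \<Rightarrow> real \<Rightarrow> nat set" where
  "large_prime_powers P x =
     {p ^ k | p k. prime p \<and> k \<ge> 1 \<and> real p \<ge> x \<and>
        (\<exists>n::nat. 1 \<le> n \<and> real n \<le> x \<and>
           int (p ^ k) dvd poly P (int n) \<and> \<not> int (p ^ (k + 1)) dvd poly P (int n))}"

text \<open>
  The sum over \<^const>\<open>large_prime_powers\<close> is a genuine finite sum: exact divisibility by a
  prime power excludes the zeros of \<open>P\<close>.
\<close>

lemma finite_large_prime_powers: "finite (large_prime_powers P x)"
proof -
  let ?N = "{n::nat. 1 \<le> n \<and> real n \<le> x}"
  have "?N \<subseteq> {.. nat \<lfloor>x\<rfloor>}"
    by (auto simp: le_nat_floor)
  then have fin: "finite ?N"
    using finite_subset by blast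
  have bound: "q \<le> nat \<bar>m\<bar>" if "int q dvd m" "\<not> int r dvd m" for q r :: nat and m :: int
  proof -
    have "m \<noteq> 0"
      using that(2) by auto
    then show ?thesis
      using dvd_imp_le_int[OF _ that(1)] by simp
  qed
  have "large_prime_powers P x \<subseteq> (\<Union>n\<in>?N. {.. nat \<bar>poly P (int n)\<bar>})"
  proof
    fix q
    assume "q \<in> large_prime_powers P x"
    then obtain n r where "n \<in> ?N" "int q dvd poly P (int n)" "\<not> int r dvd poly P (int n)"
      unfolding large_prime_powers_def by blast
    then show "q \<in> (\<Union>n\<in>?N. {.. nat \<bar>poly P (int n)\<bar>})"
      using bound by blast
  qed
  then show ?thesis
    using fin by (meson finite_UN_I finite_atMost finite_subset)
qed

definition pretentious_dist ::
  "int poly \<Rightarrow> (nat \<Rightarrow> complex) \<Rightarrow> (nat \<Rightarrow> complex) \<Rightarrow> real \<Rightarrow> real \<Rightarrow> real" where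
  "pretentious_dist P f g y x =
     sqrt ((\<Sum>p | prime p \<and> y \<le> real p \<and> real p \<le> x. (1 - Re (f p * cnj (g p))) / real p)
         + (\<Sum>q\<in>large_prime_powers P x. (1 - Re (f q * cnj (g q))) / x))"

end

theory Submission
  imports Defs "Subresultants.Subresultant_Gcd" "HOL-Real_Asymp.Real_Asymp" "HOL-Number_Theory.Cong"
begin

text \<open>
  The proof evaluates both sides by one product over primes. The value \<open>f |P(n)|\<close> is
  the product over \<open>p\<close> of the components \<open>f (p ^ v)\<close>, where
  \<open>p ^ v\<close> is the exact power of \<open>p\<close> in \<open>P(n)\<close>. Capping
  \<open>v\<close> at some \<open>a\<close> changes the component only for those \<open>n\<close>
  with \<open>p ^ (a + 1)\<close> dividing \<open>P(n)\<close>. Irreducibility makes the roots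
  of \<open>P\<close> modulo prime powers uniformly sparse
  (\<open>card_roots_mod_prime_power_le\<close>), so these \<open>n\<close> have density
  \<open>O(1 / p ^ (a + 1))\<close>, and the same cap changes the local correlation by
  \<open>O(1 / p ^ (a + 1))\<close> (\<open>norm_local_minus_trunc_correlation_le\<close>).
  The exponents are chosen in \<open>truncation_exponents_exist\<close> such that all caps
  together cost \<open>O(1 / ln (ln x))\<close>. The primes then play different roles
  according to their size.

  For the primes up to \<open>ln x\<close> the capped components of \<open>f\<close> and
  \<open>g\<close> are periodic in \<open>n\<close> with a common period below
  \<open>sqrt x\<close>. By the Chinese remainder theorem their average is the product of the
  capped local correlations (\<open>sum_small_components_approx\<close>).

  For the primes between \<open>ln x\<close> and \<open>x powr (1 / 8)\<close> the product of
  the components is close to \<open>exp (H n)\<close>, where \<open>H n\<close> is the sum of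
  \<open>f p - 1\<close> over the primes that divide \<open>P(n)\<close>. The Turan-Kubilius
  inequality (\<open>turan_kubilius\<close>) shows that \<open>H n\<close> is close to its mean,
  with a variance bounded by the sum of \<open>|f p - 1|\<^sup>2 / p\<close>, hence by the
  squared distance because \<open>|u - 1|\<^sup>2 \<le> 2 (1 - Re u)\<close> in the unit
  disc. So these primes contribute a constant (\<open>sum_mid_components_le\<close>). A large
  prime does not divide \<open>P(n)\<close> and \<open>Q(n)\<close> simultaneously, as the
  resultant does not vanish; therefore the constants for \<open>f\<close> and \<open>g\<close>
  multiply to the product of the local correlations at these primes
  (\<open>prod_mid_correlations_approx\<close>).

  Primes between \<open>x powr (1 / 8)\<close> and \<open>x\<close> have a bounded sum of
  reciprocals, and the exact powers of primes \<open>p \<ge> x\<close> in the values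
  \<open>P(n)\<close> with \<open>n \<le> x\<close> are \<open>O(x)\<close> in number. In both
  cases the Cauchy-Schwarz inequality shows that replacing the components by 1 costs at most a
  multiple of the distance (\<open>sum_upper_range_le\<close>,
  \<open>sum_large_components_le\<close>).
\<close>

section \<open>Chebyshev's upper bound for the number of primes\<close>

lemma prod_primes_dvd:
  fixes n :: nat
  assumes "finite A" "\<And>p. p \<in> A \<Longrightarrow> prime p \<and> p dvd n"
  shows "\<Prod>A dvd n"
  using assms
proof (induction A rule: finite_induct)
  case (insert p A)
  have "coprime p (\<Prod>A)"
    using insert by (intro prod_coprime_right) (auto intro!: primes_coprime)
  then show ?case
    using insert by (simp add: divides_mult)
qed auto

text \<open>
  The two middle entries of row \<open>2 m + 1\<close> of Pascal's triangle are equal, and the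
  whole row sums to \<open>2 * 4 ^ m\<close>.
\<close>

lemma central_binomial_le: "(2 * m + 1) choose m \<le> 4 ^ m"
proof -
  have "((2 * m + 1) choose m) + ((2 * m + 1) choose (m + 1))
      = (\<Sum>k\<in>{m, m + 1}. (2 * m + 1) choose k)"
    by simp
  also have "\<dots> \<le> (\<Sum>k\<le>2 * m + 1. (2 * m + 1) choose k)"
    by (intro sum_mono2) auto
  also have "\<dots> = 2 * 4 ^ m"
    unfolding choose_row_sum by (simp add: power_mult)
  finally show ?thesis
    using binomial_symmetric[of m "2 * m + 1"] by simp
qed

text \<open>
  The induction of Erdos: the primes in \<open>(m + 1, 2 m + 1]\<close> all divide the
  binomial coefficient of \<open>2 m + 1\<close> over \<open>m\<close>, so their product is at
  most \<open>4 ^ m\<close>.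
\<close>

lemma primorial_le: "(\<Prod>p | prime p \<and> p \<le> n. p :: nat) \<le> 4 ^ n"
proof (induction n rule: less_induct)
  case (less n)
  have fin: "finite {p. prime p \<and> p \<le> n}" for n :: nat
    by (rule finite_subset[of _ "{..n}"]) auto
  consider "n \<le> 1" | "n = 2" | "n > 2" "even n" | m where "m \<ge> 1" "n = 2 * m + 1"
    by (metis One_nat_def Suc_lessI add.commute add_0 even_Suc leI less_one mult_0_right nat_less_le numeral_2_eq_2 oddE plus_1_eq_Suc)
  then show ?case
  proof cases
    case 1
    then have "{p. prime p \<and> p \<le> n} = {}"
      by (auto dest: prime_gt_1_nat)
    then show ?thesis by (metis One_nat_def prod.empty one_le_numeral one_le_power)
  next
    case 2
    then have "{p. prime p \<and> p \<le> n} = {2}"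
      by (auto dest: prime_gt_1_nat)
    then show ?thesis using 2 by simp
  next
    case 3
    then have "\<not> prime n"
      using prime_odd_nat by blast
    then have "p \<le> n - 1" if "prime p" "p \<le> n" for p
      using that by (cases "p = n") auto
    then have "{p. prime p \<and> p \<le> n} = {p. prime p \<and> p \<le> n - 1}"
      by auto
    moreover have "(\<Prod>p | prime p \<and> p \<le> n - 1. p :: nat) \<le> 4 ^ (n - 1)"
      using 3 by (intro less.IH) auto
    moreover have "(4::nat) ^ (n - 1) \<le> 4 ^ n"
      by (intro power_increasing) auto
    ultimately show ?thesis by (metis le_trans)
  next
    case (4 m)
    let ?A = "{p. prime p \<and> m + 1 < p \<and> p \<le> n}"
    have eq: "{p. prime p \<and> p \<le> n} = {p. prime p \<and> p \<le> m + 1} \<union> ?A"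
      using 4 by auto
    have "p dvd n choose m" if "p \<in> ?A" for p
    proof -
      have "p dvd fact n"
        using that by (auto simp: prime_dvd_fact_iff)
      then have "p dvd fact m * fact (n - m) * (n choose m)"
        using 4 by (subst binomial_fact_lemma) auto
      moreover have "\<not> p dvd fact m" "\<not> p dvd fact (n - m)"
        using that 4 prime_dvd_fact_iff[of p m] prime_dvd_fact_iff[of p "n - m"] by auto
      ultimately show ?thesis
        using that by (auto simp: prime_dvd_mult_iff)
    qed
    then have "\<Prod>?A dvd n choose m"
      by (intro prod_primes_dvd) (use fin[of n] in \<open>auto intro: finite_subset\<close>)
    then have "\<Prod>?A \<le> n choose m"
      using 4 by (intro dvd_imp_le) auto
    then have "\<Prod>?A \<le> 4 ^ m"
      using central_binomial_le[of m] 4 by simp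
    moreover have "(\<Prod>p | prime p \<and> p \<le> m + 1. p :: nat) \<le> 4 ^ (m + 1)"
      using 4 by (intro less.IH) auto
    ultimately have "(\<Prod>p | prime p \<and> p \<le> m + 1. p :: nat) * \<Prod>?A \<le> 4 ^ (m + 1) * 4 ^ m"
      by (intro mult_mono) auto
    moreover have "(\<Prod>p | prime p \<and> p \<le> n. p :: nat) = (\<Prod>p | prime p \<and> p \<le> m + 1. p :: nat) * \<Prod>?A"
      unfolding eq using fin[of n] fin[of "m + 1"]
      by (intro prod.union_disjoint) (auto intro: finite_subset)
    moreover have "(4::nat) ^ (m + 1) * 4 ^ m = 4 ^ n"
      using 4 by (simp add: power_add mult_2)
    ultimately show ?thesis by simp
  qed
qed

lemma finite_primes_le: "finite {p::nat. prime p \<and> real p \<le> t}"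
  by (rule finite_subset[of _ "{..nat \<lfloor>t\<rfloor>}"]) (auto simp: le_nat_floor)

text \<open>
  Every prime above \<open>sqrt t\<close> contributes at least \<open>ln t / 2\<close> to the
  logarithm of the primorial, which is at most \<open>t ln 4\<close>; there are at most
  \<open>sqrt t\<close> primes below.
\<close>

lemma chebyshev_upper:
  fixes t :: real
  assumes "t \<ge> 2"
  shows "real (card {p. prime p \<and> real p \<le> t}) \<le> 6 * t / ln t"
proof -
  define A where "A = {p. prime p \<and> real p \<le> t \<and> sqrt t < real p}"
  have fA: "finite A"
    unfolding A_def by (rule finite_subset[OF _ finite_primes_le[of t]]) auto
  have lnt: "ln t > 0" using assms by simp
  have st: "sqrt t > 1" using assms by simp
  have "sqrt t ^ card A = (\<Prod>p\<in>A. sqrt t)" by simp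
  also have "\<dots> \<le> (\<Prod>p\<in>A. real p)"
    using st by (intro prod_mono) (auto simp: A_def)
  also have "\<dots> \<le> (\<Prod>p | prime p \<and> real p \<le> t. real p)"
    using finite_primes_le[of t] by (intro prod_mono2) (auto simp: A_def dest: prime_ge_1_nat)
  also have "{p::nat. prime p \<and> real p \<le> t} = {p. prime p \<and> p \<le> nat \<lfloor>t\<rfloor>}"
    using assms by (auto simp: le_nat_floor) (metis le_nat_iff le_floor_iff of_int_of_nat_eq floor_mono floor_of_nat zero_le_floor order_trans zero_le_numeral)
  also have "(\<Prod>p | prime p \<and> p \<le> nat \<lfloor>t\<rfloor>. real p) \<le> 4 ^ nat \<lfloor>t\<rfloor>"
    using primorial_le[of "nat \<lfloor>t\<rfloor>"] by (metis (mono_tags, lifting) of_nat_le_iff of_nat_numeral of_nat_power of_nat_prod prod.cong)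
  finally have "ln (sqrt t ^ card A) \<le> ln (4 ^ nat \<lfloor>t\<rfloor>)"
    using st by (subst ln_le_cancel_iff) auto
  then have "real (card A) * (ln t / 2) \<le> real (nat \<lfloor>t\<rfloor>) * ln 4"
    using assms by (simp add: ln_realpow ln_sqrt)
  also have "\<dots> \<le> t * 2"
  proof (intro mult_mono)
    have "ln (4::real) = 2 * ln 2"
      using ln_realpow[of 2 2] by simp
    then show "ln (4::real) \<le> 2"
      using ln_2_less_1 by simp
  qed (use assms in auto)
  finally have 1: "real (card A) \<le> 4 * t / ln t"
    using lnt by (simp add: field_simps)
  have "{p. prime p \<and> real p \<le> t} \<subseteq> A \<union> {1..nat \<lfloor>sqrt t\<rfloor>}"
    by (auto simp: A_def le_nat_floor not_le[symmetric] dest: prime_ge_1_nat)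
  then have "card {p. prime p \<and> real p \<le> t} \<le> card (A \<union> {1..nat \<lfloor>sqrt t\<rfloor>})"
    using fA by (intro card_mono) auto
  also have "\<dots> \<le> card A + nat \<lfloor>sqrt t\<rfloor>"
    using card_Un_le[of A "{1..nat \<lfloor>sqrt t\<rfloor>}"] by simp
  finally have "real (card {p. prime p \<and> real p \<le> t}) \<le> real (card A) + real (nat \<lfloor>sqrt t\<rfloor>)"
    by linarith
  moreover have "real (nat \<lfloor>sqrt t\<rfloor>) \<le> sqrt t"
    using st by simp
  moreover have "sqrt t \<le> 2 * t / ln t"
  proof -
    have "ln (sqrt t) \<le> sqrt t"
      using st ln_bound[of "sqrt t"] by simp
    then have "ln t \<le> 2 * sqrt t"
      using assms by (simp add: ln_sqrt)
    then have "sqrt t * ln t \<le> sqrt t * (2 * sqrt t)"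
      using st by (intro mult_left_mono) auto
    also have "\<dots> = 2 * t"
      using assms by simp
    finally have "sqrt t * ln t \<le> 2 * t" .
    then show ?thesis
      using lnt assms by (simp add: field_simps)
  qed
  moreover have "4 * t / ln t + 2 * t / ln t = 6 * t / ln t"
    by (simp flip: add_divide_distrib)
  ultimately show ?thesis
    using 1 by linarith
qed

section \<open>Estimates in the unit disc and the left half-plane\<close>

text \<open>
  The exponential function is 1-Lipschitz on the left half-plane, where its derivative has modulus
  at most 1. All exponents below are sums of nonnegative multiples of \<open>f p - 1\<close>
  and lie there.
\<close>

lemma norm_exp_diff_le:
  fixes a b :: complex
  assumes "Re a \<le> 0" "Re b \<le> 0"
  shows "norm (exp a - exp b) \<le> norm (a - b)"
proof -
  have "norm (exp a - exp b) \<le> 1 * norm (a - b)"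
    by (rule field_differentiable_bound[where S = "{z. Re z \<le> 0}" and f' = exp])
       (use assms in \<open>auto intro!: convex_halfspace_Re_le derivative_eq_intros\<close>)
  then show ?thesis by simp
qed

lemma norm_exp_linear_le:
  fixes z :: complex
  assumes "norm z \<le> 2"
  shows "norm (exp z - (1 + z)) \<le> 9 * (norm z)\<^sup>2"
proof -
  have "norm (exp z - (1 + z)) \<le> exp \<bar>Re z\<bar> * norm z ^ 2"
    using Taylor_exp[of z 1] by (simp add: numeral_2_eq_2)
  also have "exp \<bar>Re z\<bar> \<le> exp 2"
    using assms abs_Re_le_cmod[of z] by simp
  also have "exp (2::real) = exp 1 * exp 1"
    by (simp flip: exp_add)
  also have "\<dots> \<le> 3 * 3"
    using exp_le by (intro mult_mono) auto
  finally show ?thesis by (simp add: mult_right_mono)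
qed

text \<open>
  This inequality turns the weights \<open>1 - Re (f p)\<close> of the pretentious distance
  into mean squares of \<open>f p - 1\<close>, to which the Cauchy-Schwarz inequality applies.
\<close>

lemma norm_diff_one_sq_le:
  fixes u :: complex
  assumes "norm u \<le> 1"
  shows "(norm (u - 1))\<^sup>2 \<le> 2 * (1 - Re u)"
proof -
  have "(norm u)\<^sup>2 \<le> 1"
    using assms by (simp add: power_le_one)
  then show ?thesis
    unfolding cmod_power2 by (simp add: power2_eq_square algebra_simps)
qed

lemma Re_le_1_if_norm_le_1: "norm u \<le> 1 \<Longrightarrow> Re u \<le> 1"
  using complex_Re_le_cmod[of u] by linarith

lemma norm_mult_diff_le:
  fixes a b c d :: complex
  assumes "norm b \<le> 1" "norm c \<le> 1"
  shows "norm (a * b - c * d) \<le> norm (a - c) + norm (b - d)"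
proof -
  have "a * b - c * d = (a - c) * b + c * (b - d)"
    by (simp add: algebra_simps)
  also have "norm \<dots> \<le> norm (a - c) * norm b + norm c * norm (b - d)"
    by (metis norm_mult norm_triangle_ineq)
  also have "\<dots> \<le> norm (a - c) * 1 + 1 * norm (b - d)"
    using assms by (intro add_mono mult_mono) auto
  finally show ?thesis by simp
qed

lemma norm_prod_le_1:
  fixes u :: "'a \<Rightarrow> complex"
  assumes "\<And>i. i \<in> I \<Longrightarrow> norm (u i) \<le> 1"
  shows "norm (prod u I) \<le> 1"
  unfolding prod_norm[symmetric] using assms by (intro prod_le_1) auto

section \<open>Means of periodic functions\<close>

definition periodic :: "nat \<Rightarrow> (nat \<Rightarrow> 'a) \<Rightarrow> bool" where
  "periodic m u \<longleftrightarrow> (\<forall>n. u n = u (n mod m))"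

lemma periodic_multiple:
  assumes "periodic m u" "m dvd M"
  shows "periodic M u"
  using assms unfolding periodic_def by (metis mod_mod_cancel)

lemma periodic_prod:
  assumes "\<And>i. i \<in> I \<Longrightarrow> periodic m (u i)"
  shows "periodic m (\<lambda>n. \<Prod>i\<in>I. u i n)"
  using assms unfolding periodic_def by (metis (mono_tags, lifting) prod.cong)

lemma periodic_binop: "periodic m u \<Longrightarrow> periodic m v \<Longrightarrow> periodic m (\<lambda>n. h (u n) (v n))"
  unfolding periodic_def by metis

lemma sum_periodic_window:
  fixes u :: "nat \<Rightarrow> complex"
  assumes "periodic M u"
  shows "(\<Sum>n\<in>{k..<k + M}. u n) = (\<Sum>n<M. u n)"
proof (induction k)
  case 0
  then show ?case by (simp add: lessThan_atLeast0)
next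
  case (Suc k)
  have "u (k + M) = u k"
    using assms unfolding periodic_def by (metis mod_add_self2)
  then have "(\<Sum>n\<in>{k..<k + M}. u n) = (\<Sum>n\<in>{Suc k..<Suc k + M}. u n)"
    using sum.atLeast_Suc_lessThan[of k "k + M" u] by (cases "M = 0") auto
  with Suc show ?case by simp
qed

text \<open>
  Complete periods contribute exactly their mean. What is left is an incomplete period and the
  mean of as many terms, each of modulus at most \<open>M\<close>.
\<close>

lemma sum_periodic_approx:
  fixes u :: "nat \<Rightarrow> complex"
  assumes per: "periodic M u" and M: "M > 0" and u: "\<And>n. norm (u n) \<le> 1"
  shows "norm ((\<Sum>n\<in>{1..N}. u n) - of_nat N * ((\<Sum>n<M. u n) / of_nat M)) \<le> 2 * real M"
proof (induction N rule: less_induct)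
  case (less N)
  have T: "norm (\<Sum>n<M. u n) \<le> real M"
    using sum_norm_le[of "{..<M}" u "\<lambda>_. 1"] u by simp
  show ?case
  proof (cases "N < M")
    case True
    have "norm (\<Sum>n\<in>{1..N}. u n) \<le> real N"
      using sum_norm_le[of "{1..N}" u "\<lambda>_. 1"] u by simp
    moreover have "norm (of_nat N * ((\<Sum>n<M. u n) / of_nat M)) \<le> real N * 1"
      unfolding norm_mult using T M by (intro mult_mono) (auto simp: norm_divide field_simps)
    ultimately show ?thesis
      using True norm_triangle_ineq4[of "\<Sum>n\<in>{1..N}. u n" "of_nat N * ((\<Sum>n<M. u n) / of_nat M)"]
      by linarith
  next
    case False
    then obtain K where K: "N = K + M"
      by (metis add.commute le_Suc_ex not_less)
    have "{1..N} = {1..K} \<union> {Suc K..<Suc K + M}" "{1..K} \<inter> {Suc K..<Suc K + M} = {}"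
      using K by auto
    then have "(\<Sum>n\<in>{1..N}. u n) = (\<Sum>n\<in>{1..K}. u n) + (\<Sum>n<M. u n)"
      by (simp only: sum.union_disjoint[of "{1..K}" "{Suc K..<Suc K + M}"] finite_atLeastAtMost
          finite_atLeastLessThan sum_periodic_window[OF per])
    then have "(\<Sum>n\<in>{1..N}. u n) - of_nat N * ((\<Sum>n<M. u n) / of_nat M)
        = (\<Sum>n\<in>{1..K}. u n) - of_nat K * ((\<Sum>n<M. u n) / of_nat M)"
      using M by (simp add: K field_simps)
    then show ?thesis
      using less.IH[of K] K M by simp
  qed
qed

lemma sum_product_coprime_periods:
  fixes u v :: "nat \<Rightarrow> complex"
  assumes "coprime a b" "a > 0" "b > 0" "periodic a u" "periodic b v"
  shows "(\<Sum>n<a * b. u n * v n) = (\<Sum>n<a. u n) * (\<Sum>n<b. v n)"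
proof -
  let ?h = "\<lambda>n. (n mod a, n mod b)"
  have inj: "inj_on ?h {..<a * b}"
  proof (rule inj_onI)
    fix x y assume xy: "x \<in> {..<a * b}" "y \<in> {..<a * b}" "?h x = ?h y"
    then have "[x = y] (mod a)" "[x = y] (mod b)"
      by (auto simp: cong_def)
    then have "[x = y] (mod (a * b))"
      using assms(1) by (simp add: coprime_cong_mult_nat)
    then show "x = y" using xy by (auto simp: cong_def)
  qed
  have "?h ` {..<a * b} \<subseteq> {..<a} \<times> {..<b}"
    using assms by auto
  then have im: "?h ` {..<a * b} = {..<a} \<times> {..<b}"
    using inj by (intro card_subset_eq) (auto simp: card_image)
  have "(\<Sum>n<a * b. u n * v n) = (\<Sum>n<a * b. u (fst (?h n)) * v (snd (?h n)))"
    using assms unfolding periodic_def by (intro sum.cong) auto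
  also have "\<dots> = (\<Sum>z\<in>{..<a} \<times> {..<b}. u (fst z) * v (snd z))"
    using sum.reindex[OF inj, of "\<lambda>z. u (fst z) * v (snd z)"] im by simp
  also have "\<dots> = (\<Sum>n<a. u n) * (\<Sum>n<b. v n)"
    by (simp add: sum_product sum.cartesian_product case_prod_beta)
  finally show ?thesis .
qed

lemma sum_prod_coprime_periods:
  fixes u :: "'i \<Rightarrow> nat \<Rightarrow> complex"
  assumes "finite I" "\<And>i. i \<in> I \<Longrightarrow> m i > 0 \<and> periodic (m i) (u i)"
    "\<And>i j. i \<in> I \<Longrightarrow> j \<in> I \<Longrightarrow> i \<noteq> j \<Longrightarrow> coprime (m i) (m j)"
  shows "(\<Sum>n<prod m I. \<Prod>i\<in>I. u i n) = (\<Prod>i\<in>I. \<Sum>n<m i. u i n)"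
  using assms
proof (induction I rule: finite_induct)
  case (insert i I)
  have "coprime (m i) (prod m I)"
    using insert by (intro prod_coprime_right) auto
  moreover have "periodic (prod m I) (\<lambda>n. \<Prod>i\<in>I. u i n)"
    using insert by (intro periodic_prod periodic_multiple[OF _ dvd_prodI]) auto
  moreover have "prod m I > 0"
    using insert by (intro prod_pos) auto
  ultimately have "(\<Sum>n<m i * prod m I. u i n * (\<Prod>i\<in>I. u i n))
      = (\<Sum>n<m i. u i n) * (\<Sum>n<prod m I. \<Prod>i\<in>I. u i n)"
    using insert.prems by (intro sum_product_coprime_periods) auto
  with insert show ?case by simp
qed auto

section \<open>Roots of integer polynomials modulo prime powers\<close>

text \<open>
  Gauss's lemma: primitive parts are multiplicative, and that of the constant \<open>a\<close> is
  a unit.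
\<close>

lemma primitive_part_dvd_if_dvd_smult:
  fixes F g :: "int poly"
  assumes "a \<noteq> 0" "Polynomial.smult a F = g * q"
  shows "primitive_part g dvd F"
proof -
  have "primitive_part g dvd primitive_part (Polynomial.smult a F)"
    by (simp add: assms(2) primitive_part_mult)
  also have "Polynomial.smult a F = [:a:] * F"
    by simp
  also have "primitive_part ([:a:] * F) = primitive_part [:a:] * primitive_part F"
    by (rule primitive_part_mult)
  also have "primitive_part [:a:] * primitive_part F dvd primitive_part F"
  proof -
    have "is_unit (primitive_part [:a:])"
      using assms(1) by (simp add: primitive_part_const_poly is_unit_const_poly_iff)
    then show ?thesis
      by (simp only: mult_unit_dvd_iff' dvd_refl)
  qed
  also have "primitive_part F dvd F"
    using content_times_primitive_part[of F] by (metis dvd_smult dvd_refl)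
  finally show ?thesis .
qed

text \<open>
  The ring of integer polynomials is not a Bezout domain, so coprimality yields a nonzero constant
  in the ideal of \<open>P\<close> and \<open>Q\<close> rather than 1. Let \<open>g\<close> be a
  nonzero element of least degree of this ideal. Pseudo-division shows that \<open>g\<close>
  divides a nonzero integer multiple of every element, hence its primitive part is a common
  divisor of \<open>P\<close> and \<open>Q\<close> and has degree 0.
\<close>

lemma bezout_if_degree_gcd_0:
  fixes P Q :: "int poly"
  assumes "P \<noteq> 0" "degree (gcd P Q) = 0"
  obtains U V R where "R \<noteq> 0" "U * P + V * Q = [:R:]"
proof -
  define I where "I = {g. \<exists>U V. g = U * P + V * Q}"
  have "P \<in> I"
    unfolding I_def by (rule CollectI, rule exI[of _ 1], rule exI[of _ 0]) simp
  moreover have QI: "Q \<in> I"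
    unfolding I_def by (rule CollectI, rule exI[of _ 0], rule exI[of _ 1]) simp
  ultimately obtain g where g: "g \<in> I" "g \<noteq> 0" "\<And>h. h \<in> I \<Longrightarrow> h \<noteq> 0 \<Longrightarrow> degree g \<le> degree h"
    using ex_has_least_nat[of "\<lambda>h. h \<in> I \<and> h \<noteq> 0" P degree] assms(1) by blast
  have "primitive_part g dvd F" if F: "F \<in> I" for F
  proof -
    obtain a q where aq: "a \<noteq> 0" "Polynomial.smult a F = g * q + pseudo_mod F g"
      using pseudo_mod(1)[OF g(2)] by blast
    obtain U V where UV: "F = U * P + V * Q" using F by (auto simp: I_def)
    obtain U' V' where UV': "g = U' * P + V' * Q" using g(1) by (auto simp: I_def)
    have "pseudo_mod F g = Polynomial.smult a F - g * q"
      using aq by simp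
    also have "\<dots> = (Polynomial.smult a U - U' * q) * P + (Polynomial.smult a V - V' * q) * Q"
      by (subst UV, subst UV') (simp add: algebra_simps smult_add_right)
    finally have "pseudo_mod F g \<in> I"
      by (auto simp: I_def)
    then have "pseudo_mod F g = 0"
      using g(3) pseudo_mod(2)[OF g(2), of F] by force
    then show ?thesis
      using aq by (intro primitive_part_dvd_if_dvd_smult[of a F g q]) auto
  qed
  then have "primitive_part g dvd gcd P Q"
    using \<open>P \<in> I\<close> QI by simp
  then have "degree g = 0"
    using dvd_imp_degree_le[of "primitive_part g" "gcd P Q"] assms by simp
  then obtain R where "g = [:R:]"
    by (rule degree_eq_zeroE)
  then show thesis
    using g(1,2) that by (auto simp: I_def)
qed

text \<open>
  An irreducible polynomial of positive degree cannot divide its derivative, which is nonzero and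
  of smaller degree. A constant polynomial is itself the required constant.
\<close>

lemma bezout_pderiv_if_irreducible:
  fixes P :: "int poly"
  assumes "irreducible P"
  obtains U V R where "R \<noteq> 0" "U * P + V * pderiv P = [:R:]"
proof (cases "degree P = 0")
  case True
  then obtain c where "P = [:c:]" by (rule degree_eq_zeroE)
  then show thesis
    using assms that[of c 1 0] by auto
next
  case False
  have P0: "P \<noteq> 0" using assms by auto
  have "\<not> P dvd gcd P (pderiv P)"
  proof
    assume "P dvd gcd P (pderiv P)"
    then have "P dvd pderiv P" by simp
    moreover have "pderiv P \<noteq> 0" using False by (simp add: pderiv_eq_0_iff)
    ultimately have "degree P \<le> degree (pderiv P)" by (rule dvd_imp_degree_le)
    then show False using False by (simp add: degree_pderiv)
  qed
  then have "is_unit (gcd P (pderiv P))"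
    using irreducibleD'[OF assms, of "gcd P (pderiv P)"] by auto
  then have "degree (gcd P (pderiv P)) = 0"
    by simp
  with P0 bezout_if_degree_gcd_0 that show thesis by metis
qed

text \<open>
  Lagrange's theorem: a root \<open>a\<close> splits off the factor \<open>X - a\<close> up to
  the constant \<open>poly P a\<close>, which vanishes modulo \<open>p\<close>, and every other
  root is a root of the cofactor.
\<close>

lemma card_roots_mod_prime_le_degree:
  fixes P :: "int poly"
  assumes "prime p" "\<not> [:int p:] dvd P"
  shows "card {n. n < p \<and> int p dvd poly P (int n)} \<le> degree P"
  using assms(2)
proof (induction "degree P" arbitrary: P)
  case 0
  then obtain c where "P = [:c:]" by (metis degree_eq_zeroE)
  then have "{n. n < p \<and> int p dvd poly P (int n)} = {}"
    using 0 by auto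
  then show ?case by (metis card.empty le0)
next
  case (Suc d)
  show ?case
  proof (cases "{n. n < p \<and> int p dvd poly P (int n)} = {}")
    case True
    then show ?thesis by (metis card.empty le0)
  next
    case False
    then obtain a where a: "a < p" "int p dvd poly P (int a)" by auto
    define Q where "Q = synthetic_div P (int a)"
    have PQ: "P = [:- int a, 1:] * Q + [:poly P (int a):]"
      unfolding Q_def by (rule synthetic_div_correct'[symmetric])
    have "[:int p:] dvd [:poly P (int a):]"
      using a by (simp add: const_poly_dvd)
    then have "\<not> [:int p:] dvd Q"
      using Suc.prems PQ by (metis dvd_add dvd_mult)
    then have IH: "card {n. n < p \<and> int p dvd poly Q (int n)} \<le> d"
      using Suc.hyps by (metis Q_def degree_synthetic_div diff_Suc_1)
    have "b = a \<or> int p dvd poly Q (int b)" if b: "b < p" "int p dvd poly P (int b)" for b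
    proof -
      have "poly P (int b) = (int b - int a) * poly Q (int b) + poly P (int a)"
        by (subst PQ) (simp add: algebra_simps)
      then have "int p dvd (int b - int a) * poly Q (int b)"
        using a b by (metis dvd_add_left_iff)
      then have "int p dvd int b - int a \<or> int p dvd poly Q (int b)"
        using assms(1) by (simp add: prime_dvd_mult_iff)
      moreover have "b = a" if "int p dvd int b - int a"
        using that a(1) b(1) by (metis cong_iff_dvd_diff cong_int_iff cong_less_modulus_unique_nat)
      ultimately show ?thesis by blast
    qed
    then have "{n. n < p \<and> int p dvd poly P (int n)}
        \<subseteq> insert a {n. n < p \<and> int p dvd poly Q (int n)}"
      by auto
    then have "card {n. n < p \<and> int p dvd poly P (int n)}
        \<le> card (insert a {n. n < p \<and> int p dvd poly Q (int n)})"
      by (intro card_mono) auto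
    also have "\<dots> \<le> Suc (card {n. n < p \<and> int p dvd poly Q (int n)})"
      by (rule card_insert_le_m1) auto
    finally show ?thesis
      using IH Suc.hyps by simp
  qed
qed

lemma poly_second_order_expansion:
  fixes P :: "int poly"
  shows "\<exists>w. poly P (a + h) = poly P a + h * (poly (pderiv P) a + h * w)"
proof (induction P)
  case 0
  then show ?case by (intro exI[of _ 0]) simp
next
  case (pCons c P)
  then obtain w where w: "poly P (a + h) = poly P a + h * (poly (pderiv P) a + h * w)" by blast
  show ?case
    by (rule exI[of _ "poly (pderiv P) a + (a + h) * w"]) (simp add: pderiv_pCons w algebra_simps)
qed

lemma poly_cong:
  fixes P :: "int poly"
  assumes "[a = b] (mod q)"
  shows "[poly P a = poly P b] (mod q)"
  using assms by (induction P) (auto intro!: cong_add cong_mult)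

text \<open>
  Distinct members of one residue class modulo \<open>q\<close> lie in distinct blocks of length
  \<open>q\<close>.
\<close>

lemma card_congruent_le:
  fixes S :: "nat set"
  assumes "S \<subseteq> {..N}" "q > 0" "\<And>m n. m \<in> S \<Longrightarrow> n \<in> S \<Longrightarrow> [m = n] (mod q)"
  shows "card S \<le> N div q + 1"
proof -
  have "inj_on (\<lambda>n. n div q) S"
    using assms(3) by (intro inj_onI) (metis cong_def div_mult_mod_eq)
  moreover have "(\<lambda>n. n div q) ` S \<subseteq> {..N div q}"
    using assms(1) by (auto intro: div_le_mono)
  ultimately have "card S \<le> card {..N div q}"
    by (intro card_inj_on_le) auto
  then show ?thesis by simp
qed

text \<open>
  Write \<open>U P + V P' = R\<close> with an integer \<open>R \<noteq> 0\<close>, and let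
  \<open>p ^ r\<close> be the exact power of \<open>p\<close> in \<open>R\<close>. For
  \<open>k \<le> r\<close> the bound is trivial since \<open>p ^ k \<le> |R|\<close>. Let
  \<open>k > r\<close>. At a root \<open>n\<close> of \<open>P\<close> modulo
  \<open>p ^ k\<close> the derivative is not divisible by \<open>p ^ (r + 1)\<close>, so by
  Taylor's formula two roots that agree modulo \<open>p ^ (r + 1)\<close> agree modulo
  \<open>p ^ (k - r)\<close>. The roots occupy boundedly many classes modulo
  \<open>p ^ (r + 1)\<close>: by Lagrange's theorem at most \<open>degree P\<close> if
  \<open>r = 0\<close>, and at most
  \<open>p ^ (r + 1) \<le> p ^ (2 r) \<le> R\<^sup>2\<close> otherwise. In each class
  there are at most \<open>N / p ^ (k - r) + 1\<close> of them up to \<open>N\<close>, and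
  \<open>p ^ r \<le> |R|\<close>.
\<close>

lemma card_roots_mod_prime_power_le:
  fixes P :: "int poly"
  assumes "irreducible P"
  obtains C :: real where "C \<ge> 1"
    "\<And>p k N. prime p \<Longrightarrow>
       real (card {n. n \<le> N \<and> int (p ^ k) dvd poly P (int n)}) \<le> C * (real N / real p ^ k + 1)"
proof -
  obtain U V R where R: "R \<noteq> 0" and bez: "U * P + V * pderiv P = [:R:]"
    using bezout_pderiv_if_irreducible[OF assms] .
  define A where "A = nat \<bar>R\<bar>"
  define E where "E = degree P + A\<^sup>2"
  have A: "A \<ge> 1" using R by (simp add: A_def)
  have bezv: "poly U x * poly P x + poly V x * poly (pderiv P) x = R" for x
    using arg_cong[OF bez, of "\<lambda>F. poly F x"] by simp
  show thesis
  proof (rule that[of "(real E + 1) * real A"])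
    show "(real E + 1) * real A \<ge> 1"
      using A mult_mono[of 1 "real E + 1" 1 "real A"] by simp
  next
    fix p k N :: nat
    assume p: "prime p"
    have p1: "p \<ge> 1" using p by (rule prime_ge_1_nat)
    define S where "S = {n. n \<le> N \<and> int (p ^ k) dvd poly P (int n)}"
    define r where "r = multiplicity (int p) R"
    have fS: "finite S" unfolding S_def by auto
    have "int p ^ r dvd R"
      unfolding r_def by (rule multiplicity_dvd)
    then have "int (p ^ r) \<le> \<bar>R\<bar>"
      using R by (intro zdvd_imp_le) auto
    then have prA: "p ^ r \<le> A"
      unfolding A_def by linarith
    have pr1: "\<not> int p ^ (r + 1) dvd R"
      unfolding r_def using R p by (subst power_dvd_iff_le_multiplicity) auto
    show "real (card S) \<le> (real E + 1) * real A * (real N / real p ^ k + 1)"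
    proof (cases "k \<le> r")
      case True
      have "card S \<le> card {..N}"
        by (intro card_mono) (auto simp: S_def)
      then have "real (card S) \<le> real N + 1" by simp
      also have "p ^ k \<le> A"
        using prA True p1 by (meson le_trans power_increasing)
      then have "real p ^ k \<le> real A"
        by (metis of_nat_le_iff of_nat_power)
      then have "real N * 1 \<le> real N * (real A / real p ^ k)"
        using p1 by (intro mult_left_mono) (auto simp: field_simps)
      then have "real N + 1 \<le> real A * (real N / real p ^ k + 1)"
        using A by (simp add: algebra_simps)
      also have "\<dots> \<le> (real E + 1) * (real A * (real N / real p ^ k + 1))"
        using mult_right_mono[of 1 "real E + 1" "real A * (real N / real p ^ k + 1)"] by simp
      finally show ?thesis by (simp add: mult.assoc)
    next
      case False
      define cl where "cl = (\<lambda>n. n mod p ^ (r + 1)) ` S"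
      \<comment> \<open>Newton-Hensel separation of roots in one class modulo \<open>p ^ (r + 1)\<close>.\<close>
      have near: "[m = n] (mod p ^ (k - r))"
        if mn: "m \<in> S" "n \<in> S" "m mod p ^ (r + 1) = n mod p ^ (r + 1)" for m n
      proof -
        define h where "h = int m - int n"
        obtain w where w: "poly P (int n + h) = poly P (int n) + h * (poly (pderiv P) (int n) + h * w)"
          using poly_second_order_expansion by blast
        define s where "s = poly (pderiv P) (int n) + h * w"
        have hp: "int p ^ (r + 1) dvd h"
          using mn(3) unfolding h_def by (metis cong_def cong_iff_dvd_diff cong_int_iff of_nat_power)
        have Pm: "int p ^ k dvd poly P (int m)" and Pn: "int p ^ k dvd poly P (int n)"
          using mn by (auto simp: S_def)
        have "int p ^ k dvd h * s"
          using w Pm Pn by (simp add: h_def s_def dvd_add_right_iff)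
        have "\<not> int p ^ (r + 1) dvd s"
        proof
          assume "int p ^ (r + 1) dvd s"
          then have "int p ^ (r + 1) dvd poly (pderiv P) (int n)"
            using hp unfolding s_def by (metis dvd_add_left_iff dvd_mult2)
          moreover have "int p ^ (r + 1) dvd poly P (int n)"
            using False by (intro dvd_trans[OF le_imp_power_dvd Pn]) auto
          ultimately have "int p ^ (r + 1) dvd R"
            unfolding bezv[of "int n", symmetric] by (intro dvd_add dvd_mult)
          with pr1 show False by blast
        qed
        have "int p ^ (k - r) dvd h"
        proof (cases "h = 0")
          case True
          then show ?thesis by simp
        next
          case h: False
          have s: "s \<noteq> 0" using \<open>\<not> int p ^ (r + 1) dvd s\<close> by auto
          have pp: "prime_elem (int p)" using p by simp
          have "k \<le> multiplicity (int p) (h * s)"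
            using \<open>int p ^ k dvd h * s\<close> h s p by (subst power_dvd_iff_le_multiplicity[symmetric]) auto
          moreover have "multiplicity (int p) s < r + 1"
            using \<open>\<not> int p ^ (r + 1) dvd s\<close> s p by (subst (asm) power_dvd_iff_le_multiplicity) auto
          ultimately have "k - r \<le> multiplicity (int p) h"
            using prime_elem_multiplicity_mult_distrib[OF pp h s] by simp
          then show ?thesis
            by (rule multiplicity_dvd')
        qed
        then show ?thesis
          unfolding h_def by (metis cong_iff_dvd_diff cong_int_iff of_nat_power)
      qed
      have "card cl \<le> E"
      proof (cases "r = 0")
        case True
        have k1: "k \<ge> 1" using False by simp
        have "int p dvd poly P (int (n mod p))" if "n \<in> S" for n
        proof -
          have "int p dvd poly P (int n)"
            using that k1 unfolding S_def by (auto intro: dvd_trans[of "int p" "int p ^ k"])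
          moreover have "[poly P (int (n mod p)) = poly P (int n)] (mod int p)"
            by (intro poly_cong) (simp add: cong_def zmod_int)
          ultimately show ?thesis by (metis cong_dvd_iff)
        qed
        then have "cl \<subseteq> {n. n < p \<and> int p dvd poly P (int n)}"
          using True p1 by (auto simp: cl_def)
        then have "card cl \<le> card {n. n < p \<and> int p dvd poly P (int n)}"
          by (intro card_mono) auto
        also have "\<dots> \<le> degree P"
        proof (rule card_roots_mod_prime_le_degree[OF p])
          show "\<not> [:int p:] dvd P"
          proof
            assume "[:int p:] dvd P"
            then obtain K where "P = [:int p:] * K" ..
            then have "pderiv P = [:int p:] * pderiv K"
              by (simp add: pderiv_smult)
            then have "[:int p:] dvd pderiv P" by (rule dvdI)
            with \<open>[:int p:] dvd P\<close> have "[:int p:] dvd [:R:]"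
              unfolding bez[symmetric] by (meson dvd_add dvd_mult)
            then show False using pr1 True by (simp add: const_poly_dvd)
          qed
        qed
        finally show ?thesis by (simp add: E_def)
      next
        case r0: False
        have "cl \<subseteq> {..<p ^ (r + 1)}"
          using p1 by (auto simp: cl_def)
        then have "card cl \<le> p ^ (r + 1)"
          using card_mono[of "{..<p ^ (r + 1)}" cl] by simp
        also have "\<dots> \<le> p ^ (r * 2)"
          using r0 p1 by (intro power_increasing) auto
        also have "\<dots> \<le> A\<^sup>2"
          unfolding power_mult using prA by (intro power_mono) auto
        finally show ?thesis by (simp add: E_def)
      qed
      have fib: "card {n \<in> S. n mod p ^ (r + 1) = c} \<le> N div p ^ (k - r) + 1" for c
        by (rule card_congruent_le) (use near p1 in \<open>auto simp: S_def\<close>)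
      have "S = (\<Union>c\<in>cl. {n \<in> S. n mod p ^ (r + 1) = c})"
        by (auto simp: cl_def)
      then have "card S \<le> (\<Sum>c\<in>cl. card {n \<in> S. n mod p ^ (r + 1) = c})"
        using card_UN_le[of cl "\<lambda>c. {n \<in> S. n mod p ^ (r + 1) = c}"] fS by (simp add: cl_def)
      also have "\<dots> \<le> card cl * (N div p ^ (k - r) + 1)"
        using sum_bounded_above[of cl _ "N div p ^ (k - r) + 1"] fib by simp
      also have "\<dots> \<le> E * (N div p ^ (k - r) + 1)"
        using \<open>card cl \<le> E\<close> by (rule mult_right_mono) auto
      finally have "real (card S) \<le> real (E * (N div p ^ (k - r) + 1))"
        by (simp only: of_nat_le_iff)
      also have "\<dots> = real E * (real (N div p ^ (k - r)) + 1)"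
        by (simp add: algebra_simps)
      also have "\<dots> \<le> (real E + 1) * (real A * (real N / real p ^ k + 1))"
      proof (intro mult_mono)
        have "real (N div p ^ (k - r)) \<le> real N / real (p ^ (k - r))"
          by (rule of_nat_div_le_of_nat)
        also have "\<dots> = real (p ^ r) * (real N / real p ^ k)"
        proof -
          have "real p ^ k = real p ^ r * real p ^ (k - r)"
            using False by (simp flip: power_add)
          then show ?thesis using p1 by simp
        qed
        also have "\<dots> \<le> real A * (real N / real p ^ k)"
          using prA by (intro mult_right_mono) (auto simp del: of_nat_power)
        finally show "real (N div p ^ (k - r)) + 1 \<le> real A * (real N / real p ^ k + 1)"
          using A by (simp add: distrib_left)
      qed auto
      finally show ?thesis by (simp only: mult.assoc)
    qed
  qed
qed

section \<open>Local components and local correlations\<close>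

definition pval :: "int poly \<Rightarrow> nat \<Rightarrow> nat" where
  "pval P n = nat \<bar>poly P (int n)\<bar>"

lemma dvd_pval_iff: "q dvd pval P n \<longleftrightarrow> int q dvd poly P (int n)"
proof -
  have "q dvd pval P n \<longleftrightarrow> int q dvd int (pval P n)" by simp
  then show ?thesis by (simp add: pval_def)
qed

lemma pval_eq_0_iff: "pval P n = 0 \<longleftrightarrow> poly P (int n) = 0"
  by (simp add: pval_def)

text \<open>
  The form in which irreducibility enters the averages over \<open>n\<close>. Uniformity in
  \<open>p\<close>, \<open>k\<close> and \<open>N\<close> is what allows errors to be summed over
  all primes.
\<close>

definition prime_power_sparse :: "real \<Rightarrow> int poly \<Rightarrow> bool" where
  "prime_power_sparse C P \<longleftrightarrow> C \<ge> 1 \<and>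
     (\<forall>p k N. prime p \<longrightarrow>
        real (card {n. n \<le> N \<and> p ^ k dvd pval P n}) \<le> C * (real N / real p ^ k + 1))"

lemma prime_power_sparse_exists: "irreducible P \<Longrightarrow> \<exists>C. prime_power_sparse C P"
  unfolding prime_power_sparse_def dvd_pval_iff
  using card_roots_mod_prime_power_le[of P] by metis

lemma prime_power_sparse_mono: "prime_power_sparse C P \<Longrightarrow> C \<le> C' \<Longrightarrow> prime_power_sparse C' P"
  unfolding prime_power_sparse_def
  by (meson add_nonneg_nonneg divide_nonneg_nonneg mult_right_mono of_nat_0_le_iff order_trans zero_le_one zero_le_power)

lemma sum_prime_power_multiples_le:
  assumes "prime_power_sparse C P" "prime p"
  shows "(\<Sum>n\<in>{1..N}. if p ^ k dvd pval P n then 1 else 0 :: real) \<le> C * (real N / real p ^ k + 1)"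
proof -
  have "(\<Sum>n\<in>{1..N}. if p ^ k dvd pval P n then 1 else 0 :: real)
      = real (card {n \<in> {1..N}. p ^ k dvd pval P n})"
    by (simp add: sum.If_cases Int_def)
  also have "\<dots> \<le> real (card {n. n \<le> N \<and> p ^ k dvd pval P n})"
    by (intro of_nat_mono card_mono) auto
  also have "\<dots> \<le> C * (real N / real p ^ k + 1)"
    using assms by (auto simp: prime_power_sparse_def)
  finally show ?thesis .
qed

lemma finite_zeros: "P \<noteq> 0 \<Longrightarrow> finite {n::nat. poly P (int n) = 0}"
  using finite_vimageI[of "{x. poly P x = 0}" int] poly_roots_finite[of P] by (simp add: vimage_def)

text \<open>
  The component of \<open>f\<close> at \<open>p\<close> with the exponent of \<open>p\<close>
  capped at \<open>a\<close>. With a greatest common divisor in place of a minimum of exponents it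
  is a function of \<open>m\<close> modulo \<open>p ^ a\<close>, also at \<open>m = 0\<close>.
\<close>

definition trunc_component :: "(nat \<Rightarrow> complex) \<Rightarrow> nat \<Rightarrow> nat \<Rightarrow> nat \<Rightarrow> complex" where
  "trunc_component f p a m = f (gcd (p ^ a) m)"

lemma norm_component_le:
  assumes "unit_disc_valued f" "prime p"
  shows "norm (local_component f p m) \<le> 1" "norm (trunc_component f p a m) \<le> 1"
  using assms unfolding local_component_def trunc_component_def unit_disc_valued_def
  by (auto simp: prime_gt_0_nat)

lemma gcd_prime_power_eq:
  fixes p m :: nat
  assumes "prime p" "\<not> p ^ (a + 1) dvd m"
  shows "gcd (p ^ a) m = p ^ multiplicity p m"
proof -
  have m: "m \<noteq> 0" using assms(2) by (cases "m = 0") auto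
  have np: "\<not> is_unit p" using assms(1) by auto
  have va: "multiplicity p m \<le> a"
    using assms(2) multiplicity_dvd'[of "a + 1" p m] by force
  obtain m' where m': "m = p ^ multiplicity p m * m'" "\<not> p dvd m'"
    using multiplicity_decompose'[OF m np] by metis
  have "coprime (p ^ (a - multiplicity p m)) m'"
    using assms(1) m'(2) by (simp add: prime_imp_coprime)
  moreover have "p ^ a = p ^ multiplicity p m * p ^ (a - multiplicity p m)"
    using va by (simp flip: power_add)
  ultimately show ?thesis
    using m'(1) by (metis coprime_iff_gcd_eq_1 gcd_mult_distrib_nat mult.right_neutral)
qed

lemma norm_local_minus_trunc_le:
  assumes "unit_disc_valued f" "prime p"
  shows "norm (local_component f p m - trunc_component f p a m) \<le> (if p ^ (a + 1) dvd m then 2 else 0)"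
proof (cases "p ^ (a + 1) dvd m")
  case True
  have "norm (local_component f p m - trunc_component f p a m) \<le> 1 + 1"
    using norm_component_le[OF assms] by (intro order_trans[OF norm_triangle_ineq4 add_mono]) auto
  with True show ?thesis by simp
next
  case False
  then show ?thesis
    using gcd_prime_power_eq[OF assms(2) False]
    by (simp add: local_component_def trunc_component_def)
qed

lemma periodic_trunc_component:
  "periodic (p ^ a) (\<lambda>n. trunc_component f p a (pval P n))"
proof -
  have "gcd (p ^ a) (pval P n) = gcd (p ^ a) (pval P (n mod p ^ a))" for n
  proof -
    have "[poly P (int n) = poly P (int (n mod p ^ a))] (mod int (p ^ a))"
      by (intro poly_cong) (simp add: cong_def zmod_int)
    then have "gcd (int (p ^ a)) (poly P (int n)) = gcd (int (p ^ a)) (poly P (int (n mod p ^ a)))"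
      using cong_gcd_eq by (metis gcd.commute)
    then have "int (gcd (p ^ a) (pval P n)) = int (gcd (p ^ a) (pval P (n mod p ^ a)))"
      by (simp add: pval_def flip: gcd_int_int_eq)
    then show ?thesis by simp
  qed
  then show ?thesis
    by (simp add: periodic_def trunc_component_def)
qed

definition period_mean :: "nat \<Rightarrow> (nat \<Rightarrow> complex) \<Rightarrow> complex" where
  "period_mean m u = (\<Sum>n<m. u n) / of_nat m"

lemma norm_period_mean_le:
  assumes "\<And>n. norm (u n) \<le> 1"
  shows "norm (period_mean m u) \<le> 1"
proof -
  have "norm (\<Sum>n<m. u n) \<le> real m"
    using sum_norm_le[of "{..<m}" u "\<lambda>_. 1"] assms by simp
  then show ?thesis
    unfolding period_mean_def by (cases "m = 0") (auto simp: norm_divide)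
qed

lemma sum_minus_period_mean_le:
  assumes "periodic m u" "m > 0" "\<And>n. norm (u n) \<le> 1" "x \<ge> 1"
  shows "norm ((\<Sum>n\<in>{1..nat \<lfloor>x\<rfloor>}. u n) - of_real x * period_mean m u) \<le> 2 * real m + 1"
proof -
  let ?N = "nat \<lfloor>x\<rfloor>"
  have N: "\<bar>real ?N - x\<bar> \<le> 1" using assms(4) by linarith
  have "(\<Sum>n\<in>{1..?N}. u n) - of_real x * period_mean m u
      = ((\<Sum>n\<in>{1..?N}. u n) - of_nat ?N * period_mean m u) + of_real (real ?N - x) * period_mean m u"
    by (simp add: algebra_simps)
  also have "norm \<dots> \<le> 2 * real m + \<bar>real ?N - x\<bar> * 1"
    using sum_periodic_approx[OF assms(1,2,3), of ?N] norm_period_mean_le[of u m, OF assms(3)]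
    unfolding period_mean_def[symmetric]
    by (intro order_trans[OF norm_triangle_ineq add_mono])
       (auto simp: norm_mult intro!: mult_left_le simp del: of_real_diff)
  also have "\<dots> \<le> 2 * real m + 1"
    using N by simp
  finally show ?thesis .
qed

definition trunc_correlation ::
  "nat \<Rightarrow> nat \<Rightarrow> (nat \<Rightarrow> complex) \<Rightarrow> int poly \<Rightarrow> (nat \<Rightarrow> complex) \<Rightarrow> int poly \<Rightarrow> complex" where
  "trunc_correlation p a f P g Q =
     period_mean (p ^ a) (\<lambda>n. trunc_component f p a (pval P n) * trunc_component g p a (pval Q n))"

text \<open>
  The approximations \<open>E a\<close> form a Cauchy sequence, so the limit of
  \<open>\<Phi>\<close> exists; without this the value of \<^const>\<open>Lim\<close> would carry
  no information.
\<close>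

lemma Lim_approx:
  fixes \<Phi> :: "real \<Rightarrow> complex"
  assumes e: "e \<longlonglongrightarrow> 0"
    and approx: "\<And>a x. x \<ge> 1 \<Longrightarrow> norm (\<Phi> x - E a) \<le> e a + K a / x"
  shows "norm (Lim at_top \<Phi> - E a) \<le> e a"
proof -
  have lim: "((\<lambda>x::real. K a / x) \<longlongrightarrow> 0) at_top" for a
    by real_asymp
  have EE: "norm (E a - E b) \<le> e a + e b" for a b
  proof (rule tendsto_lowerbound)
    show "((\<lambda>x. (e a + K a / x) + (e b + K b / x)) \<longlongrightarrow> e a + e b) at_top"
      using tendsto_add[OF tendsto_add[OF tendsto_const[of "e a"] lim[of a]]
          tendsto_add[OF tendsto_const[of "e b"] lim[of b]]] by simp
    show "\<forall>\<^sub>F x in at_top. norm (E a - E b) \<le> (e a + K a / x) + (e b + K b / x)"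
      using eventually_ge_at_top[of 1]
    proof eventually_elim
      case (elim x)
      have "norm (E a - E b) \<le> norm (\<Phi> x - E a) + norm (\<Phi> x - E b)"
        using norm_triangle_ineq4[of "\<Phi> x - E b" "\<Phi> x - E a"] by simp
      then show ?case using approx[OF elim, of a] approx[OF elim, of b] by linarith
    qed
  qed simp
  have "Cauchy E"
  proof (rule metric_CauchyI)
    fix r :: real assume "r > 0"
    then obtain M where M: "\<And>a. a \<ge> M \<Longrightarrow> norm (e a) < r / 2"
      using LIMSEQ_D[OF e, of "r / 2"] by auto
    show "\<exists>M. \<forall>m\<ge>M. \<forall>n\<ge>M. dist (E m) (E n) < r"
    proof (intro exI[of _ M] allI impI)
      fix m n assume "m \<ge> M" "n \<ge> M"
      then have "\<bar>e m\<bar> < r / 2" "\<bar>e n\<bar> < r / 2"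
        using M by auto
      then show "dist (E m) (E n) < r"
        using EE[of m n] unfolding dist_norm by linarith
    qed
  qed
  then obtain L where L: "E \<longlonglongrightarrow> L"
    using Cauchy_convergent_iff convergent_def by blast
  have EL: "norm (E a - L) \<le> e a" for a
  proof (rule tendsto_le)
    show "(\<lambda>b. norm (E a - E b)) \<longlonglongrightarrow> norm (E a - L)"
      by (intro tendsto_intros L)
    show "(\<lambda>b. e a + e b) \<longlonglongrightarrow> e a"
      using tendsto_add[OF tendsto_const[of "e a"] e] by simp
  qed (use EE in auto)
  have "(\<Phi> \<longlongrightarrow> L) at_top"
  proof (rule tendstoI)
    fix r :: real assume r: "r > 0"
    then obtain b where b: "norm (e b) < r / 4"
      using LIMSEQ_D[OF e, of "r / 4"] by auto
    have "\<forall>\<^sub>F x in at_top. dist (K b / x) 0 < r / 4"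
      using lim[of b] r by (intro tendstoD) auto
    then show "\<forall>\<^sub>F x in at_top. dist (\<Phi> x) L < r"
      using eventually_ge_at_top[of 1]
    proof eventually_elim
      case (elim x)
      have "norm (\<Phi> x - L) \<le> norm (\<Phi> x - E b) + norm (E b - L)"
        using norm_triangle_ineq[of "\<Phi> x - E b" "E b - L"] by simp
      moreover have "K b / x < r / 4" "e b < r / 4"
        using elim(1) b unfolding dist_real_def real_norm_def by linarith+
      ultimately show ?case
        using approx[OF elim(2), of b] EL[of b] r unfolding dist_norm by linarith
    qed
  qed
  then have "Lim at_top \<Phi> = L"
    by (intro tendsto_Lim) auto
  then show ?thesis
    using EL[of a] by (simp add: norm_minus_commute)
qed

lemma correlation_mean_eq:
  assumes "x \<ge> 0"
  shows "correlation_mean f P g Q x = (1 / complex_of_real x) *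
    (\<Sum>n | n \<in> {1..nat \<lfloor>x\<rfloor>} \<and> poly P (int n) * poly Q (int n) \<noteq> 0. f (pval P n) * g (pval Q n))"
proof -
  have "real n \<le> x \<longleftrightarrow> n \<le> nat \<lfloor>x\<rfloor>" for n
    using assms by (simp add: le_nat_iff le_floor_iff)
  then have "{n. 1 \<le> n \<and> real n \<le> x \<and> poly P (int n) * poly Q (int n) \<noteq> 0}
      = {n. n \<in> {1..nat \<lfloor>x\<rfloor>} \<and> poly P (int n) * poly Q (int n) \<noteq> 0}"
    by auto
  then show ?thesis
    unfolding correlation_mean_def pval_def by simp
qed

text \<open>
  For comparing a sum from which finitely many terms are omitted, here the zeros of the
  polynomials, with a complete sum.
\<close>

lemma norm_sum_omit_le:
  fixes F G :: "nat \<Rightarrow> complex"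
  assumes "finite Z" "\<And>n. norm (G n) \<le> 1"
  shows "norm ((\<Sum>n | n \<in> {1..N} \<and> n \<notin> Z. F n) - (\<Sum>n\<in>{1..N}. G n))
    \<le> real (card Z) + (\<Sum>n | n \<in> {1..N} \<and> n \<notin> Z. norm (F n - G n))"
proof -
  have "(\<Sum>n\<in>{1..N}. G n) = (\<Sum>n | n \<in> {1..N} \<and> n \<notin> Z. G n) + (\<Sum>n | n \<in> {1..N} \<and> n \<in> Z. G n)"
    by (subst sum.union_disjoint[symmetric]) (auto intro!: sum.cong)
  then have "(\<Sum>n | n \<in> {1..N} \<and> n \<notin> Z. F n) - (\<Sum>n\<in>{1..N}. G n)
      = (\<Sum>n | n \<in> {1..N} \<and> n \<notin> Z. F n - G n) - (\<Sum>n | n \<in> {1..N} \<and> n \<in> Z. G n)"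
    by (simp add: sum_subtractf)
  also have "norm \<dots> \<le> (\<Sum>n | n \<in> {1..N} \<and> n \<notin> Z. norm (F n - G n)) + real (card Z)"
  proof (intro order_trans[OF norm_triangle_ineq4 add_mono] norm_sum)
    have "norm (\<Sum>n | n \<in> {1..N} \<and> n \<in> Z. G n) \<le> real (card {n. n \<in> {1..N} \<and> n \<in> Z})"
      using sum_norm_le[of "{n. n \<in> {1..N} \<and> n \<in> Z}" G "\<lambda>_. 1"] assms by simp
    also have "\<dots> \<le> real (card Z)"
      using assms by (intro of_nat_mono card_mono) auto
    finally show "norm (\<Sum>n | n \<in> {1..N} \<and> n \<in> Z. G n) \<le> real (card Z)" .
  qed
  finally show ?thesis by simp
qed

text \<open>
  Capping the exponents at \<open>a\<close> changes a summand only if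
  \<open>p ^ (a + 1)\<close> divides \<open>poly P n\<close> or \<open>poly Q n\<close>,
  and then by at most 2. The capped summands are periodic, so their mean value is a finite
  average. This gives the existence of the limit that defines the local correlation together with
  its approximation.
\<close>

lemma norm_local_minus_trunc_correlation_le:
  assumes P: "prime_power_sparse C P" "P \<noteq> 0" and Q: "prime_power_sparse C Q" "Q \<noteq> 0"
    and f: "unit_disc_valued f" and g: "unit_disc_valued g" and p: "prime p"
  shows "norm (local_correlation p f P g Q - trunc_correlation p a f P g Q) \<le> 4 * C / real p ^ (a + 1)"
proof -
  define Z where "Z = {n::nat. poly P (int n) * poly Q (int n) = 0}"
  have fZ: "finite Z"
  proof -
    have "Z = {n. poly P (int n) = 0} \<union> {n. poly Q (int n) = 0}" by (auto simp: Z_def)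
    then show ?thesis using P Q finite_zeros by simp
  qed
  have C: "C \<ge> 1" using P by (simp add: prime_power_sparse_def)
  have p2: "real p > 1" using p prime_gt_1_nat by simp
  let ?\<Phi> = "correlation_mean (local_component f p) P (local_component g p) Q"
  let ?K = "\<lambda>a. real (card Z) + 4 * C + 2 * real (p ^ a) + 1"
  show ?thesis
    unfolding local_correlation_def
  proof (rule Lim_approx[where K = ?K and e = "\<lambda>a. 4 * C / real p ^ (a + 1)"
        and E = "\<lambda>a. trunc_correlation p a f P g Q"])
    show "(\<lambda>a. 4 * C / real p ^ (a + 1)) \<longlonglongrightarrow> 0"
    proof -
      have "(\<lambda>a. 4 * C * inverse (real p) ^ (a + 1)) \<longlonglongrightarrow> 4 * C * 0"
        using p2 by (intro tendsto_mult tendsto_const LIMSEQ_ignore_initial_segment[OF LIMSEQ_realpow_zero])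
                    (auto simp: inverse_eq_divide)
      then show ?thesis by (simp add: field_simps)
    qed
    fix a and x :: real
    assume x: "x \<ge> 1"
    define N where "N = nat \<lfloor>x\<rfloor>"
    define F where "F n = local_component f p (pval P n) * local_component g p (pval Q n)" for n
    define G where "G n = trunc_component f p a (pval P n) * trunc_component g p a (pval Q n)" for n
    have nG: "norm (G n) \<le> 1" for n
      using norm_component_le[OF f p] norm_component_le[OF g p] by (simp add: G_def norm_mult mult_le_one)
    have Nx: "real N \<le> x" using x by (simp add: N_def)
    have "norm (F n - G n) \<le> 2 * (if p ^ (a + 1) dvd pval P n then 1 else 0)
        + 2 * (if p ^ (a + 1) dvd pval Q n then 1 else 0)" for n
      unfolding F_def G_def
      using norm_mult_diff_le[OF norm_component_le(1)[OF g p] norm_component_le(2)[OF f p]]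
        norm_local_minus_trunc_le[OF f p, of "pval P n" a] norm_local_minus_trunc_le[OF g p, of "pval Q n" a]
      by (rule order_trans[OF _ add_mono[THEN order_trans]]) (auto split: if_splits)
    then have "(\<Sum>n | n \<in> {1..N} \<and> n \<notin> Z. norm (F n - G n))
        \<le> (\<Sum>n | n \<in> {1..N} \<and> n \<notin> Z. 2 * (if p ^ (a + 1) dvd pval P n then 1 else 0)
        + 2 * (if p ^ (a + 1) dvd pval Q n then 1 else 0))"
      by (rule sum_mono)
    also have "\<dots> \<le> (\<Sum>n\<in>{1..N}. 2 * (if p ^ (a + 1) dvd pval P n then 1 else 0)
        + 2 * (if p ^ (a + 1) dvd pval Q n then 1 else 0))"
      by (rule sum_mono2) auto
    also have "\<dots> \<le> 2 * (C * (real N / real p ^ (a + 1) + 1)) + 2 * (C * (real N / real p ^ (a + 1) + 1))"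
      unfolding sum.distrib sum_distrib_left[symmetric]
      by (intro add_mono mult_left_mono sum_prime_power_multiples_le P Q p) auto
    also have "\<dots> = 4 * C * (real N / real p ^ (a + 1) + 1)"
      by simp
    also have "\<dots> \<le> 4 * C * (x / real p ^ (a + 1) + 1)"
      using C Nx by (intro mult_left_mono add_mono divide_right_mono) auto
    finally have FG: "(\<Sum>n | n \<in> {1..N} \<and> n \<notin> Z. norm (F n - G n)) \<le> x * (4 * C / real p ^ (a + 1)) + 4 * C"
      by (simp add: algebra_simps)
    define S where "S = (\<Sum>n | n \<in> {1..N} \<and> n \<notin> Z. F n)"
    have "norm (S - of_real x * trunc_correlation p a f P g Q)
      \<le> norm (S - (\<Sum>n\<in>{1..N}. G n)) + norm ((\<Sum>n\<in>{1..N}. G n) - of_real x * trunc_correlation p a f P g Q)"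
      using norm_triangle_ineq[of "S - (\<Sum>n\<in>{1..N}. G n)"
          "(\<Sum>n\<in>{1..N}. G n) - of_real x * trunc_correlation p a f P g Q"] by simp
    also have "norm (S - (\<Sum>n\<in>{1..N}. G n)) \<le> real (card Z) + (x * (4 * C / real p ^ (a + 1)) + 4 * C)"
      unfolding S_def using norm_sum_omit_le[where N = N and F = F and G = G, OF fZ nG] FG by linarith
    also have "norm ((\<Sum>n\<in>{1..N}. G n) - of_real x * trunc_correlation p a f P g Q) \<le> 2 * real (p ^ a) + 1"
      unfolding trunc_correlation_def N_def G_def[symmetric]
    proof (rule sum_minus_period_mean_le[OF _ _ nG x])
      show "periodic (p ^ a) G"
        unfolding G_def[abs_def]
        by (rule periodic_binop[OF periodic_trunc_component periodic_trunc_component])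
    qed (use p prime_gt_0_nat in auto)
    finally have main: "norm (S - of_real x * trunc_correlation p a f P g Q)
        \<le> x * (4 * C / real p ^ (a + 1)) + ?K a"
      by simp
    have "?\<Phi> x = (1 / of_real x) * S"
      using x unfolding S_def F_def N_def Z_def by (subst correlation_mean_eq) auto
    then have "?\<Phi> x - trunc_correlation p a f P g Q = (1 / of_real x) * (S - of_real x * trunc_correlation p a f P g Q)"
      using x by (simp add: field_simps)
    then have "norm (?\<Phi> x - trunc_correlation p a f P g Q) = norm (S - of_real x * trunc_correlation p a f P g Q) / x"
      using x by (simp add: norm_mult norm_divide)
    also have "\<dots> \<le> (x * (4 * C / real p ^ (a + 1)) + ?K a) / x"
      using main x by (intro divide_right_mono) auto
    also have "\<dots> = 4 * C / real p ^ (a + 1) + ?K a / x"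
      using x by (simp add: add_divide_distrib)
    finally show "norm (?\<Phi> x - trunc_correlation p a f P g Q) \<le> 4 * C / real p ^ (a + 1) + ?K a / x" .
  qed
qed

lemma multiplicative_prod_components:
  assumes f: "multiplicative f" and T: "finite T" "\<And>p. p \<in> T \<Longrightarrow> prime p" "prime_factors m \<subseteq> T" and m: "m > 0"
  shows "f m = (\<Prod>p\<in>T. local_component f p m)"
proof -
  have f1: "f 1 = 1" using f by (simp add: multiplicative_def)
  have "f (\<Prod>p\<in>A. p ^ multiplicity p m) = (\<Prod>p\<in>A. local_component f p m)"
    if "finite A" "\<And>p. p \<in> A \<Longrightarrow> prime p" for A
    using that
  proof (induction A rule: finite_induct)
    case (insert p A)
    have "coprime (p ^ multiplicity p m) (\<Prod>p\<in>A. p ^ multiplicity p m)"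
      using insert by (intro prod_coprime_right) (auto intro!: primes_coprime)
    moreover have "(\<Prod>p\<in>A. p ^ multiplicity p m) > 0"
      using insert by (intro prod_pos) (auto simp: prime_gt_0_nat)
    ultimately show ?case
      using insert f by (simp add: multiplicative_def local_component_def prime_gt_0_nat)
  qed (use f1 in auto)
  from this[OF T(1,2)] have "f (\<Prod>p\<in>T. p ^ multiplicity p m) = (\<Prod>p\<in>T. local_component f p m)"
    by simp
  moreover have "(\<Prod>p\<in>T. p ^ multiplicity p m) = (\<Prod>p\<in>prime_factors m. p ^ multiplicity p m)"
    using T m by (intro prod.mono_neutral_right) (auto simp: in_prime_factors_iff intro: not_dvd_imp_multiplicity_0)
  moreover have "\<dots> = m"
    using m by (metis prime_factorization_nat)
  ultimately show ?thesis by simp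
qed

text \<open>
  The product of distinct prime divisors of \<open>m\<close> divides \<open>m\<close>.
\<close>

lemma power_card_primes_le:
  fixes b :: real
  assumes "finite A" "\<And>p. p \<in> A \<Longrightarrow> prime p \<and> p dvd m \<and> b \<le> real p" "m > 0" "b \<ge> 0"
  shows "b ^ card A \<le> real m"
proof -
  have "b ^ card A = (\<Prod>p\<in>A. b)" by simp
  also have "\<dots> \<le> (\<Prod>p\<in>A. real p)"
    using assms by (intro prod_mono) auto
  also have "\<dots> = real (\<Prod>A)" by simp
  also have "\<dots> \<le> real m"
    using assms by (intro of_nat_mono dvd_imp_le prod_primes_dvd) auto
  finally show ?thesis .
qed

section \<open>The pretentious distance and primes beyond \<open>x\<close>\<close>

text \<open>
  The distance enters the proof through these mean square bounds for \<open>f - 1\<close> over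
  the primes between \<open>ln x\<close> and \<open>x\<close> and over the large prime powers.
\<close>

lemma pretentious_dist_bounds:
  fixes f :: "nat \<Rightarrow> complex" and P :: "int poly" and x :: real
  assumes f: "unit_disc_valued f" and x: "x > 0"
  defines "D \<equiv> pretentious_dist P (\<lambda>_. 1) f (ln x) x"
  shows "D \<ge> 0"
    and "T \<subseteq> {p. prime p \<and> ln x \<le> real p \<and> real p \<le> x} \<Longrightarrow>
           (\<Sum>p\<in>T. (norm (f p - 1))\<^sup>2 / real p) \<le> 2 * D\<^sup>2"
    and "(\<Sum>q\<in>large_prime_powers P x. (norm (f q - 1))\<^sup>2) \<le> 2 * x * D\<^sup>2"
proof -
  let ?A = "{p. prime p \<and> ln x \<le> real p \<and> real p \<le> x}"
  let ?L = "large_prime_powers P x"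
  have fA: "finite ?A"
    by (rule finite_subset[OF _ finite_primes_le[of x]]) auto
  have nf: "norm (f p) \<le> 1" if "p > 0" for p
    using f that by (simp add: unit_disc_valued_def)
  have L0: "q > 0" if "q \<in> ?L" for q
    using that by (auto simp: large_prime_powers_def prime_gt_0_nat)
  define S1 where "S1 = (\<Sum>p\<in>?A. (1 - Re (f p)) / real p)"
  define S2 where "S2 = (\<Sum>q\<in>?L. (1 - Re (f q)) / x)"
  have S1: "S1 \<ge> 0"
    unfolding S1_def using nf by (intro sum_nonneg divide_nonneg_nonneg) (auto simp: prime_gt_0_nat Re_le_1_if_norm_le_1)
  have S2: "S2 \<ge> 0"
    unfolding S2_def using nf L0 x by (intro sum_nonneg divide_nonneg_nonneg) (auto simp: Re_le_1_if_norm_le_1)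
  have D: "D = sqrt (S1 + S2)"
    by (simp add: D_def pretentious_dist_def S1_def S2_def)
  show "D \<ge> 0" using D S1 S2 by simp
  have D2: "D\<^sup>2 = S1 + S2" using D S1 S2 by simp
  show "(\<Sum>p\<in>T. (norm (f p - 1))\<^sup>2 / real p) \<le> 2 * D\<^sup>2" if T: "T \<subseteq> ?A"
  proof -
    have "(\<Sum>p\<in>T. (norm (f p - 1))\<^sup>2 / real p) \<le> (\<Sum>p\<in>?A. (norm (f p - 1))\<^sup>2 / real p)"
      using T fA by (intro sum_mono2) auto
    also have "\<dots> \<le> (\<Sum>p\<in>?A. 2 * ((1 - Re (f p)) / real p))"
    proof (rule sum_mono)
      fix p assume "p \<in> ?A"
      then have "(norm (f p - 1))\<^sup>2 \<le> 2 * (1 - Re (f p))"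
        using nf by (intro norm_diff_one_sq_le) (auto simp: prime_gt_0_nat)
      then have "(norm (f p - 1))\<^sup>2 / real p \<le> 2 * (1 - Re (f p)) / real p"
        by (rule divide_right_mono) simp
      then show "(norm (f p - 1))\<^sup>2 / real p \<le> 2 * ((1 - Re (f p)) / real p)" by simp
    qed
    also have "\<dots> = 2 * S1" by (simp add: S1_def sum_distrib_left)
    finally show ?thesis using D2 S2 by simp
  qed
  have "(\<Sum>q\<in>?L. (norm (f q - 1))\<^sup>2) \<le> (\<Sum>q\<in>?L. 2 * x * ((1 - Re (f q)) / x))"
  proof (rule sum_mono)
    fix q assume "q \<in> ?L"
    then have "(norm (f q - 1))\<^sup>2 \<le> 2 * (1 - Re (f q))"
      using nf L0 by (intro norm_diff_one_sq_le) auto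
    then show "(norm (f q - 1))\<^sup>2 \<le> 2 * x * ((1 - Re (f q)) / x)"
      using x by simp
  qed
  also have "\<dots> = 2 * x * S2" by (simp add: S2_def sum_distrib_left)
  also have "\<dots> \<le> 2 * x * D\<^sup>2" using D2 S1 x by simp
  finally show "(\<Sum>q\<in>?L. (norm (f q - 1))\<^sup>2) \<le> 2 * x * D\<^sup>2" .
qed

lemma pval_le_power: "\<exists>A d. \<forall>n\<ge>1. real (pval P n) \<le> A * real n ^ d"
proof (induction P)
  case 0
  then show ?case by (intro exI[of _ 0]) (simp add: pval_def)
next
  case (pCons c P)
  then obtain A d where Ad: "\<And>n. n \<ge> 1 \<Longrightarrow> real (pval P n) \<le> A * real n ^ d" by blast
  have "real (pval (pCons c P) n) \<le> (\<bar>real_of_int c\<bar> + A) * real n ^ (d + 1)" if n: "n \<ge> 1" for n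
  proof -
    have "real (pval (pCons c P) n) = \<bar>real_of_int (c + int n * poly P (int n))\<bar>"
      by (simp add: pval_def)
    also have "\<dots> \<le> \<bar>real_of_int c\<bar> + real n * \<bar>real_of_int (poly P (int n))\<bar>"
      using abs_triangle_ineq[of "real_of_int c" "real n * real_of_int (poly P (int n))"]
      by (simp add: abs_mult)
    also have "\<bar>real_of_int (poly P (int n))\<bar> = real (pval P n)"
      by (simp add: pval_def)
    also have "\<bar>real_of_int c\<bar> + real n * real (pval P n)
        \<le> \<bar>real_of_int c\<bar> * real n ^ (d + 1) + real n * (A * real n ^ d)"
    proof (intro add_mono mult_left_mono)
      have "1 \<le> real n ^ (d + 1)" using n by (intro one_le_power) simp
      then show "\<bar>real_of_int c\<bar> \<le> \<bar>real_of_int c\<bar> * real n ^ (d + 1)"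
        using mult_left_mono[of 1 "real n ^ (d + 1)" "\<bar>real_of_int c\<bar>"] by simp
    qed (use Ad[OF n] in auto)
    finally show ?thesis by (simp add: algebra_simps)
  qed
  then show ?case by blast
qed

text \<open>
  A nonzero value of \<open>P\<close> at some \<open>n \<le> x\<close> is at most
  \<open>|A| x ^ d\<close>, so for \<open>x > |A|\<close> it has at most \<open>d\<close>
  prime factors \<open>p \<ge> x\<close>, each of which determines one exact prime power.
\<close>

lemma card_large_prime_powers_le:
  fixes P :: "int poly"
  shows "\<exists>K\<ge>0. \<exists>x0::real. \<forall>x\<ge>x0. real (card (large_prime_powers P x)) \<le> K * x"
proof -
  obtain A d where A: "\<And>n. n \<ge> 1 \<Longrightarrow> real (pval P n) \<le> A * real n ^ d"
    using pval_le_power by blast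
  have "real (card (large_prime_powers P x)) \<le> real d * x" if x: "x \<ge> \<bar>A\<bar> + 1" for x
  proof -
    define N where "N = nat \<lfloor>x\<rfloor>"
    have x1: "x \<ge> 1" using x by simp
    define B where "B n = {p. prime p \<and> x \<le> real p \<and> p dvd pval P n}" for n
    define G where "G = {n \<in> {1..N}. pval P n \<noteq> 0}"
    have fB: "finite (B n)" and cB: "card (B n) \<le> d" if n: "n \<in> G" for n
    proof -
      have n': "n \<ge> 1" "n \<le> N" "pval P n > 0" using n by (auto simp: G_def)
      have "B n \<subseteq> prime_factors (pval P n)"
        using n' by (auto simp: B_def in_prime_factors_iff)
      then show f: "finite (B n)" by (rule finite_subset) simp
      show "card (B n) \<le> d"
      proof (rule ccontr)
        assume "\<not> card (B n) \<le> d"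
        then have "x ^ (d + 1) \<le> x ^ card (B n)"
          using x1 by (intro power_increasing) auto
        also have "\<dots> \<le> real (pval P n)"
          using f n' x1 by (intro power_card_primes_le) (auto simp: B_def)
        also have "\<dots> \<le> A * real n ^ d" using n' by (intro A)
        also have "\<dots> \<le> \<bar>A\<bar> * x ^ d"
          using n' x1 by (intro mult_mono power_mono) (auto simp: N_def le_nat_iff le_floor_iff)
        finally have "x * x ^ d \<le> \<bar>A\<bar> * x ^ d" by simp
        then have "x \<le> \<bar>A\<bar>" using x1 by simp
        then show False using x by simp
      qed
    qed
    have "large_prime_powers P x \<subseteq> (\<Union>n\<in>G. (\<lambda>p. p ^ multiplicity p (pval P n)) ` B n)"
    proof
      fix q assume "q \<in> large_prime_powers P x"
      then obtain p k n where q: "q = p ^ k" "prime p" "k \<ge> 1" "real p \<ge> x" "1 \<le> n" "real n \<le> x"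
        "p ^ k dvd pval P n" "\<not> p ^ (k + 1) dvd pval P n"
        unfolding large_prime_powers_def dvd_pval_iff by blast
      have n0: "pval P n \<noteq> 0" using q(8) by (metis dvd_0_right)
      have "multiplicity p (pval P n) = k"
        using q by (intro multiplicity_eqI) auto
      moreover have "p dvd pval P n"
        using q(3) by (intro dvd_trans[OF dvd_power q(7)]) auto
      moreover have "n \<in> G"
        using q n0 x1 by (auto simp: G_def N_def le_nat_iff le_floor_iff)
      ultimately show "q \<in> (\<Union>n\<in>G. (\<lambda>p. p ^ multiplicity p (pval P n)) ` B n)"
        using q by (auto simp: B_def intro!: bexI[of _ n] image_eqI[of _ _ p])
    qed
    then have "card (large_prime_powers P x) \<le> card (\<Union>n\<in>G. (\<lambda>p. p ^ multiplicity p (pval P n)) ` B n)"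
      using fB by (intro card_mono) (auto simp: G_def)
    also have "\<dots> \<le> (\<Sum>n\<in>G. card ((\<lambda>p. p ^ multiplicity p (pval P n)) ` B n))"
      by (intro card_UN_le) (auto simp: G_def)
    also have "\<dots> \<le> (\<Sum>n\<in>G. d)"
      using fB cB by (intro sum_mono) (meson card_image_le le_trans)
    also have "\<dots> \<le> N * d"
    proof -
      have "card G \<le> card {1..N}" unfolding G_def by (intro card_mono) auto
      then show ?thesis by simp
    qed
    finally have "real (card (large_prime_powers P x)) \<le> real (N * d)"
      by (simp only: of_nat_le_iff)
    also have "\<dots> = real N * real d" by simp
    also have "\<dots> \<le> x * real d" using x1 by (intro mult_right_mono) (auto simp: N_def)
    finally show ?thesis by (simp add: mult.commute)
  qed
  then show ?thesis by (intro exI[of _ "real d"] conjI exI[of _ "\<bar>A\<bar> + 1"]) auto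
qed

text \<open>
  A prime \<open>p > x\<close> that divides \<open>poly P n\<close> yields an exact prime
  power \<open>q\<close> in the set of large prime powers. Since \<open>q \<ge> x\<close>, it
  divides the values of \<open>P\<close> at no more than \<open>2 C\<close> integers up to
  \<open>x\<close>. So the double sum is at most \<open>2 C\<close> times the sum of
  \<open>|f q - 1|\<close> over \<open>O(x)\<close> prime powers, and the Cauchy-Schwarz
  inequality bounds it by the distance.
\<close>

lemma sum_large_components_le:
  assumes sp: "prime_power_sparse C P"
  shows "\<exists>K\<ge>0. \<exists>x0::real. \<forall>f x. unit_disc_valued f \<longrightarrow> x \<ge> x0 \<longrightarrow>
    (\<Sum>n | n \<in> {1..nat \<lfloor>x\<rfloor>} \<and> pval P n \<noteq> 0.
       \<Sum>p | p \<in> prime_factors (pval P n) \<and> real p > x. norm (local_component f p (pval P n) - 1))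
    \<le> K * x * pretentious_dist P (\<lambda>_. 1) f (ln x) x"
proof -
  obtain K0 x0 where K0: "K0 \<ge> 0" "\<And>x. x \<ge> x0 \<Longrightarrow> real (card (large_prime_powers P x)) \<le> K0 * x"
    using card_large_prime_powers_le[of P] by blast
  have C: "C \<ge> 1" using sp by (simp add: prime_power_sparse_def)
  have main: "(\<Sum>n | n \<in> {1..nat \<lfloor>x\<rfloor>} \<and> pval P n \<noteq> 0.
       \<Sum>p | p \<in> prime_factors (pval P n) \<and> real p > x. norm (local_component f p (pval P n) - 1))
    \<le> 2 * C * sqrt (2 * K0) * x * pretentious_dist P (\<lambda>_. 1) f (ln x) x"
    if f: "unit_disc_valued f" and x: "x \<ge> max 1 x0" for f x
  proof -
    define D where "D = pretentious_dist P (\<lambda>_. 1) f (ln x) x"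
    define N where "N = nat \<lfloor>x\<rfloor>"
    define L where "L = large_prime_powers P x"
    define s where "s q = norm (f q - 1)" for q
    have fL: "finite L" unfolding L_def by (rule finite_large_prime_powers)
    have x1: "x \<ge> 1" using x by simp
    have Nx: "real N \<le> x" using x1 by (simp add: N_def)
    have inner: "(\<Sum>p | p \<in> prime_factors (pval P n) \<and> real p > x. norm (local_component f p (pval P n) - 1))
        \<le> (\<Sum>q\<in>L. s q * (if q dvd pval P n then 1 else 0))"
      if n: "n \<in> {1..N}" "pval P n \<noteq> 0" for n
    proof -
      define B where "B = {p. p \<in> prime_factors (pval P n) \<and> real p > x}"
      define h where "h p = p ^ multiplicity p (pval P n)" for p
      have B: "prime p" "multiplicity p (pval P n) \<ge> 1" if "p \<in> B" for p
        using that by (auto simp: B_def in_prime_factors_iff prime_factors_multiplicity)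
      \<comment> \<open>For fixed \<open>n\<close>, a prime is recovered from its exact power.\<close>
      have inj: "inj_on h B"
      proof (rule inj_onI)
        fix p q assume pq: "p \<in> B" "q \<in> B" "h p = h q"
        have "p dvd h p" using B[OF pq(1)] by (auto simp: h_def)
        then have "p dvd q"
          using pq B unfolding h_def by (metis prime_dvd_power)
        then show "p = q" using B pq by (simp add: primes_dvd_imp_eq)
      qed
      have "h p \<in> L" "h p dvd pval P n" if "p \<in> B" for p
      proof -
        show d: "h p dvd pval P n" unfolding h_def by (rule multiplicity_dvd)
        have "\<not> p ^ (multiplicity p (pval P n) + 1) dvd pval P n"
          using n(2) B[OF that] by (subst power_dvd_iff_le_multiplicity) auto
        moreover have "real n \<le> x" "1 \<le> n"
          using n(1) Nx by auto
        moreover have "real p \<ge> x" using that by (simp add: B_def)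
        ultimately show "h p \<in> L"
          using B[OF that] d unfolding L_def large_prime_powers_def dvd_pval_iff[symmetric] h_def by blast
      qed
      then have sub: "h ` B \<subseteq> {q \<in> L. q dvd pval P n}" by auto
      have "(\<Sum>p\<in>B. norm (local_component f p (pval P n) - 1)) = (\<Sum>p\<in>B. s (h p))"
        by (simp add: s_def h_def local_component_def)
      also have "\<dots> = (\<Sum>q\<in>h ` B. s q)"
        by (simp add: sum.reindex[OF inj])
      also have "\<dots> \<le> (\<Sum>q | q \<in> L \<and> q dvd pval P n. s q)"
        using sub fL by (intro sum_mono2) (auto simp: s_def)
      also have "\<dots> = (\<Sum>q\<in>L. s q * (if q dvd pval P n then 1 else 0))"
        using fL by (intro sum.mono_neutral_cong_left) auto
      finally show ?thesis by (simp add: B_def)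
    qed
    have "(\<Sum>n | n \<in> {1..N} \<and> pval P n \<noteq> 0.
       \<Sum>p | p \<in> prime_factors (pval P n) \<and> real p > x. norm (local_component f p (pval P n) - 1))
      \<le> (\<Sum>n | n \<in> {1..N} \<and> pval P n \<noteq> 0. \<Sum>q\<in>L. s q * (if q dvd pval P n then 1 else 0))"
      using inner by (intro sum_mono) auto
    also have "\<dots> \<le> (\<Sum>n\<in>{1..N}. \<Sum>q\<in>L. s q * (if q dvd pval P n then 1 else 0))"
      by (intro sum_mono2 sum_nonneg) (auto simp: s_def)
    also have "\<dots> = (\<Sum>q\<in>L. s q * (\<Sum>n\<in>{1..N}. if q dvd pval P n then 1 else 0))"
      by (subst sum.swap) (simp add: sum_distrib_left)
    also have "\<dots> \<le> (\<Sum>q\<in>L. s q * (2 * C))"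
    proof (intro sum_mono mult_left_mono)
      fix q assume "q \<in> L"
      then obtain p k where q: "q = p ^ k" "prime p" "k \<ge> 1" "real p \<ge> x"
        by (auto simp: L_def large_prime_powers_def)
      have "real p ^ 1 \<le> real p ^ k"
        using q prime_ge_1_nat[of p] by (intro power_increasing) auto
      then have "real N \<le> real p ^ k" using q Nx by simp
      then have "real N / real p ^ k \<le> 1"
        using q prime_gt_0_nat[of p] by simp
      then have "C * (real N / real p ^ k + 1) \<le> C * 2"
        using C by (intro mult_left_mono) auto
      then show "(\<Sum>n\<in>{1..N}. if q dvd pval P n then 1 else 0) \<le> 2 * C"
        using sum_prime_power_multiples_le[OF sp q(2), of k N] q(1) by simp
    qed (auto simp: s_def)
    also have "\<dots> = 2 * C * (\<Sum>q\<in>L. s q)"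
      by (simp flip: sum_distrib_right)
    also have "(\<Sum>q\<in>L. s q) \<le> sqrt (2 * K0) * x * D"
    proof (rule power2_le_imp_le)
      have "(\<Sum>q\<in>L. s q)\<^sup>2 = (\<Sum>q\<in>L. s q * 1)\<^sup>2" by simp
      also have "\<dots> \<le> (\<Sum>q\<in>L. (s q)\<^sup>2) * (\<Sum>q\<in>L. 1\<^sup>2)"
        by (rule Cauchy_Schwarz_ineq_sum)
      also have "\<dots> \<le> (2 * x * D\<^sup>2) * (K0 * x)"
      proof (intro mult_mono)
        show "(\<Sum>q\<in>L. (s q)\<^sup>2) \<le> 2 * x * D\<^sup>2"
          unfolding s_def L_def D_def using x1 by (intro pretentious_dist_bounds(3) f) auto
        show "(\<Sum>q\<in>L. 1\<^sup>2) \<le> K0 * x"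
          using K0(2)[of x] x by (simp add: L_def)
      qed (use x1 in auto)
      also have "\<dots> = (sqrt (2 * K0) * x * D)\<^sup>2"
        using K0(1) by (simp add: power_mult_distrib power2_eq_square[of x])
      finally show "(\<Sum>q\<in>L. s q)\<^sup>2 \<le> (sqrt (2 * K0) * x * D)\<^sup>2" .
      show "0 \<le> sqrt (2 * K0) * x * D"
        using K0(1) x1 pretentious_dist_bounds(1)[OF f, of x P] by (auto simp: D_def)
    qed
    finally show ?thesis
      using C by (simp add: N_def D_def mult_ac)
  qed
  show ?thesis
    by (rule exI[of _ "2 * C * sqrt (2 * K0)"], intro conjI exI[of _ "max 1 x0"] allI impI main)
       (use C K0 in auto)
qed

text \<open>
  A weak form of Mertens' theorem by double counting: a prime \<open>p \<le> x\<close> has at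
  least \<open>x / (2 p)\<close> multiples up to \<open>x\<close>, whereas an integer up to
  \<open>x < w ^ m\<close> has fewer than \<open>m\<close> prime factors that are at least
  \<open>w\<close>.
\<close>

lemma sum_reciprocal_primes_le:
  assumes x: "x \<ge> 1" and w: "w \<ge> 1" "x < w ^ m" and U: "U \<subseteq> {p. prime p \<and> w \<le> real p \<and> real p \<le> x}"
  shows "(\<Sum>p\<in>U. 1 / real p) \<le> 2 * real m"
proof -
  define N where "N = nat \<lfloor>x\<rfloor>"
  have fU: "finite U" by (rule finite_subset[OF U]) (rule finite_subset[OF _ finite_primes_le[of x]], auto)
  have Nx: "real N \<le> x" using x by (simp add: N_def)
  have "x * (\<Sum>p\<in>U. 1 / real p) = (\<Sum>p\<in>U. 2 * (x / (2 * real p)))"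
    by (simp add: sum_distrib_left)
  also have "\<dots> \<le> (\<Sum>p\<in>U. 2 * (\<Sum>n\<in>{1..N}. if p dvd n then 1 else 0))"
  proof (intro sum_mono mult_left_mono)
    fix p assume "p \<in> U"
    then have p: "p > 0" "real p \<le> x" using U by (auto simp: prime_gt_0_nat)
    define k where "k = nat \<lfloor>x / real p\<rfloor>"
    have xp: "x / real p \<ge> 1" using p by simp
    have k: "real k \<ge> x / (2 * real p)"
    proof -
      have fl: "\<lfloor>x / real p\<rfloor> \<ge> 1" using xp by simp
      then have "real k = of_int \<lfloor>x / real p\<rfloor>" by (simp add: k_def)
      then have "real k \<ge> 1" "real k > x / real p - 1"
        using fl real_of_int_floor_gt_diff_one[of "x / real p"] by simp_all
      moreover have "x / (2 * real p) = (x / real p) / 2" by simp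
      ultimately show ?thesis by linarith
    qed
    have "real k \<le> x / real p" using xp by (simp add: k_def)
    then have "real k * real p \<le> x" using p by (simp add: field_simps)
    then have kp: "p * k \<le> N"
      unfolding N_def using x by (simp add: le_nat_iff le_floor_iff mult.commute)
    have "(\<lambda>i. p * i) ` {1..k} \<subseteq> {n \<in> {1..N}. p dvd n}"
    proof
      fix n assume "n \<in> (\<lambda>i. p * i) ` {1..k}"
      then obtain i where i: "n = p * i" "i \<in> {1..k}" by blast
      have "n \<le> N" using i by (intro order_trans[OF _ kp]) simp
      then show "n \<in> {n \<in> {1..N}. p dvd n}" using i p by simp
    qed
    then have "card ((\<lambda>i. p * i) ` {1..k}) \<le> card {n \<in> {1..N}. p dvd n}"
      by (intro card_mono) auto
    then have "k \<le> card {n \<in> {1..N}. p dvd n}"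
      using p by (simp add: card_image inj_on_def)
    then have "real k \<le> (\<Sum>n\<in>{1..N}. if p dvd n then 1 else 0)"
      by (simp add: sum.If_cases Int_def)
    then show "x / (2 * real p) \<le> (\<Sum>n\<in>{1..N}. if p dvd n then 1 else 0)"
      using k by linarith
  qed auto
  also have "\<dots> = 2 * (\<Sum>n\<in>{1..N}. \<Sum>p\<in>U. if p dvd n then 1 else 0)"
    by (subst sum.swap) (simp add: sum_distrib_left)
  also have "\<dots> \<le> 2 * (\<Sum>n\<in>{1..N}. real m)"
  proof (intro mult_left_mono sum_mono)
    fix n assume n: "n \<in> {1..N}"
    define A where "A = {p \<in> U. p dvd n}"
    have "card A < m"
    proof (rule ccontr)
      assume "\<not> card A < m"
      then have "w ^ m \<le> w ^ card A" using w by (intro power_increasing) auto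
      also have "\<dots> \<le> real n"
        using n w U fU by (intro power_card_primes_le) (auto simp: A_def)
      also have "\<dots> \<le> x" using n Nx by auto
      finally show False using w by simp
    qed
    then show "(\<Sum>p\<in>U. if p dvd n then 1 else 0) \<le> real m"
      using fU by (simp add: sum.If_cases Int_def A_def)
  qed auto
  also have "\<dots> \<le> x * (2 * real m)"
    using Nx by (simp add: mult_right_mono)
  finally show ?thesis using x by simp
qed

section \<open>The Turan-Kubilius inequality\<close>

definition root_density :: "int poly \<Rightarrow> nat \<Rightarrow> real" where
  "root_density P p = real (card {n. n < p \<and> p dvd pval P n}) / real p"

lemma root_density_bounds:
  assumes "prime_power_sparse C P" "prime p"
  shows "0 \<le> root_density P p" "root_density P p \<le> 1" "root_density P p \<le> 2 * C / real p"
proof -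
  have p: "real p > 0" using assms(2) by (simp add: prime_gt_0_nat)
  show "0 \<le> root_density P p" by (simp add: root_density_def)
  have "card {n. n < p \<and> p dvd pval P n} \<le> card {..<p}"
    by (intro card_mono) auto
  then show "root_density P p \<le> 1"
    using p by (simp add: root_density_def)
  have "card {n. n < p \<and> p dvd pval P n} \<le> card {n. n \<le> p \<and> p ^ 1 dvd pval P n}"
    by (intro card_mono) auto
  then have "real (card {n. n < p \<and> p dvd pval P n}) \<le> real (card {n. n \<le> p \<and> p ^ 1 dvd pval P n})"
    by (simp only: of_nat_le_iff)
  also have "\<dots> \<le> C * (real p / real p ^ 1 + 1)"
    using assms by (auto simp only: prime_power_sparse_def)
  also have "\<dots> = 2 * C" using p by simp
  finally show "root_density P p \<le> 2 * C / real p"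
    unfolding root_density_def using p by (intro divide_right_mono) auto
qed

lemma trunc_component_1:
  assumes "multiplicative f" "prime p"
  shows "trunc_component f p 1 m = 1 + (f p - 1) * of_bool (p dvd m)"
proof (cases "p dvd m")
  case True
  then show ?thesis by (simp add: trunc_component_def gcd_nat.absorb1)
next
  case False
  then have "gcd p m = 1"
    using assms(2) by (simp add: prime_imp_coprime flip: coprime_iff_gcd_eq_1)
  then show ?thesis
    using assms False by (simp add: trunc_component_def multiplicative_def)
qed

definition centred_indicator :: "int poly \<Rightarrow> nat \<Rightarrow> nat \<Rightarrow> complex" where
  "centred_indicator P p n = of_bool (p dvd pval P n) - of_real (root_density P p)"

lemma periodic_dvd_pval: "periodic p (\<lambda>n. p dvd pval P n)"
  unfolding periodic_def dvd_pval_iff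
proof
  fix n
  have "[poly P (int n) = poly P (int (n mod p))] (mod int p)"
    by (intro poly_cong) (simp add: cong_def zmod_int)
  then show "int p dvd poly P (int n) \<longleftrightarrow> int p dvd poly P (int (n mod p))"
    by (rule cong_dvd_iff)
qed

lemma periodic_centred_indicator: "periodic p (centred_indicator P p)"
  using periodic_dvd_pval[of p P] by (simp add: periodic_def centred_indicator_def)

lemma sum_centred_indicator:
  assumes "p > 0"
  shows "(\<Sum>n<p. centred_indicator P p n) = 0"
proof -
  have "(\<Sum>n<p. of_bool (p dvd pval P n) :: complex) = of_nat (card {n. n < p \<and> p dvd pval P n})"
    by (simp add: of_bool_def sum.If_cases Int_def lessThan_def)
  then show ?thesis
    using assms by (simp add: centred_indicator_def sum_subtractf root_density_def)
qed

lemma norm_centred_indicator: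
  assumes "prime_power_sparse C P" "prime p"
  shows "norm (centred_indicator P p n) \<le> 1"
    "(norm (centred_indicator P p n))\<^sup>2 \<le> (if p dvd pval P n then 1 else 0) + root_density P p"
proof -
  define t where "t = root_density P p"
  have t: "0 \<le> t" "t \<le> 1" using root_density_bounds[OF assms] by (simp_all add: t_def)
  have "centred_indicator P p n = of_real (of_bool (p dvd pval P n) - t)"
    by (simp add: centred_indicator_def t_def)
  then have n: "norm (centred_indicator P p n) = \<bar>of_bool (p dvd pval P n) - t\<bar>"
    by (simp only: norm_of_real)
  show "norm (centred_indicator P p n) \<le> 1"
    unfolding n using t by auto
  have "t * t \<le> t * 1" "t * t \<le> 1 * 1" using t by (intro mult_mono; simp)+
  then show "(norm (centred_indicator P p n))\<^sup>2 \<le> (if p dvd pval P n then 1 else 0) + root_density P p"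
    unfolding n t_def[symmetric] using t by (auto simp: power2_eq_square algebra_simps)
qed

text \<open>
  For \<open>p \<noteq> q\<close> the product has mean zero over the period \<open>p q\<close>
  by the Chinese remainder theorem, and an incomplete period remains. For \<open>p = q\<close>
  the sum is governed by the number of roots modulo \<open>p\<close>.
\<close>

lemma sum_centred_indicator_mult:
  assumes sp: "prime_power_sparse C P" and pq: "prime p" "prime q" and N: "real N \<le> x" and px: "real p \<le> x"
  shows "norm (\<Sum>n\<in>{1..N}. centred_indicator P p n * centred_indicator P q n)
    \<le> (if p = q then 4 * C * x / real p else 2 * (real p * real q))"
proof (cases "p = q")
  case True
  have p: "real p > 0" using pq by (simp add: prime_gt_0_nat)
  have C: "C \<ge> 1" using sp by (simp add: prime_power_sparse_def)
  have "norm (\<Sum>n\<in>{1..N}. centred_indicator P p n * centred_indicator P p n)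
      \<le> (\<Sum>n\<in>{1..N}. (if p ^ 1 dvd pval P n then 1 else 0) + root_density P p)"
    using norm_centred_indicator(2)[OF sp pq(1)]
    by (intro sum_norm_le) (auto simp: norm_mult power2_eq_square)
  also have "\<dots> = (\<Sum>n\<in>{1..N}. if p ^ 1 dvd pval P n then 1 else 0) + real N * root_density P p"
    by (simp add: sum.distrib)
  also have "\<dots> \<le> C * (x / real p + x / real p) + x * (2 * C / real p)"
  proof (intro add_mono mult_mono)
    have "real N / real p ^ 1 + 1 \<le> x / real p + x / real p"
      using N px p by (intro add_mono) (auto simp: divide_right_mono)
    then have "C * (real N / real p ^ 1 + 1) \<le> C * (x / real p + x / real p)"
      using C by (intro mult_left_mono) auto
    then show "(\<Sum>n\<in>{1..N}. if p ^ 1 dvd pval P n then 1 else 0) \<le> C * (x / real p + x / real p)"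
      using sum_prime_power_multiples_le[OF sp pq(1), of 1 N] by linarith
  qed (use root_density_bounds[OF sp pq(1)] N p px in auto)
  also have "\<dots> = 4 * C * x / real p" by (simp add: field_simps)
  finally show ?thesis using True by simp
next
  case False
  have cop: "coprime p q" using False pq by (simp add: primes_coprime)
  have pq0: "p > 0" "q > 0" using pq by (auto simp: prime_gt_0_nat)
  have "periodic (p * q) (\<lambda>n. centred_indicator P p n * centred_indicator P q n)"
    by (rule periodic_binop[OF periodic_multiple[OF periodic_centred_indicator]
          periodic_multiple[OF periodic_centred_indicator]]) auto
  moreover have "norm (centred_indicator P p n * centred_indicator P q n) \<le> 1" for n
    using norm_centred_indicator(1)[OF sp] pq by (simp add: norm_mult mult_le_one)
  ultimately have "norm ((\<Sum>n\<in>{1..N}. centred_indicator P p n * centred_indicator P q n)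
      - of_nat N * ((\<Sum>n<p * q. centred_indicator P p n * centred_indicator P q n) / of_nat (p * q)))
    \<le> 2 * real (p * q)"
    using pq0 by (intro sum_periodic_approx) auto
  then show ?thesis
    using False sum_product_coprime_periods[OF cop pq0 periodic_centred_indicator periodic_centred_indicator, of P P]
      sum_centred_indicator[OF pq0(1), of P] by simp
qed

text \<open>
  The Turan-Kubilius inequality for values of polynomials. After expanding the square, the
  diagonal \<open>p = q\<close> gives the first term on the right. The at most
  \<open>w\<^sup>2\<close> other pairs contribute at most \<open>8 w\<^sup>2\<close> each, which
  is harmless as long as \<open>w\<close> is a small power of \<open>x\<close>.
\<close>

lemma turan_kubilius:
  assumes sp: "prime_power_sparse C P" and T: "T \<subseteq> {p. prime p \<and> real p \<le> w}" and w: "w \<le> x" "w \<ge> 0"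
    and c: "\<And>p. p \<in> T \<Longrightarrow> norm (c p) \<le> 2" and N: "real N \<le> x"
  shows "(\<Sum>n\<in>{1..N}. (norm (\<Sum>p\<in>T. c p * centred_indicator P p n))\<^sup>2)
    \<le> 4 * C * x * (\<Sum>p\<in>T. (norm (c p))\<^sup>2 / real p) + 8 * w ^ 4"
proof -
  let ?u = "centred_indicator P"
  have fT: "finite T" by (rule finite_subset[OF T finite_primes_le])
  have T': "prime p" "real p \<le> w" "real p \<le> x" if "p \<in> T" for p
    using that T w by auto
  \<comment> \<open>The centred indicators are real, so squared norms expand into plain products.\<close>
  have cnju: "cnj (?u p n) = ?u p n" for p n
    by (simp add: centred_indicator_def)
  have "T \<subseteq> {1..nat \<lfloor>w\<rfloor>}"
  proof
    fix p assume "p \<in> T"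
    then show "p \<in> {1..nat \<lfloor>w\<rfloor>}"
      using T'(1,2)[of p] prime_ge_1_nat[of p] by (simp add: le_nat_floor)
  qed
  then have "card T \<le> nat \<lfloor>w\<rfloor>"
    using card_mono[of "{1..nat \<lfloor>w\<rfloor>}" T] by simp
  then have cT: "real (card T) \<le> w" using w(2) by linarith
  have "complex_of_real (\<Sum>n\<in>{1..N}. (norm (\<Sum>p\<in>T. c p * ?u p n))\<^sup>2)
      = (\<Sum>n\<in>{1..N}. (\<Sum>p\<in>T. c p * ?u p n) * cnj (\<Sum>q\<in>T. c q * ?u q n))"
    unfolding of_real_sum complex_norm_square ..
  also have "\<dots> = (\<Sum>n\<in>{1..N}. \<Sum>p\<in>T. \<Sum>q\<in>T. c p * cnj (c q) * (?u p n * ?u q n))"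
    by (simp add: cnj_sum cnju sum_product mult_ac)
  also have "\<dots> = (\<Sum>p\<in>T. \<Sum>n\<in>{1..N}. \<Sum>q\<in>T. c p * cnj (c q) * (?u p n * ?u q n))"
    by (rule sum.swap)
  also have "\<dots> = (\<Sum>p\<in>T. \<Sum>q\<in>T. \<Sum>n\<in>{1..N}. c p * cnj (c q) * (?u p n * ?u q n))"
    by (intro sum.cong refl sum.swap)
  also have "\<dots> = (\<Sum>p\<in>T. \<Sum>q\<in>T. c p * cnj (c q) * (\<Sum>n\<in>{1..N}. ?u p n * ?u q n))"
    by (simp only: sum_distrib_left)
  finally have eq: "complex_of_real (\<Sum>n\<in>{1..N}. (norm (\<Sum>p\<in>T. c p * ?u p n))\<^sup>2)
      = (\<Sum>p\<in>T. \<Sum>q\<in>T. c p * cnj (c q) * (\<Sum>n\<in>{1..N}. ?u p n * ?u q n))" .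
  have "(\<Sum>n\<in>{1..N}. (norm (\<Sum>p\<in>T. c p * ?u p n))\<^sup>2)
      = norm (complex_of_real (\<Sum>n\<in>{1..N}. (norm (\<Sum>p\<in>T. c p * ?u p n))\<^sup>2))"
    unfolding norm_of_real by (intro abs_of_nonneg[symmetric] sum_nonneg) auto
  also have "\<dots> \<le> (\<Sum>p\<in>T. \<Sum>q\<in>T. norm (c p * cnj (c q) * (\<Sum>n\<in>{1..N}. ?u p n * ?u q n)))"
    unfolding eq by (intro order_trans[OF norm_sum] sum_mono norm_sum)
  also have "\<dots> \<le> (\<Sum>p\<in>T. \<Sum>q\<in>T. (if q = p then 4 * C * x * ((norm (c p))\<^sup>2 / real p) else 0) + 8 * w\<^sup>2)"
  proof (intro sum_mono)
    fix p q assume pq: "p \<in> T" "q \<in> T"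
    note u = sum_centred_indicator_mult[OF sp T'(1)[OF pq(1)] T'(1)[OF pq(2)] N T'(3)[OF pq(1)]]
    show "norm (c p * cnj (c q) * (\<Sum>n\<in>{1..N}. ?u p n * ?u q n))
        \<le> (if q = p then 4 * C * x * ((norm (c p))\<^sup>2 / real p) else 0) + 8 * w\<^sup>2"
    proof (cases "q = p")
      case True
      have "norm (c p * cnj (c q) * (\<Sum>n\<in>{1..N}. ?u p n * ?u q n))
          \<le> (norm (c p))\<^sup>2 * (4 * C * x / real p)"
        unfolding norm_mult complex_mod_cnj True power2_eq_square
        using u True by (intro mult_left_mono) auto
      also have "\<dots> = 4 * C * x * ((norm (c p))\<^sup>2 / real p)" by simp
      finally show ?thesis using True by (simp add: add_increasing2)
    next
      case False
      have "norm (c p * cnj (c q) * (\<Sum>n\<in>{1..N}. ?u p n * ?u q n))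
          \<le> (2 * 2) * (2 * (w * w))"
        unfolding norm_mult complex_mod_cnj
      proof (intro mult_mono)
        have "norm (\<Sum>n\<in>{1..N}. ?u p n * ?u q n) \<le> 2 * (real p * real q)"
          using u False by simp
        also have "\<dots> \<le> 2 * (w * w)"
          using T'(2) pq by (intro mult_left_mono mult_mono) (use w in auto)
        finally show "norm (\<Sum>n\<in>{1..N}. ?u p n * ?u q n) \<le> 2 * (w * w)" .
      qed (use c pq in auto)
      then show ?thesis using False by (simp add: power2_eq_square)
    qed
  qed
  also have "\<dots> = (\<Sum>p\<in>T. 4 * C * x * ((norm (c p))\<^sup>2 / real p)) + real (card T) * (real (card T) * (8 * w\<^sup>2))"
    using fT by (simp add: sum.distrib sum.delta)
  also have "\<dots> \<le> 4 * C * x * (\<Sum>p\<in>T. (norm (c p))\<^sup>2 / real p) + w * (w * (8 * w\<^sup>2))"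
    using cT w by (intro add_mono mult_mono) (auto simp: sum_distrib_left)
  also have "w * (w * (8 * w\<^sup>2)) = 8 * w ^ 4"
    by (simp add: power2_eq_square power4_eq_xxxx)
  finally show ?thesis .
qed

section \<open>Primes between \<open>ln x\<close> and \<open>x\<close>\<close>

text \<open>
  The mean value of the exponent: the sum of \<open>f p - 1\<close> over the primes
  \<open>ln x < p \<le> x powr (1 / 8)\<close> that divide \<open>poly P n\<close>. The
  cut at \<open>x powr (1 / 8)\<close> makes the error \<open>8 w ^ 4\<close> in the
  Turan-Kubilius inequality as small as \<open>8 sqrt x\<close>.
\<close>

definition mid_exponent :: "(nat \<Rightarrow> complex) \<Rightarrow> int poly \<Rightarrow> real \<Rightarrow> complex" where
  "mid_exponent f P x =
     (\<Sum>p | prime p \<and> ln x < real p \<and> real p \<le> x powr (1 / 8). (f p - 1) * of_real (root_density P p))"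

lemma Re_mid_exponent_le:
  assumes "prime_power_sparse C P" "unit_disc_valued f"
  shows "Re (mid_exponent f P x) \<le> 0"
proof -
  have "Re ((f p - 1) * of_real (root_density P p)) \<le> 0" if "prime p" for p
    using that assms root_density_bounds(1)[OF assms(1) that] Re_le_1_if_norm_le_1[of "f p"]
    by (auto simp: unit_disc_valued_def prime_gt_0_nat mult_le_0_iff)
  then show ?thesis
    unfolding mid_exponent_def Re_sum by (intro sum_nonpos) auto
qed

text \<open>
  The squares are compared with the telescoping series of
  \<open>1 / (n - 1) - 1 / n\<close>. The factor 2 absorbs the passage from
  \<open>y\<close> to its integer part.
\<close>

lemma sum_inverse_squares_le:
  assumes "finite T" "\<And>n. n \<in> T \<Longrightarrow> y < real n" "y \<ge> 1"
  shows "(\<Sum>n\<in>T. 1 / (real n)\<^sup>2) \<le> 2 / y"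
proof -
  define m where "m = nat \<lfloor>y\<rfloor>"
  have m: "m \<ge> 1" "real m \<le> y" "y < real m + 1"
    using assms(3) unfolding m_def by linarith+
  have *: "(\<Sum>n\<in>{m<..M}. 1 / (real n)\<^sup>2) \<le> 1 / real m - 1 / real M" if "M \<ge> m" for M
    using that
  proof (induction M rule: dec_induct)
    case (step M)
    have "1 / (real (Suc M))\<^sup>2 \<le> 1 / (real M * real (Suc M))"
      using step m by (intro divide_left_mono) (auto simp: power2_eq_square)
    also have "\<dots> = 1 / real M - 1 / real (Suc M)"
      using step m by (simp add: field_simps)
    finally have "1 / (real (Suc M))\<^sup>2 \<le> 1 / real M - 1 / real (Suc M)" .
    moreover have "{m<..Suc M} = insert (Suc M) {m<..M}" using step by auto
    ultimately show ?case using step.IH by simp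
  qed simp
  define M where "M = Max (insert m T)"
  have "T \<subseteq> {m<..M}"
    using assms m by (force simp: M_def intro: Max_ge)
  then have "(\<Sum>n\<in>T. 1 / (real n)\<^sup>2) \<le> (\<Sum>n\<in>{m<..M}. 1 / (real n)\<^sup>2)"
    by (intro sum_mono2) auto
  also have "\<dots> \<le> 1 / real m - 1 / real M"
    by (rule *) (use assms in \<open>auto simp: M_def intro: Max_ge\<close>)
  also have "\<dots> \<le> 1 / real m" by simp
  also have "\<dots> \<le> 2 / y"
  proof -
    have "real m \<ge> 1" using m(1) by simp
    then have "y \<le> 2 * real m" using m(3) by linarith
    then show ?thesis using m(1) assms(3) by (simp add: field_simps)
  qed
  finally show ?thesis .
qed

text \<open>
  Primes between \<open>x powr (1 / 8)\<close> and \<open>x\<close> have a bounded sum of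
  reciprocals, so the Cauchy-Schwarz inequality gives a bound that is linear in the distance.
\<close>

lemma sum_upper_range_le:
  assumes f: "unit_disc_valued f" and x: "x > 1"
    and U: "U \<subseteq> {p. prime p \<and> ln x \<le> real p \<and> x powr (1 / 8) \<le> real p \<and> real p \<le> x}"
  shows "(\<Sum>p\<in>U. norm (f p - 1) / real p) \<le> 6 * pretentious_dist P (\<lambda>_. 1) f (ln x) x"
proof (rule power2_le_imp_le)
  define D where "D = pretentious_dist P (\<lambda>_. 1) f (ln x) x"
  have D0: "D \<ge> 0" unfolding D_def using x by (intro pretentious_dist_bounds(1) f) auto
  then show "0 \<le> 6 * pretentious_dist P (\<lambda>_. 1) f (ln x) x" by (simp add: D_def)
  have "(x powr (1 / 8)) ^ 9 = x powr (9 / 8)"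
    using x by (simp flip: powr_realpow add: powr_powr)
  also have "\<dots> > x powr 1" using x by (intro powr_less_mono) auto
  finally have w9: "x < (x powr (1 / 8)) ^ 9" using x by simp
  have rec: "(\<Sum>p\<in>U. 1 / real p) \<le> 2 * real 9"
    by (rule sum_reciprocal_primes_le[OF _ _ w9]) (use x U in \<open>auto simp: ge_one_powr_ge_zero\<close>)
  have "(\<Sum>p\<in>U. norm (f p - 1) / real p)\<^sup>2 = (\<Sum>p\<in>U. (norm (f p - 1) / sqrt (real p)) * (1 / sqrt (real p)))\<^sup>2"
    by simp
  also have "\<dots> \<le> (\<Sum>p\<in>U. (norm (f p - 1) / sqrt (real p))\<^sup>2) * (\<Sum>p\<in>U. (1 / sqrt (real p))\<^sup>2)"
    by (rule Cauchy_Schwarz_ineq_sum)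
  also have "\<dots> = (\<Sum>p\<in>U. (norm (f p - 1))\<^sup>2 / real p) * (\<Sum>p\<in>U. 1 / real p)"
    by (simp add: power_divide)
  also have "\<dots> \<le> (2 * D\<^sup>2) * (2 * real 9)"
    unfolding D_def using x rec U
    by (intro mult_mono pretentious_dist_bounds(2) f) (auto intro!: sum_nonneg)
  also have "\<dots> = (6 * pretentious_dist P (\<lambda>_. 1) f (ln x) x)\<^sup>2"
    by (simp add: D_def power_mult_distrib)
  finally show "(\<Sum>p\<in>U. norm (f p - 1) / real p)\<^sup>2 \<le> (6 * pretentious_dist P (\<lambda>_. 1) f (ln x) x)\<^sup>2" .
qed

text \<open>
  The primes between \<open>ln x\<close> and \<open>x\<close> act on average like a constant. Up
  to \<open>w = x powr (1 / 8)\<close> the product of the components is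
  \<open>exp (H n)\<close>, with \<open>H n\<close> the sum of \<open>f p - 1\<close> over
  the \<open>p\<close> that divide \<open>poly P n\<close>, except for an error of second order
  in \<open>f p - 1\<close>; by the Turan-Kubilius inequality \<open>H n\<close> is close to
  its mean. The components at primes above \<open>w\<close> are replaced by 1. A distance of at
  most 1 makes its square at most the distance itself.
\<close>

lemma sum_mid_components_le:
  assumes sp: "prime_power_sparse C P"
  shows "\<exists>K\<ge>0. \<exists>x0::real. \<forall>f x. multiplicative f \<longrightarrow> unit_disc_valued f \<longrightarrow> x \<ge> x0 \<longrightarrow>
    pretentious_dist P (\<lambda>_. 1) f (ln x) x \<le> 1 \<longrightarrow>
    (\<Sum>n\<in>{1..nat \<lfloor>x\<rfloor>}. norm ((\<Prod>p | prime p \<and> ln x < real p \<and> real p \<le> x.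
        trunc_component f p 1 (pval P n)) - exp (mid_exponent f P x)))
    \<le> K * x * (pretentious_dist P (\<lambda>_. 1) f (ln x) x + 1 / ln (ln x))"
proof -
  have C: "C \<ge> 1" using sp by (simp add: prime_power_sparse_def)
  have "\<forall>\<^sub>F x::real in at_top. x > 1 \<and> ln (ln x) > 0 \<and> ln x \<le> x powr (1 / 8) \<and>
      3 * x powr (3 / 4) \<le> 3 * x * (1 / ln (ln x))"
    by (intro eventually_conj; real_asymp)
  then obtain x0 :: real where x0: "\<And>x. x \<ge> x0 \<Longrightarrow> x > 1 \<and> ln (ln x) > 0 \<and> ln x \<le> x powr (1 / 8) \<and>
      3 * x powr (3 / 4) \<le> 3 * x * (1 / ln (ln x))"
    unfolding eventually_at_top_linorder by blast
  have main: "(\<Sum>n\<in>{1..nat \<lfloor>x\<rfloor>}. norm ((\<Prod>p | prime p \<and> ln x < real p \<and> real p \<le> x.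
        trunc_component f p 1 (pval P n)) - exp (mid_exponent f P x)))
    \<le> (56 * C + 3) * x * (pretentious_dist P (\<lambda>_. 1) f (ln x) x + 1 / ln (ln x))"
    if mf: "multiplicative f" and f: "unit_disc_valued f" and x: "x \<ge> x0"
      and D1: "pretentious_dist P (\<lambda>_. 1) f (ln x) x \<le> 1" for f x
  proof -
    define D where "D = pretentious_dist P (\<lambda>_. 1) f (ln x) x"
    define N where "N = nat \<lfloor>x\<rfloor>"
    define w where "w = x powr (1 / 8)"
    define T where "T = {p. prime p \<and> ln x < real p \<and> real p \<le> w}"
    define U where "U = {p. prime p \<and> ln x < real p \<and> w < real p \<and> real p \<le> x}"
    define c where "c p = f p - 1" for p
    define i :: "nat \<Rightarrow> nat \<Rightarrow> complex" where "i p n = of_bool (p dvd pval P n)" for p n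
    have x1: "x > 1" and lnx: "ln (ln x) > 0" and lw: "ln x \<le> w" and x34: "3 * x powr (3 / 4) \<le> 3 * x * (1 / ln (ln x))"
      using x0[OF x] by (auto simp: w_def)
    have wx: "w \<le> x"
      using x1 powr_mono[of "1/8" 1 x] by (simp add: w_def)
    have Nx: "real N \<le> x" using x1 by (simp add: N_def)
    have D0: "D \<ge> 0" unfolding D_def using x1 by (intro pretentious_dist_bounds(1) f) auto
    have fT: "finite T"
      unfolding T_def by (rule finite_subset[OF _ finite_primes_le[of w]]) auto
    have fU: "finite U"
      unfolding U_def by (rule finite_subset[OF _ finite_primes_le[of x]]) auto
    have TU: "{p. prime p \<and> ln x < real p \<and> real p \<le> x} = T \<union> U" "T \<inter> U = {}"
      using wx by (auto simp: T_def U_def)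
    have pr: "prime p" "real p \<le> x" "real p > 0" if "p \<in> T \<union> U" for p
      using that wx by (auto simp: T_def U_def prime_gt_0_nat)
    have nf: "norm (f p) \<le> 1" if "p \<in> T \<union> U" for p
      using f pr(1)[OF that] by (simp add: unit_disc_valued_def prime_gt_0_nat)
    have nc: "norm (c p) \<le> 2" if "p \<in> T \<union> U" for p
      using nf[OF that] norm_triangle_ineq4[of "f p" 1] by (simp add: c_def)
    have Rc: "Re (c p) \<le> 0" if "p \<in> T \<union> U" for p
      using Re_le_1_if_norm_le_1[OF nf[OF that]] by (simp add: c_def)
    have sumi: "(\<Sum>n\<in>{1..N}. norm (i p n)) \<le> 2 * C * (x / real p)" if "p \<in> T \<union> U" for p
    proof -
      have "(\<Sum>n\<in>{1..N}. norm (i p n)) = (\<Sum>n\<in>{1..N}. if p ^ 1 dvd pval P n then 1 else 0)"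
        by (intro sum.cong) (auto simp: i_def)
      also have "\<dots> \<le> C * (real N / real p ^ 1 + 1)"
        by (rule sum_prime_power_multiples_le[OF sp pr(1)[OF that]])
      also have "\<dots> \<le> C * (x / real p + x / real p)"
        using C Nx pr[OF that] by (intro mult_left_mono add_mono) (auto simp: divide_right_mono)
      also have "\<dots> = 2 * C * (x / real p)" by (simp add: algebra_simps)
      finally show ?thesis .
    qed
    define H where "H n = (\<Sum>p\<in>T. c p * i p n)" for n
    have mu: "mid_exponent f P x = (\<Sum>p\<in>T. c p * of_real (root_density P p))"
      by (simp add: mid_exponent_def T_def w_def c_def)
    have ReH: "Re (H n) \<le> 0" for n
      unfolding H_def Re_sum using Rc by (intro sum_nonpos) (auto simp: i_def)
    have Remu: "Re (mid_exponent f P x) \<le> 0" by (rule Re_mid_exponent_le[OF sp f])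
    have tc: "trunc_component f p 1 (pval P n) = 1 + c p * i p n" if "p \<in> T \<union> U" for p n
      using trunc_component_1[OF mf pr(1)[OF that]] by (simp add: c_def i_def)
    have step1: "norm ((\<Prod>p\<in>T \<union> U. trunc_component f p 1 (pval P n)) - exp (H n))
        \<le> (\<Sum>p\<in>T. 9 * (norm (c p))\<^sup>2 * norm (i p n)) + (\<Sum>p\<in>U. norm (c p) * norm (i p n))" for n
    proof -
      \<comment> \<open>Components at primes in \<open>U\<close> are compared with 1, those in \<open>T\<close> with the factors of \<open>exp (H n)\<close>.\<close>
      define v where "v p = (if p \<in> T then exp (c p * i p n) else 1)" for p
      have "exp (H n) = (\<Prod>p\<in>T \<union> U. v p)"
        using fT fU TU(2) by (auto simp: H_def exp_sum prod.union_disjoint v_def intro!: prod.cong prod.neutral)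
      then have "norm ((\<Prod>p\<in>T \<union> U. trunc_component f p 1 (pval P n)) - exp (H n))
          \<le> (\<Sum>p\<in>T \<union> U. norm (trunc_component f p 1 (pval P n) - v p))"
        using norm_component_le(2)[OF f] pr Rc
        by (auto intro!: norm_prod_diff simp: v_def norm_exp_eq_Re i_def simp del: One_nat_def)
      also have "\<dots> = (\<Sum>p\<in>T. norm (trunc_component f p 1 (pval P n) - v p))
          + (\<Sum>p\<in>U. norm (trunc_component f p 1 (pval P n) - v p))"
        by (rule sum.union_disjoint[OF fT fU TU(2)])
      also have "\<dots> \<le> (\<Sum>p\<in>T. 9 * (norm (c p))\<^sup>2 * norm (i p n)) + (\<Sum>p\<in>U. norm (c p) * norm (i p n))"
      proof (intro add_mono sum_mono)
        fix p assume p: "p \<in> T"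
        have "norm (c p * i p n) \<le> 2" using nc[of p] p by (auto simp: i_def)
        then have "norm (exp (c p * i p n) - (1 + c p * i p n)) \<le> 9 * (norm (c p * i p n))\<^sup>2"
          by (rule norm_exp_linear_le)
        also have "\<dots> = 9 * (norm (c p))\<^sup>2 * norm (i p n)"
          by (auto simp: i_def)
        finally show "norm (trunc_component f p 1 (pval P n) - v p) \<le> 9 * (norm (c p))\<^sup>2 * norm (i p n)"
          using p tc[of p n] by (simp add: v_def norm_minus_commute)
      next
        fix p assume p: "p \<in> U"
        then have "p \<notin> T" using TU(2) by auto
        then show "norm (trunc_component f p 1 (pval P n) - v p) \<le> norm (c p) * norm (i p n)"
          using p tc[of p n] by (simp add: v_def norm_mult)
      qed
      finally show ?thesis .
    qed
    have sumT: "(\<Sum>p\<in>T. (norm (c p))\<^sup>2 / real p) \<le> 2 * D\<^sup>2"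
      unfolding c_def D_def using x1 wx by (intro pretentious_dist_bounds(2) f) (auto simp: T_def)
    have sumU: "(\<Sum>p\<in>U. norm (c p) / real p) \<le> 6 * D"
      unfolding c_def D_def using x1 wx by (intro sum_upper_range_le f) (auto simp: U_def w_def)
    \<comment> \<open>The error from \<open>T\<close> is of second order in \<open>f p - 1\<close>, that from \<open>U\<close> of first order.\<close>
    have part1: "(\<Sum>n\<in>{1..N}. norm ((\<Prod>p\<in>T \<union> U. trunc_component f p 1 (pval P n)) - exp (H n)))
        \<le> 48 * C * x * D"
    proof -
      have "(\<Sum>n\<in>{1..N}. norm ((\<Prod>p\<in>T \<union> U. trunc_component f p 1 (pval P n)) - exp (H n)))
        \<le> (\<Sum>n\<in>{1..N}. (\<Sum>p\<in>T. 9 * (norm (c p))\<^sup>2 * norm (i p n)) + (\<Sum>p\<in>U. norm (c p) * norm (i p n)))"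
        by (intro sum_mono step1)
      also have "\<dots> = (\<Sum>p\<in>T. 9 * (norm (c p))\<^sup>2 * (\<Sum>n\<in>{1..N}. norm (i p n)))
          + (\<Sum>p\<in>U. norm (c p) * (\<Sum>n\<in>{1..N}. norm (i p n)))"
        unfolding sum.distrib sum_distrib_left by (intro arg_cong2[of _ _ _ _ "(+)"] sum.swap)
      also have "\<dots> \<le> (\<Sum>p\<in>T. 9 * (norm (c p))\<^sup>2 * (2 * C * (x / real p)))
          + (\<Sum>p\<in>U. norm (c p) * (2 * C * (x / real p)))"
        by (intro add_mono sum_mono mult_left_mono sumi) auto
      also have "\<dots> = 18 * C * x * (\<Sum>p\<in>T. (norm (c p))\<^sup>2 / real p) + 2 * C * x * (\<Sum>p\<in>U. norm (c p) / real p)"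
        by (simp add: sum_distrib_left mult_ac)
      also have "\<dots> \<le> 18 * C * x * (2 * D) + 2 * C * x * (6 * D)"
      proof (intro add_mono mult_left_mono sumU)
        have "D\<^sup>2 \<le> D" using D0 D1 by (simp add: D_def power2_eq_square mult_left_le)
        then show "(\<Sum>p\<in>T. (norm (c p))\<^sup>2 / real p) \<le> 2 * D" using sumT by linarith
      qed (use C x1 in auto)
      also have "\<dots> = 48 * C * x * D" by (simp add: algebra_simps)
      finally show ?thesis .
    qed
    \<comment> \<open>Both exponents lie in the left half-plane, so the exponentials are as close as the exponents.\<close>
    have part2: "(\<Sum>n\<in>{1..N}. norm (exp (H n) - exp (mid_exponent f P x))) \<le> 8 * C * x * D + 3 * x powr (3 / 4)"
    proof (rule power2_le_imp_le)
      have "(\<Sum>n\<in>{1..N}. norm (exp (H n) - exp (mid_exponent f P x)))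
          \<le> (\<Sum>n\<in>{1..N}. norm (\<Sum>p\<in>T. c p * centred_indicator P p n))"
      proof (rule sum_mono)
        fix n
        have "norm (exp (H n) - exp (mid_exponent f P x)) \<le> norm (H n - mid_exponent f P x)"
          by (rule norm_exp_diff_le[OF ReH Remu])
        also have "H n - mid_exponent f P x = (\<Sum>p\<in>T. c p * centred_indicator P p n)"
          by (simp add: H_def mu centred_indicator_def i_def algebra_simps sum_subtractf)
        finally show "norm (exp (H n) - exp (mid_exponent f P x)) \<le> norm (\<Sum>p\<in>T. c p * centred_indicator P p n)" .
      qed
      then have "(\<Sum>n\<in>{1..N}. norm (exp (H n) - exp (mid_exponent f P x)))\<^sup>2
          \<le> (\<Sum>n\<in>{1..N}. norm (\<Sum>p\<in>T. c p * centred_indicator P p n) * 1)\<^sup>2"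
        by (intro power_mono) (auto intro: sum_nonneg)
      also have "\<dots> \<le> (\<Sum>n\<in>{1..N}. (norm (\<Sum>p\<in>T. c p * centred_indicator P p n))\<^sup>2) * (\<Sum>n\<in>{1..N}. 1\<^sup>2)"
        by (rule Cauchy_Schwarz_ineq_sum)
      also have "\<dots> \<le> (4 * C * x * (\<Sum>p\<in>T. (norm (c p))\<^sup>2 / real p) + 8 * w ^ 4) * x"
        using nc Nx wx by (intro mult_mono turan_kubilius[OF sp, where w = w])
          (auto simp: T_def w_def intro!: add_nonneg_nonneg mult_nonneg_nonneg sum_nonneg, use C x1 in auto)
      also have "\<dots> \<le> (4 * C * x * (2 * D\<^sup>2) + 8 * w ^ 4) * x"
        using sumT C x1 by (intro mult_right_mono add_right_mono mult_left_mono) auto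
      also have "w ^ 4 = x powr (1 / 2)"
        using x1 by (simp add: w_def powr_powr flip: powr_realpow)
      also have "(4 * C * x * (2 * D\<^sup>2) + 8 * x powr (1 / 2)) * x = 8 * C * (x * D)\<^sup>2 + 8 * (x powr (3 / 4))\<^sup>2"
      proof -
        have "x powr (1 / 2) * x = (x powr (3 / 4))\<^sup>2"
          using x1 by (simp add: powr_powr powr_mult_base mult.commute flip: powr_realpow)
        then show ?thesis by (simp add: algebra_simps power2_eq_square)
      qed
      also have "\<dots> \<le> (8 * C * x * D)\<^sup>2 + (3 * x powr (3 / 4))\<^sup>2"
      proof (intro add_mono)
        have "8 * C \<le> (8 * C)\<^sup>2" using C by (simp add: power2_eq_square)
        then have "8 * C * (x * D)\<^sup>2 \<le> (8 * C)\<^sup>2 * (x * D)\<^sup>2" by (intro mult_right_mono) auto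
        then show "8 * C * (x * D)\<^sup>2 \<le> (8 * C * x * D)\<^sup>2" by (simp add: power_mult_distrib mult_ac)
      qed (simp add: power_mult_distrib)
      also have "\<dots> \<le> (8 * C * x * D + 3 * x powr (3 / 4))\<^sup>2"
        using C x1 D0 unfolding power2_sum by simp
      finally show "(\<Sum>n\<in>{1..N}. norm (exp (H n) - exp (mid_exponent f P x)))\<^sup>2
          \<le> (8 * C * x * D + 3 * x powr (3 / 4))\<^sup>2" .
      show "0 \<le> 8 * C * x * D + 3 * x powr (3 / 4)" using C x1 D0 by simp
    qed
    have "(\<Sum>n\<in>{1..N}. norm ((\<Prod>p\<in>T \<union> U. trunc_component f p 1 (pval P n)) - exp (mid_exponent f P x)))
      \<le> (\<Sum>n\<in>{1..N}. norm ((\<Prod>p\<in>T \<union> U. trunc_component f p 1 (pval P n)) - exp (H n))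
            + norm (exp (H n) - exp (mid_exponent f P x)))"
      by (intro sum_mono norm_diff_triangle_le[OF order_refl order_refl])
    also have "\<dots> \<le> 48 * C * x * D + (8 * C * x * D + 3 * x powr (3 / 4))"
      unfolding sum.distrib by (intro add_mono part1 part2)
    also have "\<dots> \<le> 56 * C * x * D + 3 * x * (1 / ln (ln x))"
      using x34 by simp
    also have "\<dots> \<le> (56 * C + 3) * x * (D + 1 / ln (ln x))"
    proof -
      have "(56 * C + 3) * x * (D + 1 / ln (ln x)) - (56 * C * x * D + 3 * x * (1 / ln (ln x)))
          = 3 * x * D + 56 * C * x * (1 / ln (ln x))"
        by (simp add: algebra_simps)
      moreover have "\<dots> \<ge> 0" using C x1 D0 lnx by (intro add_nonneg_nonneg mult_nonneg_nonneg) auto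
      ultimately show ?thesis by linarith
    qed
    finally show ?thesis by (simp add: TU(1) D_def N_def)
  qed
  show ?thesis
    by (rule exI[of _ "56 * C + 3"], intro conjI exI[of _ x0] allI impI main) (use C in auto)
qed

text \<open>
  A nonvanishing resultant puts a nonzero integer \<open>R\<close> into the ideal of
  \<open>P\<close> and \<open>Q\<close>, and every common prime divisor of
  \<open>poly P n\<close> and \<open>poly Q n\<close> divides \<open>R\<close>.
\<close>

lemma common_prime_divisors_bounded:
  fixes P Q :: "int poly"
  assumes "P \<noteq> 0" "resultant P Q \<noteq> 0"
  obtains B :: real where "\<And>p n. prime p \<Longrightarrow> p dvd pval P n \<Longrightarrow> p dvd pval Q n \<Longrightarrow> real p \<le> B"
proof -
  have "degree (gcd P Q) = 0" using assms(2) resultant_0_gcd[of P Q] by simp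
  then obtain U V R where R: "R \<noteq> 0" "U * P + V * Q = [:R:]"
    using bezout_if_degree_gcd_0[OF assms(1)] by metis
  have "real p \<le> real_of_int \<bar>R\<bar>" if "p dvd pval P n" "p dvd pval Q n" for p n
  proof -
    have "R = poly U (int n) * poly P (int n) + poly V (int n) * poly Q (int n)"
      using arg_cong[OF R(2), of "\<lambda>F. poly F (int n)"] by simp
    moreover have "int p dvd \<dots>"
      using that unfolding dvd_pval_iff by (intro dvd_add dvd_mult)
    ultimately have "int p dvd R" by simp
    then have "\<bar>int p\<bar> \<le> \<bar>R\<bar>" using R(1) by (intro dvd_imp_le_int)
    then show ?thesis by linarith
  qed
  then show thesis using that by blast
qed

text \<open>
  If \<open>p\<close> never divides values of \<open>P\<close> and \<open>Q\<close> at the same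
  \<open>n\<close>, the product term of the two components disappears and the average is linear in
  \<open>f p - 1\<close> and \<open>g p - 1\<close>.
\<close>

lemma trunc_correlation_1_eq:
  assumes f: "multiplicative f" and g: "multiplicative g" and p: "prime p"
    and disj: "\<And>n. \<not> (p dvd pval P n \<and> p dvd pval Q n)"
  shows "trunc_correlation p 1 f P g Q
    = 1 + ((f p - 1) * of_real (root_density P p) + (g p - 1) * of_real (root_density Q p))"
proof -
  have p0: "p > 0" using p by (simp add: prime_gt_0_nat)
  have ind: "(\<Sum>n<p. of_bool (p dvd pval F n) :: complex) = of_nat p * of_real (root_density F p)" for F
    using p0 by (simp add: root_density_def of_bool_def sum.If_cases Int_def lessThan_def)
  have "trunc_component f p 1 (pval P n) * trunc_component g p 1 (pval Q n)
      = 1 + (f p - 1) * of_bool (p dvd pval P n) + (g p - 1) * of_bool (p dvd pval Q n)" for n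
    unfolding trunc_component_1[OF f p] trunc_component_1[OF g p] using disj[of n] by auto
  then have "(\<Sum>n<p. trunc_component f p 1 (pval P n) * trunc_component g p 1 (pval Q n))
      = of_nat p + (f p - 1) * (of_nat p * of_real (root_density P p)) + (g p - 1) * (of_nat p * of_real (root_density Q p))"
    by (simp add: sum.distrib ind flip: sum_distrib_left del: One_nat_def)
  then show ?thesis
    using p0 by (simp add: trunc_correlation_def period_mean_def field_simps del: One_nat_def)
qed

lemma norm_trunc_correlation_le:
  assumes "unit_disc_valued f" "unit_disc_valued g" "prime p"
  shows "norm (trunc_correlation p a f P g Q) \<le> 1"
  unfolding trunc_correlation_def
  using norm_component_le[OF assms(1,3)] norm_component_le[OF assms(2,3)]
  by (intro norm_period_mean_le) (simp add: norm_mult mult_le_one)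

lemma norm_local_correlation_le:
  assumes P: "prime_power_sparse C P" "P \<noteq> 0" and Q: "prime_power_sparse C Q" "Q \<noteq> 0"
    and f: "unit_disc_valued f" and g: "unit_disc_valued g" and p: "prime p"
  shows "norm (local_correlation p f P g Q) \<le> 1"
proof (rule LIMSEQ_le_const)
  have p2: "real p > 1" using p prime_gt_1_nat by simp
  have "(\<lambda>a. 1 + 4 * C * inverse (real p) ^ (a + 1)) \<longlonglongrightarrow> 1 + 4 * C * 0"
    using p2 by (intro tendsto_add tendsto_mult tendsto_const LIMSEQ_ignore_initial_segment[OF LIMSEQ_realpow_zero])
                (auto simp: inverse_eq_divide)
  then show "(\<lambda>a. 1 + 4 * C / real p ^ (a + 1)) \<longlonglongrightarrow> 1" by (simp add: field_simps)
  show "\<exists>N. \<forall>a\<ge>N. norm (local_correlation p f P g Q) \<le> 1 + 4 * C / real p ^ (a + 1)"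
  proof (intro exI allI impI)
    fix a
    show "norm (local_correlation p f P g Q) \<le> 1 + 4 * C / real p ^ (a + 1)"
      using norm_local_minus_trunc_correlation_le[OF P Q f g p, of a] norm_trunc_correlation_le[OF f g p, of a P Q]
        norm_triangle_sub[of "local_correlation p f P g Q" "trunc_correlation p a f P g Q"] by linarith
  qed
qed

text \<open>
  The constant that the medium primes contribute to the average of \<open>f\<close> and
  \<open>g\<close> is also their product of local correlations. For large \<open>x\<close> a prime
  \<open>p > ln x\<close> does not divide \<open>poly P n\<close> and
  \<open>poly Q n\<close> at the same \<open>n\<close>, so its factor is
  \<open>1 + \<zeta> p\<close> with \<open>\<zeta> p = O(1 / p)\<close>, and replacing it
  by \<open>exp (\<zeta> p)\<close> costs \<open>O(1 / p\<^sup>2)\<close>. Above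
  \<open>x powr (1 / 8)\<close> the \<open>\<zeta> p\<close> sum up to a multiple of the
  distances and are dropped.
\<close>

lemma prod_mid_correlations_approx:
  assumes P: "prime_power_sparse C P" and Q: "prime_power_sparse C Q"
    and P0: "P \<noteq> 0" and res: "resultant P Q \<noteq> 0"
  shows "\<exists>K\<ge>0. \<exists>x0::real. \<forall>f g x. multiplicative f \<longrightarrow> unit_disc_valued f \<longrightarrow>
    multiplicative g \<longrightarrow> unit_disc_valued g \<longrightarrow> x \<ge> x0 \<longrightarrow>
    norm ((\<Prod>p | prime p \<and> ln x < real p \<and> real p \<le> x. trunc_correlation p 1 f P g Q)
        - exp (mid_exponent f P x + mid_exponent g Q x))
    \<le> K * (pretentious_dist P (\<lambda>_. 1) f (ln x) x + pretentious_dist Q (\<lambda>_. 1) g (ln x) x + 1 / ln (ln x))"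
proof -
  have C: "C \<ge> 1" using P by (simp add: prime_power_sparse_def)
  obtain B where B: "\<And>p n. prime p \<Longrightarrow> p dvd pval P n \<Longrightarrow> p dvd pval Q n \<Longrightarrow> real p \<le> B"
    using common_prime_divisors_bounded[OF P0 res] by blast
  have "\<forall>\<^sub>F x::real in at_top. x > 1 \<and> ln (ln x) > 0 \<and> ln x \<le> x powr (1 / 8) \<and>
      ln x \<ge> 1 \<and> ln x \<ge> 4 * C \<and> ln x \<ge> B \<and> 2 / ln x \<le> 2 * (1 / ln (ln x))"
    by (intro eventually_conj; real_asymp)
  then obtain x0 :: real where x0: "\<And>x. x \<ge> x0 \<Longrightarrow> x > 1 \<and> ln (ln x) > 0 \<and> ln x \<le> x powr (1 / 8) \<and>
      ln x \<ge> 1 \<and> ln x \<ge> 4 * C \<and> ln x \<ge> B \<and> 2 / ln x \<le> 2 * (1 / ln (ln x))"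
    unfolding eventually_at_top_linorder by blast
  define K where "K = 1152 * C\<^sup>2 + 12 * C"
  have main: "norm ((\<Prod>p | prime p \<and> ln x < real p \<and> real p \<le> x. trunc_correlation p 1 f P g Q)
        - exp (mid_exponent f P x + mid_exponent g Q x))
    \<le> K * (pretentious_dist P (\<lambda>_. 1) f (ln x) x + pretentious_dist Q (\<lambda>_. 1) g (ln x) x + 1 / ln (ln x))"
    if mf: "multiplicative f" and f: "unit_disc_valued f" and mg: "multiplicative g" and g: "unit_disc_valued g"
      and x: "x \<ge> x0" for f g x
  proof -
    define DP where "DP = pretentious_dist P (\<lambda>_. 1) f (ln x) x"
    define DQ where "DQ = pretentious_dist Q (\<lambda>_. 1) g (ln x) x"
    define w where "w = x powr (1 / 8)"
    define T where "T = {p. prime p \<and> ln x < real p \<and> real p \<le> w}"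
    define U where "U = {p. prime p \<and> ln x < real p \<and> w < real p \<and> real p \<le> x}"
    define \<zeta> where "\<zeta> p = (f p - 1) * of_real (root_density P p) + (g p - 1) * of_real (root_density Q p)" for p
    have x1: "x > 1" and lnx: "ln (ln x) > 0" and lw: "ln x \<le> w" and l1: "ln x \<ge> 1" and lC: "ln x \<ge> 4 * C"
      and lB: "ln x \<ge> B" and l2: "2 / ln x \<le> 2 * (1 / ln (ln x))"
      using x0[OF x] by (auto simp: w_def)
    have wx: "w \<le> x"
      using x1 powr_mono[of "1/8" 1 x] by (simp add: w_def)
    have D0: "DP \<ge> 0" "DQ \<ge> 0"
      unfolding DP_def DQ_def using x1 by (intro pretentious_dist_bounds(1) f g; simp)+
    have fT: "finite T"
      unfolding T_def by (rule finite_subset[OF _ finite_primes_le[of w]]) auto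
    have fU: "finite U"
      unfolding U_def by (rule finite_subset[OF _ finite_primes_le[of x]]) auto
    have TU: "{p. prime p \<and> ln x < real p \<and> real p \<le> x} = T \<union> U" "T \<inter> U = {}"
      using wx by (auto simp: T_def U_def)
    have pr: "prime p" "ln x < real p" "real p > 0" if "p \<in> T \<union> U" for p
      using that by (auto simp: T_def U_def prime_gt_0_nat)
    have nf: "norm (f p) \<le> 1" "norm (g p) \<le> 1" if "p \<in> T \<union> U" for p
      using f g pr(1)[OF that] by (simp_all add: unit_disc_valued_def prime_gt_0_nat)
    have dens: "0 \<le> root_density P p" "root_density P p \<le> 2 * C / real p"
      "0 \<le> root_density Q p" "root_density Q p \<le> 2 * C / real p" if "p \<in> T \<union> U" for p
      using root_density_bounds[OF P pr(1)[OF that]] root_density_bounds[OF Q pr(1)[OF that]] by auto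
    have E: "trunc_correlation p 1 f P g Q = 1 + \<zeta> p" if "p \<in> T \<union> U" for p
      unfolding \<zeta>_def using B[OF pr(1)[OF that]] lB pr(2)[OF that]
      by (intro trunc_correlation_1_eq mf mg pr(1)[OF that]) fastforce
    have n\<zeta>: "norm (\<zeta> p) \<le> 2 * C * (norm (f p - 1) / real p) + 2 * C * (norm (g p - 1) / real p)" if "p \<in> T \<union> U" for p
    proof -
      have "norm (\<zeta> p) \<le> norm (f p - 1) * root_density P p + norm (g p - 1) * root_density Q p"
        unfolding \<zeta>_def using dens[OF that]
        by (intro order_trans[OF norm_triangle_ineq]) (simp add: norm_mult)
      also have "\<dots> \<le> norm (f p - 1) * (2 * C / real p) + norm (g p - 1) * (2 * C / real p)"
        using dens[OF that] by (intro add_mono mult_left_mono) auto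
      finally show ?thesis by (simp add: mult_ac)
    qed
    have n\<zeta>2: "norm (\<zeta> p) \<le> 8 * C / real p" if "p \<in> T \<union> U" for p
    proof -
      have "norm (f p - 1) \<le> 2" "norm (g p - 1) \<le> 2"
        using nf[OF that] norm_triangle_ineq4[of "f p" 1] norm_triangle_ineq4[of "g p" 1] by simp_all
      then have "2 * C * (norm (f p - 1) / real p) + 2 * C * (norm (g p - 1) / real p)
          \<le> 2 * C * (2 / real p) + 2 * C * (2 / real p)"
        using C pr[OF that] by (intro add_mono mult_left_mono divide_right_mono) auto
      also have "\<dots> = 8 * C / real p" by simp
      finally show ?thesis using n\<zeta>[OF that] by linarith
    qed
    have R\<zeta>: "Re (\<zeta> p) \<le> 0" if "p \<in> T \<union> U" for p
      using Re_le_1_if_norm_le_1[OF nf(1)[OF that]] Re_le_1_if_norm_le_1[OF nf(2)[OF that]] dens[OF that]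
      by (auto simp: \<zeta>_def intro!: add_nonpos_nonpos mult_nonpos_nonneg)
    define v where "v p = (if p \<in> T then exp (\<zeta> p) else 1)" for p
    have "mid_exponent f P x + mid_exponent g Q x = (\<Sum>p\<in>T. \<zeta> p)"
      by (simp add: mid_exponent_def T_def w_def \<zeta>_def sum.distrib)
    then have "exp (mid_exponent f P x + mid_exponent g Q x) = (\<Prod>p\<in>T \<union> U. v p)"
      using fT fU TU(2) by (auto simp: exp_sum prod.union_disjoint v_def intro!: prod.cong prod.neutral)
    then have "norm ((\<Prod>p\<in>T \<union> U. trunc_correlation p 1 f P g Q) - exp (mid_exponent f P x + mid_exponent g Q x))
        \<le> (\<Sum>p\<in>T \<union> U. norm (trunc_correlation p 1 f P g Q - v p))"
      using norm_trunc_correlation_le[OF f g] pr R\<zeta>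
      by (auto intro!: norm_prod_diff simp: v_def norm_exp_eq_Re simp del: One_nat_def)
    also have "\<dots> = (\<Sum>p\<in>T. norm (trunc_correlation p 1 f P g Q - v p))
        + (\<Sum>p\<in>U. norm (trunc_correlation p 1 f P g Q - v p))"
      by (rule sum.union_disjoint[OF fT fU TU(2)])
    also have "\<dots> \<le> (\<Sum>p\<in>T. 576 * C\<^sup>2 * (1 / (real p)\<^sup>2))
        + (\<Sum>p\<in>U. 2 * C * (norm (f p - 1) / real p) + 2 * C * (norm (g p - 1) / real p))"
    proof (intro add_mono sum_mono)
      fix p assume p: "p \<in> T"
      have "norm (\<zeta> p) \<le> 8 * C / real p" using n\<zeta>2 p by simp
      also have "\<dots> \<le> 2" using lC pr[of p] p by (simp add: field_simps)
      finally have "norm (exp (\<zeta> p) - (1 + \<zeta> p)) \<le> 9 * (norm (\<zeta> p))\<^sup>2"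
        by (rule norm_exp_linear_le)
      also have "\<dots> \<le> 9 * (8 * C / real p)\<^sup>2"
        using n\<zeta>2 p by (intro mult_left_mono power_mono) auto
      also have "\<dots> = 576 * C\<^sup>2 * (1 / (real p)\<^sup>2)"
        by (simp add: power_divide power_mult_distrib)
      finally show "norm (trunc_correlation p 1 f P g Q - v p) \<le> 576 * C\<^sup>2 * (1 / (real p)\<^sup>2)"
        using p E[of p] by (simp add: v_def norm_minus_commute)
    next
      fix p assume p: "p \<in> U"
      then have "p \<notin> T" using TU(2) by auto
      then show "norm (trunc_correlation p 1 f P g Q - v p)
          \<le> 2 * C * (norm (f p - 1) / real p) + 2 * C * (norm (g p - 1) / real p)"
        using p E[of p] n\<zeta>[of p] by (simp add: v_def)
    qed
    also have "\<dots> = 576 * C\<^sup>2 * (\<Sum>p\<in>T. 1 / (real p)\<^sup>2)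
        + (2 * C * (\<Sum>p\<in>U. norm (f p - 1) / real p) + 2 * C * (\<Sum>p\<in>U. norm (g p - 1) / real p))"
      by (simp add: sum.distrib sum_distrib_left)
    also have "\<dots> \<le> 576 * C\<^sup>2 * (2 * (1 / ln (ln x))) + (2 * C * (6 * DP) + 2 * C * (6 * DQ))"
    proof (intro add_mono mult_left_mono)
      have "(\<Sum>p\<in>T. 1 / (real p)\<^sup>2) \<le> 2 / ln x"
        by (rule sum_inverse_squares_le[OF fT _ l1]) (auto simp: T_def)
      with l2 show "(\<Sum>p\<in>T. 1 / (real p)\<^sup>2) \<le> 2 * (1 / ln (ln x))" by linarith
      show "(\<Sum>p\<in>U. norm (f p - 1) / real p) \<le> 6 * DP"
        unfolding DP_def using x1 by (intro sum_upper_range_le f) (auto simp: U_def w_def)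
      show "(\<Sum>p\<in>U. norm (g p - 1) / real p) \<le> 6 * DQ"
        unfolding DQ_def using x1 by (intro sum_upper_range_le g) (auto simp: U_def w_def)
    qed (use C in auto)
    also have "\<dots> \<le> K * (DP + DQ + 1 / ln (ln x))"
    proof -
      have "K * (DP + DQ + 1 / ln (ln x)) - (576 * C\<^sup>2 * (2 * (1 / ln (ln x))) + (2 * C * (6 * DP) + 2 * C * (6 * DQ)))
          = 12 * C * (1 / ln (ln x)) + 1152 * C\<^sup>2 * (DP + DQ)"
        by (simp add: K_def algebra_simps)
      moreover have "\<dots> \<ge> 0" using C D0 lnx by (intro add_nonneg_nonneg mult_nonneg_nonneg) auto
      ultimately show ?thesis by linarith
    qed
    finally show ?thesis by (simp add: TU(1) DP_def DQ_def)
  qed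
  show ?thesis
    by (rule exI[of _ K], intro conjI exI[of _ x0] allI impI main) (use C in \<open>auto simp: K_def\<close>)
qed

section \<open>Primes up to \<open>ln x\<close>\<close>

text \<open>
  The exponents have to be so large that capping costs little and so small that the common modulus
  of the primes up to \<open>ln x\<close> is at most \<open>sqrt x\<close>. Let
  \<open>z = ln x / 24\<close>. For \<open>p \<le> z\<close> the power
  \<open>p ^ a\<close> is the largest one up to \<open>z\<^sup>2\<close>; by Chebyshev's bound
  the modulus is then at most \<open>z ^ (12 z / ln z) = exp (12 z) = sqrt x\<close>.
  For large \<open>x\<close> even the first powers of the primes between \<open>z\<close> and
  \<open>ln x\<close> have a product beyond \<open>sqrt x\<close>, so these primes are ignored
  (\<open>a = 0\<close>); their reciprocals sum up to \<open>O(1 / ln (ln x))\<close>, and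
  this is the source of that term in the theorem. Larger primes get \<open>a = 1\<close>.
\<close>

lemma truncation_exponents_exist:
  shows "\<exists>x0::real. \<forall>x\<ge>x0. \<exists>a :: nat \<Rightarrow> nat.
    (\<Sum>p | prime p \<and> real p \<le> x. 1 / real p ^ (a p + 1)) \<le> 170 * (1 / ln (ln x)) \<and>
    real (\<Prod>p | prime p \<and> real p \<le> ln x. p ^ a p) \<le> sqrt x \<and>
    (\<forall>p. ln x < real p \<longrightarrow> a p = 1)"
proof -
  have "\<forall>\<^sub>F x::real in at_top. x > 1 \<and> ln (ln x) > 0 \<and> ln x \<ge> 48 \<and> ln x \<le> x \<and> 1 / ln x \<le> 1 / ln (ln x)"
    by (intro eventually_conj; real_asymp)
  then obtain x0 :: real where x0: "\<And>x. x \<ge> x0 \<Longrightarrow>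
      x > 1 \<and> ln (ln x) > 0 \<and> ln x \<ge> 48 \<and> ln x \<le> x \<and> 1 / ln x \<le> 1 / ln (ln x)"
    unfolding eventually_at_top_linorder by blast
  show ?thesis
  proof (intro exI[of _ x0] allI impI)
    fix x :: real assume x: "x \<ge> x0"
    define L where "L = ln x"
    \<comment> \<open>24 is four times the Chebyshev constant 6, which gives \<open>12 z = ln x / 2\<close> at the end.\<close>
    define z where "z = L / 24"
    have x1: "x > 1" and lL: "ln L > 0" and L48: "L \<ge> 48" and Lx: "L \<le> x" and LlL: "1 / L \<le> 1 / ln L"
      using x0[OF x] by (auto simp: L_def)
    have z2: "z \<ge> 2" and zL: "z \<le> L" using L48 by (auto simp: z_def)
    define k where "k = nat \<lfloor>z\<^sup>2\<rfloor>"
    have z4: "z\<^sup>2 \<ge> 2\<^sup>2" using z2 by (intro power_mono) auto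
    have k: "k \<ge> 1" "real k \<le> z\<^sup>2" "z\<^sup>2 < real k + 1"
      using z4 unfolding k_def by (auto simp: le_nat_iff)
    have "\<exists>b. p ^ b \<le> k \<and> k < p ^ (b + 1)" if "p \<ge> 2" for p
      using ex_power_ivl1[OF that k(1)] .
    then obtain b where b: "\<And>p. p \<ge> 2 \<Longrightarrow> p ^ b p \<le> k \<and> k < p ^ (b p + 1)" by metis
    define a where "a p = (if real p \<le> z then b p else if real p \<le> L then 0 else 1)" for p
    define S1 where "S1 = {p. prime p \<and> real p \<le> z}"
    define S2 where "S2 = {p. prime p \<and> z < real p \<and> real p \<le> L}"
    define S3 where "S3 = {p. prime p \<and> L < real p \<and> real p \<le> x}"
    have f1: "finite S1" unfolding S1_def by (rule finite_primes_le)
    have f2: "finite S2" unfolding S2_def by (rule finite_subset[OF _ finite_primes_le[of L]]) auto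
    have f3: "finite S3" unfolding S3_def by (rule finite_subset[OF _ finite_primes_le[of x]]) auto
    have S: "{p. prime p \<and> real p \<le> x} = S1 \<union> (S2 \<union> S3)" "{p. prime p \<and> real p \<le> L} = S1 \<union> S2"
      "S1 \<inter> (S2 \<union> S3) = {}" "S2 \<inter> S3 = {}" "S1 \<inter> S2 = {}"
      using zL Lx by (auto simp: S1_def S2_def S3_def)
    have c1: "real (card S1) \<le> z"
    proof -
      have "S1 \<subseteq> {1..nat \<lfloor>z\<rfloor>}"
        by (auto simp: S1_def le_nat_floor dest: prime_ge_1_nat)
      then have "card S1 \<le> nat \<lfloor>z\<rfloor>"
        using card_mono[of "{1..nat \<lfloor>z\<rfloor>}" S1] by simp
      then show ?thesis using z2 by linarith
    qed
    \<comment> \<open>The three ranges contribute 24, 144 and 2, in total 170.\<close>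
    have e1: "(\<Sum>p\<in>S1. 1 / real p ^ (a p + 1)) \<le> 24 * (1 / ln L)"
    proof -
      have "(\<Sum>p\<in>S1. 1 / real p ^ (a p + 1)) \<le> (\<Sum>p\<in>S1. 1 / z\<^sup>2)"
      proof (rule sum_mono)
        fix p assume p: "p \<in> S1"
        then have "k < p ^ (b p + 1)" using b[of p] prime_ge_2_nat[of p] by (auto simp: S1_def)
        then have "k + 1 \<le> p ^ (b p + 1)" by simp
        then have "real (k + 1) \<le> real (p ^ (b p + 1))" by (simp only: of_nat_le_iff)
        then have "z\<^sup>2 \<le> real p ^ (a p + 1)" using k(3) p by (simp add: a_def S1_def)
        then show "1 / real p ^ (a p + 1) \<le> 1 / z\<^sup>2"
          using z4 by (intro divide_left_mono mult_pos_pos) auto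
      qed
      also have "\<dots> = real (card S1) * (1 / z\<^sup>2)" by simp
      also have "\<dots> \<le> z * (1 / z\<^sup>2)" using c1 by (intro mult_right_mono) auto
      also have "\<dots> = 24 * (1 / L)" using z2 by (simp add: power2_eq_square z_def)
      also have "\<dots> \<le> 24 * (1 / ln L)" using LlL by simp
      finally show ?thesis .
    qed
    have e2: "(\<Sum>p\<in>S2. 1 / real p ^ (a p + 1)) \<le> 144 * (1 / ln L)"
    proof -
      have "(\<Sum>p\<in>S2. 1 / real p ^ (a p + 1)) \<le> (\<Sum>p\<in>S2. 1 / z)"
        using z2 by (intro sum_mono) (auto simp: S2_def a_def intro!: divide_left_mono)
      also have "\<dots> = real (card S2) * (1 / z)" by simp
      also have "\<dots> \<le> (6 * L / ln L) * (1 / z)"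
      proof (intro mult_right_mono)
        have "card S2 \<le> card {p. prime p \<and> real p \<le> L}"
          using finite_primes_le[of L] by (intro card_mono) (auto simp: S2_def)
        then show "real (card S2) \<le> 6 * L / ln L"
          using chebyshev_upper[of L] L48 by linarith
      qed (use z2 in auto)
      also have "\<dots> = 144 * (1 / ln L)" using L48 by (simp add: z_def)
      finally show ?thesis .
    qed
    have e3: "(\<Sum>p\<in>S3. 1 / real p ^ (a p + 1)) \<le> 2 * (1 / ln L)"
    proof -
      have "(\<Sum>p\<in>S3. 1 / real p ^ (a p + 1)) = (\<Sum>p\<in>S3. 1 / (real p)\<^sup>2)"
        using zL by (intro sum.cong) (auto simp: S3_def a_def power2_eq_square)
      also have "\<dots> \<le> 2 / L"
        using L48 by (intro sum_inverse_squares_le f3) (auto simp: S3_def)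
      finally show ?thesis using LlL by simp
    qed
    have "real (\<Prod>p\<in>S1 \<union> S2. p ^ a p) = (\<Prod>p\<in>S1. real (p ^ a p))"
    proof -
      have "(\<Prod>p\<in>S1 \<union> S2. p ^ a p) = (\<Prod>p\<in>S1. p ^ a p) * (\<Prod>p\<in>S2. p ^ a p)"
        by (rule prod.union_disjoint[OF f1 f2 S(5)])
      also have "(\<Prod>p\<in>S2. p ^ a p) = 1"
        by (intro prod.neutral) (auto simp: S2_def a_def)
      finally show ?thesis by simp
    qed
    also have "\<dots> \<le> (\<Prod>p\<in>S1. z\<^sup>2)"
    proof (intro prod_mono conjI)
      fix p assume p: "p \<in> S1"
      then have "p ^ a p \<le> k" using b[of p] prime_ge_2_nat[of p] by (auto simp: S1_def a_def)
      then have "real (p ^ a p) \<le> real k" by (simp only: of_nat_le_iff)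
      then show "real (p ^ a p) \<le> z\<^sup>2" using k by linarith
    qed auto
    also have "\<dots> = z ^ (2 * card S1)" by (simp add: power_mult)
    also have "\<dots> = exp (real (2 * card S1) * ln z)"
      using z2 powr_realpow[of z "2 * card S1"] by (simp add: powr_def)
    also have "\<dots> \<le> exp (ln x / 2)"
    proof -
      have "real (card S1) \<le> 6 * z / ln z" using chebyshev_upper[OF z2] by (simp add: S1_def)
      then have "real (card S1) * ln z \<le> 6 * z"
        using z2 by (simp add: field_simps)
      moreover have "real (2 * card S1) * ln z = 2 * (real (card S1) * ln z)" by simp
      ultimately have "real (2 * card S1) * ln z \<le> 12 * z" by linarith
      also have "\<dots> = ln x / 2" by (simp add: z_def L_def)
      finally show ?thesis by simp
    qed
    also have "\<dots> = sqrt x"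
      using x1 by (simp add: exp_ln flip: ln_sqrt)
    finally have m: "real (\<Prod>p\<in>S1 \<union> S2. p ^ a p) \<le> sqrt x" .
    have "(\<Sum>p\<in>S1 \<union> (S2 \<union> S3). 1 / real p ^ (a p + 1)) \<le> 170 * (1 / ln L)"
      using e1 e2 e3 f1 f2 f3 S by (simp add: sum.union_disjoint)
    then show "\<exists>a :: nat \<Rightarrow> nat.
      (\<Sum>p | prime p \<and> real p \<le> x. 1 / real p ^ (a p + 1)) \<le> 170 * (1 / ln (ln x)) \<and>
      real (\<Prod>p | prime p \<and> real p \<le> ln x. p ^ a p) \<le> sqrt x \<and>
      (\<forall>p. ln x < real p \<longrightarrow> a p = 1)"
      using m zL unfolding S(1) L_def[symmetric] S(2) by (intro exI[of _ a]) (auto simp: a_def)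
  qed
qed

section \<open>The correlation formula\<close>

text \<open>
  The treatment of one polynomial: the value \<open>f (pval P n)\<close> splits into its
  components at the primes up to \<open>ln x\<close>, between \<open>ln x\<close> and
  \<open>x\<close>, and beyond \<open>x\<close>. Capping the exponents, replacing the medium
  components by a constant, and dropping the large ones costs, on average over \<open>n\<close>,
  no more than the claimed error.
\<close>

lemma multiplicative_value_approx:
  assumes P: "prime_power_sparse C P"
  shows "\<exists>K\<ge>0. \<exists>x0::real. \<forall>f x (a :: nat \<Rightarrow> nat). multiplicative f \<longrightarrow> unit_disc_valued f \<longrightarrow> x \<ge> x0 \<longrightarrow>
    pretentious_dist P (\<lambda>_. 1) f (ln x) x \<le> 1 \<longrightarrow>
    (\<Sum>p | prime p \<and> real p \<le> x. 1 / real p ^ (a p + 1)) \<le> 170 * (1 / ln (ln x)) \<longrightarrow>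
    (\<forall>p. ln x < real p \<longrightarrow> a p = 1) \<longrightarrow>
    (\<Sum>n | n \<in> {1..nat \<lfloor>x\<rfloor>} \<and> pval P n \<noteq> 0.
       norm (f (pval P n) - (\<Prod>p | prime p \<and> real p \<le> ln x. trunc_component f p (a p) (pval P n))
             * exp (mid_exponent f P x)))
    \<le> K * x * (pretentious_dist P (\<lambda>_. 1) f (ln x) x + 1 / ln (ln x))"
proof -
  have C: "C \<ge> 1" using P by (simp add: prime_power_sparse_def)
  obtain K1 x1 where K1: "K1 \<ge> 0" "\<And>f x. unit_disc_valued f \<Longrightarrow> x \<ge> x1 \<Longrightarrow>
    (\<Sum>n | n \<in> {1..nat \<lfloor>x\<rfloor>} \<and> pval P n \<noteq> 0.
       \<Sum>p | p \<in> prime_factors (pval P n) \<and> real p > x. norm (local_component f p (pval P n) - 1))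
    \<le> K1 * x * pretentious_dist P (\<lambda>_. 1) f (ln x) x"
    using sum_large_components_le[OF P] by blast
  obtain K2 x2 where K2: "K2 \<ge> 0" "\<And>f x. multiplicative f \<Longrightarrow> unit_disc_valued f \<Longrightarrow> x \<ge> x2 \<Longrightarrow>
    pretentious_dist P (\<lambda>_. 1) f (ln x) x \<le> 1 \<Longrightarrow>
    (\<Sum>n\<in>{1..nat \<lfloor>x\<rfloor>}. norm ((\<Prod>p | prime p \<and> ln x < real p \<and> real p \<le> x.
        trunc_component f p 1 (pval P n)) - exp (mid_exponent f P x)))
    \<le> K2 * x * (pretentious_dist P (\<lambda>_. 1) f (ln x) x + 1 / ln (ln x))"
    using sum_mid_components_le[OF P] by blast
  have "\<forall>\<^sub>F x::real in at_top. x \<ge> 2 \<and> ln (ln x) > 0 \<and> ln x \<le> x \<and> 1 / ln x \<le> 1 / ln (ln x)"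
    by (intro eventually_conj; real_asymp)
  then obtain x3 :: real where x3: "\<And>x. x \<ge> x3 \<Longrightarrow> x \<ge> 2 \<and> ln (ln x) > 0 \<and> ln x \<le> x \<and> 1 / ln x \<le> 1 / ln (ln x)"
    unfolding eventually_at_top_linorder by blast
  define K where "K = 352 * C + K1 + K2"
  have main: "(\<Sum>n | n \<in> {1..nat \<lfloor>x\<rfloor>} \<and> pval P n \<noteq> 0.
       norm (f (pval P n) - (\<Prod>p | prime p \<and> real p \<le> ln x. trunc_component f p (a p) (pval P n))
             * exp (mid_exponent f P x)))
    \<le> K * x * (pretentious_dist P (\<lambda>_. 1) f (ln x) x + 1 / ln (ln x))"
    if mf: "multiplicative f" and f: "unit_disc_valued f" and x: "x \<ge> Max {x1, x2, x3}"
      and D1: "pretentious_dist P (\<lambda>_. 1) f (ln x) x \<le> 1"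
      and a: "(\<Sum>p | prime p \<and> real p \<le> x. 1 / real p ^ (a p + 1)) \<le> 170 * (1 / ln (ln x))"
        "\<And>p. ln x < real p \<Longrightarrow> a p = 1" for f x and a :: "nat \<Rightarrow> nat"
  proof -
    define D where "D = pretentious_dist P (\<lambda>_. 1) f (ln x) x"
    define \<epsilon> where "\<epsilon> = 1 / ln (ln x)"
    define N where "N = nat \<lfloor>x\<rfloor>"
    have xx: "x \<ge> x1" "x \<ge> x2" "x \<ge> x3" using x by auto
    have x2: "x \<ge> 2" and lnx: "ln (ln x) > 0" and Lx: "ln x \<le> x" and Le: "1 / ln x \<le> \<epsilon>"
      using x3[OF xx(3)] by (auto simp: \<epsilon>_def)
    have e0: "\<epsilon> > 0" using lnx by (simp add: \<epsilon>_def)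
    have Nx: "real N \<le> x" using x2 by (simp add: N_def)
    have D0: "D \<ge> 0" unfolding D_def using x2 by (intro pretentious_dist_bounds(1) f) auto
    define M where "M = {p. prime p \<and> real p \<le> x}"
    define S where "S = {p. prime p \<and> real p \<le> ln x}"
    define R where "R = {p. prime p \<and> ln x < real p \<and> real p \<le> x}"
    have fM: "finite M" unfolding M_def by (rule finite_primes_le)
    have MSR: "M = S \<union> R" "S \<inter> R = {}" using Lx by (auto simp: M_def S_def R_def)
    have fS: "finite S" and fR: "finite R" using fM MSR(1) by auto
    define mu where "mu = exp (mid_exponent f P x)"
    have nmu: "norm mu \<le> 1"
      using Re_mid_exponent_le[OF P f, of x] by (simp add: mu_def norm_exp_eq_Re)
    define t where "t n p = trunc_component f p (a p) (pval P n)" for n p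
    define l where "l n p = local_component f p (pval P n)" for n p
    define e :: "nat \<Rightarrow> nat \<Rightarrow> real" where "e n p = (if p ^ (a p + 1) dvd pval P n then 1 else 0)" for n p
    define hi where "hi n = {p. p \<in> prime_factors (pval P n) \<and> real p > x}" for n
    have nt: "norm (t n p) \<le> 1" and nl: "norm (l n p) \<le> 1" if "prime p" for n p
      using norm_component_le[OF f that] by (simp_all add: t_def l_def)
    have pointwise: "norm (f (pval P n) - (\<Prod>p\<in>S. t n p) * mu)
        \<le> (\<Sum>p\<in>M. 2 * e n p) + (\<Sum>p\<in>hi n. norm (l n p - 1)) + norm ((\<Prod>p\<in>R. t n p) - mu)"
      if n: "pval P n \<noteq> 0" for n
    proof -
      have fh: "finite (hi n)" by (simp add: hi_def)
      have Mh: "M \<inter> hi n = {}" by (auto simp: M_def hi_def)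
      have prM: "prime p" if "p \<in> M" for p using that by (simp add: M_def)
      have prh: "prime p" if "p \<in> hi n" for p using that by (auto simp: hi_def)
      have "f (pval P n) = (\<Prod>p\<in>M \<union> hi n. l n p)"
        unfolding l_def
      proof (rule multiplicative_prod_components[OF mf])
        show "prime_factors (pval P n) \<subseteq> M \<union> hi n"
          by (auto simp: M_def hi_def)
      qed (use fM fh prM prh n in auto)
      also have "\<dots> = (\<Prod>p\<in>M. l n p) * (\<Prod>p\<in>hi n. l n p)"
        by (rule prod.union_disjoint[OF fM fh Mh])
      finally have fe: "f (pval P n) = (\<Prod>p\<in>M. l n p) * (\<Prod>p\<in>hi n. l n p)" .
      have "norm (f (pval P n) - (\<Prod>p\<in>M. t n p) * 1)
          \<le> norm ((\<Prod>p\<in>M. l n p) - (\<Prod>p\<in>M. t n p)) + norm ((\<Prod>p\<in>hi n. l n p) - 1)"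
        unfolding fe
      proof (rule norm_mult_diff_le)
        show "norm (\<Prod>p\<in>hi n. l n p) \<le> 1" by (intro norm_prod_le_1 nl prh)
        show "norm (\<Prod>p\<in>M. t n p) \<le> 1" by (intro norm_prod_le_1 nt prM)
      qed
      also have "norm ((\<Prod>p\<in>M. l n p) - (\<Prod>p\<in>M. t n p)) \<le> (\<Sum>p\<in>M. norm (l n p - t n p))"
        by (intro norm_prod_diff nl nt prM)
      also have "\<dots> \<le> (\<Sum>p\<in>M. 2 * e n p)"
      proof (rule sum_mono)
        fix p assume "p \<in> M"
        then show "norm (l n p - t n p) \<le> 2 * e n p"
          using norm_local_minus_trunc_le[OF f prM, of p "pval P n" "a p"] by (auto simp: l_def t_def e_def split: if_splits)
      qed
      also have "norm ((\<Prod>p\<in>hi n. l n p) - 1) \<le> (\<Sum>p\<in>hi n. norm (l n p - 1))"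
        using norm_prod_diff[of "hi n" "l n" "\<lambda>_. 1"] nl prh by simp
      finally have 1: "norm (f (pval P n) - (\<Prod>p\<in>M. t n p)) \<le> (\<Sum>p\<in>M. 2 * e n p) + (\<Sum>p\<in>hi n. norm (l n p - 1))"
        by simp
      have "(\<Prod>p\<in>M. t n p) = (\<Prod>p\<in>S. t n p) * (\<Prod>p\<in>R. t n p)"
        unfolding MSR(1) by (rule prod.union_disjoint[OF fS fR MSR(2)])
      then have "norm ((\<Prod>p\<in>M. t n p) - (\<Prod>p\<in>S. t n p) * mu) = norm (\<Prod>p\<in>S. t n p) * norm ((\<Prod>p\<in>R. t n p) - mu)"
        by (simp add: norm_mult flip: right_diff_distrib)
      also have "\<dots> \<le> 1 * norm ((\<Prod>p\<in>R. t n p) - mu)"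
        using nt by (intro mult_right_mono norm_prod_le_1) (auto simp: S_def)
      finally show ?thesis
        using 1 norm_triangle_ineq[of "f (pval P n) - (\<Prod>p\<in>M. t n p)" "(\<Prod>p\<in>M. t n p) - (\<Prod>p\<in>S. t n p) * mu"]
        by simp
    qed
    let ?G = "{n. n \<in> {1..N} \<and> pval P n \<noteq> 0}"
    have "(\<Sum>n\<in>?G. norm (f (pval P n) - (\<Prod>p\<in>S. t n p) * mu))
        \<le> (\<Sum>n\<in>?G. (\<Sum>p\<in>M. 2 * e n p) + (\<Sum>p\<in>hi n. norm (l n p - 1)) + norm ((\<Prod>p\<in>R. t n p) - mu))"
      using pointwise by (intro sum_mono) auto
    also have "\<dots> = (\<Sum>n\<in>?G. \<Sum>p\<in>M. 2 * e n p) + (\<Sum>n\<in>?G. \<Sum>p\<in>hi n. norm (l n p - 1))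
        + (\<Sum>n\<in>?G. norm ((\<Prod>p\<in>R. t n p) - mu))"
      by (simp add: sum.distrib)
    also have "(\<Sum>n\<in>?G. \<Sum>p\<in>M. 2 * e n p) \<le> 352 * C * x * \<epsilon>"
    proof -
      have "(\<Sum>n\<in>?G. \<Sum>p\<in>M. 2 * e n p) \<le> (\<Sum>n\<in>{1..N}. \<Sum>p\<in>M. 2 * e n p)"
        by (intro sum_mono2) (auto simp: e_def intro!: sum_nonneg)
      also have "\<dots> = (\<Sum>p\<in>M. 2 * (\<Sum>n\<in>{1..N}. e n p))"
        by (subst sum.swap) (simp add: sum_distrib_left)
      also have "\<dots> \<le> (\<Sum>p\<in>M. 2 * (C * (x * (1 / real p ^ (a p + 1)) + 1)))"
      proof (intro sum_mono mult_left_mono)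
        fix p assume "p \<in> M"
        then have "(\<Sum>n\<in>{1..N}. e n p) \<le> C * (real N / real p ^ (a p + 1) + 1)"
          unfolding e_def by (intro sum_prime_power_multiples_le P) (simp add: M_def)
        also have "\<dots> \<le> C * (x * (1 / real p ^ (a p + 1)) + 1)"
          using C Nx by (intro mult_left_mono add_right_mono) (auto intro!: divide_right_mono)
        finally show "(\<Sum>n\<in>{1..N}. e n p) \<le> C * (x * (1 / real p ^ (a p + 1)) + 1)" .
      qed auto
      also have "\<dots> = 2 * C * (x * (\<Sum>p\<in>M. 1 / real p ^ (a p + 1)) + real (card M))"
        by (simp add: sum.distrib sum_distrib_left algebra_simps)
      \<comment> \<open>The 1 in \<open>N / p ^ (a p + 1) + 1\<close> is summed over all primes up to \<open>x\<close> and needs Chebyshev's bound again.\<close>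
      also have "\<dots> \<le> 2 * C * (x * (170 * \<epsilon>) + 6 * x * \<epsilon>)"
      proof (intro mult_left_mono add_mono)
        show "(\<Sum>p\<in>M. 1 / real p ^ (a p + 1)) \<le> 170 * \<epsilon>"
          using a(1) by (simp only: M_def \<epsilon>_def)
        have "real (card M) \<le> 6 * x / ln x"
          unfolding M_def by (rule chebyshev_upper[OF x2])
        also have "\<dots> = 6 * x * (1 / ln x)" by simp
        also have "\<dots> \<le> 6 * x * \<epsilon>" using Le x2 by (intro mult_left_mono) auto
        finally show "real (card M) \<le> 6 * x * \<epsilon>" .
      qed (use C x2 in auto)
      also have "\<dots> = 352 * C * x * \<epsilon>" by (simp add: algebra_simps)
      finally show ?thesis .
    qed
    also have "(\<Sum>n\<in>?G. \<Sum>p\<in>hi n. norm (l n p - 1)) \<le> K1 * x * D"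
      using K1(2)[OF f xx(1)] by (simp only: hi_def l_def D_def N_def)
    also have "(\<Sum>n\<in>?G. norm ((\<Prod>p\<in>R. t n p) - mu)) \<le> K2 * x * (D + \<epsilon>)"
    proof -
      have "(\<Sum>n\<in>?G. norm ((\<Prod>p\<in>R. t n p) - mu)) \<le> (\<Sum>n\<in>{1..N}. norm ((\<Prod>p\<in>R. t n p) - mu))"
        by (intro sum_mono2) auto
      also have "\<dots> = (\<Sum>n\<in>{1..N}. norm ((\<Prod>p\<in>R. trunc_component f p 1 (pval P n)) - mu))"
        using a(2) by (intro sum.cong refl arg_cong[of _ _ norm] arg_cong2[of _ _ _ _ "(-)"] prod.cong) (auto simp: t_def R_def)
      also have "\<dots> \<le> K2 * x * (D + \<epsilon>)"
        using K2(2)[OF mf f xx(2) D1] by (simp only: R_def mu_def N_def D_def \<epsilon>_def)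
      finally show ?thesis .
    qed
    finally have "(\<Sum>n\<in>?G. norm (f (pval P n) - (\<Prod>p\<in>S. t n p) * mu))
        \<le> 352 * C * x * \<epsilon> + K1 * x * D + K2 * x * (D + \<epsilon>)"
      by simp
    also have "\<dots> \<le> K * x * (D + \<epsilon>)"
    proof -
      have "K * x * (D + \<epsilon>) - (352 * C * x * \<epsilon> + K1 * x * D + K2 * x * (D + \<epsilon>)) = 352 * C * x * D + K1 * x * \<epsilon>"
        by (simp add: K_def algebra_simps)
      moreover have "\<dots> \<ge> 0" using C D0 e0 x2 K1(1) by (intro add_nonneg_nonneg mult_nonneg_nonneg) auto
      ultimately show ?thesis by linarith
    qed
    finally show ?thesis by (simp only: S_def t_def mu_def D_def \<epsilon>_def N_def)
  qed
  show ?thesis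
    by (rule exI[of _ K], intro conjI exI[of _ "Max {x1, x2, x3}"] allI impI main)
       (use C K1 K2 in \<open>auto simp: K_def\<close>)
qed

text \<open>
  The capped components at primes up to \<open>ln x\<close> have a common period, over which the
  Chinese remainder theorem evaluates the average as a product of local averages.
\<close>

lemma sum_small_components_approx:
  assumes f: "unit_disc_valued f" and g: "unit_disc_valued g" and S: "finite S" "\<And>p. p \<in> S \<Longrightarrow> prime p"
    and x: "x \<ge> 1"
  shows "norm ((\<Sum>n\<in>{1..nat \<lfloor>x\<rfloor>}. \<Prod>p\<in>S. trunc_component f p (a p) (pval P n) * trunc_component g p (a p) (pval Q n))
      - of_real x * (\<Prod>p\<in>S. trunc_correlation p (a p) f P g Q)) \<le> 2 * real (\<Prod>p\<in>S. p ^ a p) + 1"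
proof -
  define u where "u p n = trunc_component f p (a p) (pval P n) * trunc_component g p (a p) (pval Q n)" for p n
  define M where "M = (\<Prod>p\<in>S. p ^ a p)"
  have per: "periodic (p ^ a p) (u p)" for p
    unfolding u_def[abs_def] by (rule periodic_binop[OF periodic_trunc_component periodic_trunc_component])
  have nu: "norm (u p n) \<le> 1" if "p \<in> S" for p n
    using norm_component_le[OF f S(2)[OF that]] norm_component_le[OF g S(2)[OF that]]
    by (simp add: u_def norm_mult mult_le_one)
  have M0: "M > 0" unfolding M_def using S prime_gt_0_nat by (intro prod_pos) auto
  have "(\<Sum>n<M. \<Prod>p\<in>S. u p n) = (\<Prod>p\<in>S. \<Sum>n<p ^ a p. u p n)"
    unfolding M_def
  proof (rule sum_prod_coprime_periods[OF S(1)])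
    show "0 < p ^ a p \<and> periodic (p ^ a p) (u p)" if "p \<in> S" for p
      using S(2)[OF that] per by (simp add: prime_gt_0_nat)
    show "coprime (p ^ a p) (q ^ a q)" if "p \<in> S" "q \<in> S" "p \<noteq> q" for p q
      using that S(2) primes_coprime[of p q] by simp
  qed
  then have "period_mean M (\<lambda>n. \<Prod>p\<in>S. u p n) = (\<Prod>p\<in>S. trunc_correlation p (a p) f P g Q)"
    by (simp add: period_mean_def trunc_correlation_def u_def M_def prod_dividef)
  moreover have "norm ((\<Sum>n\<in>{1..nat \<lfloor>x\<rfloor>}. \<Prod>p\<in>S. u p n) - of_real x * period_mean M (\<lambda>n. \<Prod>p\<in>S. u p n))
      \<le> 2 * real M + 1"
  proof (rule sum_minus_period_mean_le[OF _ M0 _ x])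
    show "periodic M (\<lambda>n. \<Prod>p\<in>S. u p n)"
      unfolding M_def using S(1) by (intro periodic_prod periodic_multiple[OF per] dvd_prodI)
    show "norm (\<Prod>p\<in>S. u p n) \<le> 1" for n by (intro norm_prod_le_1 nu)
  qed
  ultimately show ?thesis by (simp add: u_def M_def)
qed

lemma norm_correlation_mean_le:
  assumes "unit_disc_valued f" "unit_disc_valued g" "x \<ge> 1"
  shows "norm (correlation_mean f P g Q x) \<le> 1"
proof -
  let ?A = "{n. n \<in> {1..nat \<lfloor>x\<rfloor>} \<and> poly P (int n) * poly Q (int n) \<noteq> 0}"
  have "norm (\<Sum>n\<in>?A. f (pval P n) * g (pval Q n)) \<le> (\<Sum>n\<in>?A. 1)"
  proof (rule sum_norm_le)
    fix n assume "n \<in> ?A"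
    then have "pval P n > 0" "pval Q n > 0" by (auto simp: pval_def)
    then show "norm (f (pval P n) * g (pval Q n)) \<le> 1"
      using assms by (simp add: norm_mult unit_disc_valued_def mult_le_one)
  qed
  also have "\<dots> \<le> real (card {1..nat \<lfloor>x\<rfloor>})"
    by (simp only: sum_constant mult_1_right of_nat_le_iff) (intro card_mono, auto)
  also have "\<dots> \<le> x" using assms(3) by simp
  finally show ?thesis
    using assms(3) by (subst correlation_mean_eq) (auto simp: norm_divide)
qed

theorem theorem1p3:
  fixes P Q :: "int poly"
  assumes "irreducible P" and "irreducible Q" and "resultant P Q \<noteq> 0"
  shows "\<exists>C x0 :: real. \<forall>f g :: nat \<Rightarrow> complex.
    multiplicative f \<longrightarrow> unit_disc_valued f \<longrightarrow> multiplicative g \<longrightarrow> unit_disc_valued g \<longrightarrow>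
    (\<forall>x\<ge>x0.
      norm (correlation_mean f P g Q x
            - (\<Prod>p | prime p \<and> real p \<le> x. local_correlation p f P g Q))
      \<le> C * (pretentious_dist P (\<lambda>_. 1) f (ln x) x
             + pretentious_dist Q (\<lambda>_. 1) g (ln x) x
             + 1 / ln (ln x)))"
proof -
  have P0: "P \<noteq> 0" and Q0: "Q \<noteq> 0" using assms by auto
  obtain C1 C2 where "prime_power_sparse C1 P" "prime_power_sparse C2 Q"
    using prime_power_sparse_exists assms(1,2) by blast
  then obtain C where P: "prime_power_sparse C P" and Q: "prime_power_sparse C Q"
    using prime_power_sparse_mono[of C1 P "max C1 C2"] prime_power_sparse_mono[of C2 Q "max C1 C2"] by auto
  have C: "C \<ge> 1" using P by (simp add: prime_power_sparse_def)
  obtain K1 x1 where K1: "K1 \<ge> 0" "\<And>f x (a :: nat \<Rightarrow> nat). multiplicative f \<Longrightarrow> unit_disc_valued f \<Longrightarrow> x \<ge> x1 \<Longrightarrow>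
    pretentious_dist P (\<lambda>_. 1) f (ln x) x \<le> 1 \<Longrightarrow>
    (\<Sum>p | prime p \<and> real p \<le> x. 1 / real p ^ (a p + 1)) \<le> 170 * (1 / ln (ln x)) \<Longrightarrow>
    (\<forall>p. ln x < real p \<longrightarrow> a p = 1) \<Longrightarrow>
    (\<Sum>n | n \<in> {1..nat \<lfloor>x\<rfloor>} \<and> pval P n \<noteq> 0.
       norm (f (pval P n) - (\<Prod>p | prime p \<and> real p \<le> ln x. trunc_component f p (a p) (pval P n))
             * exp (mid_exponent f P x)))
    \<le> K1 * x * (pretentious_dist P (\<lambda>_. 1) f (ln x) x + 1 / ln (ln x))"
    using multiplicative_value_approx[OF P] by blast
  obtain K2 x2 where K2: "K2 \<ge> 0" "\<And>f x (a :: nat \<Rightarrow> nat). multiplicative f \<Longrightarrow> unit_disc_valued f \<Longrightarrow> x \<ge> x2 \<Longrightarrow>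
    pretentious_dist Q (\<lambda>_. 1) f (ln x) x \<le> 1 \<Longrightarrow>
    (\<Sum>p | prime p \<and> real p \<le> x. 1 / real p ^ (a p + 1)) \<le> 170 * (1 / ln (ln x)) \<Longrightarrow>
    (\<forall>p. ln x < real p \<longrightarrow> a p = 1) \<Longrightarrow>
    (\<Sum>n | n \<in> {1..nat \<lfloor>x\<rfloor>} \<and> pval Q n \<noteq> 0.
       norm (f (pval Q n) - (\<Prod>p | prime p \<and> real p \<le> ln x. trunc_component f p (a p) (pval Q n))
             * exp (mid_exponent f Q x)))
    \<le> K2 * x * (pretentious_dist Q (\<lambda>_. 1) f (ln x) x + 1 / ln (ln x))"
    using multiplicative_value_approx[OF Q] by blast
  obtain K3 x3 where K3: "K3 \<ge> 0" "\<And>f g x. multiplicative f \<Longrightarrow> unit_disc_valued f \<Longrightarrow>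
    multiplicative g \<Longrightarrow> unit_disc_valued g \<Longrightarrow> x \<ge> x3 \<Longrightarrow>
    norm ((\<Prod>p | prime p \<and> ln x < real p \<and> real p \<le> x. trunc_correlation p 1 f P g Q)
        - exp (mid_exponent f P x + mid_exponent g Q x))
    \<le> K3 * (pretentious_dist P (\<lambda>_. 1) f (ln x) x + pretentious_dist Q (\<lambda>_. 1) g (ln x) x + 1 / ln (ln x))"
    using prod_mid_correlations_approx[OF P Q P0 assms(3)] by blast
  obtain x4 where x4: "\<And>x. x \<ge> x4 \<Longrightarrow> \<exists>a :: nat \<Rightarrow> nat.
    (\<Sum>p | prime p \<and> real p \<le> x. 1 / real p ^ (a p + 1)) \<le> 170 * (1 / ln (ln x)) \<and>
    real (\<Prod>p | prime p \<and> real p \<le> ln x. p ^ a p) \<le> sqrt x \<and>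
    (\<forall>p. ln x < real p \<longrightarrow> a p = 1)"
    using truncation_exponents_exist by blast
  define Z where "Z = {n::nat. poly P (int n) * poly Q (int n) = 0}"
  have "Z = {n. poly P (int n) = 0} \<union> {n. poly Q (int n) = 0}" by (auto simp: Z_def)
  then have fZ: "finite Z" using finite_zeros[OF P0] finite_zeros[OF Q0] by simp
  have "\<forall>\<^sub>F x::real in at_top. x \<ge> 2 \<and> ln (ln x) > 0 \<and> ln x \<le> x \<and>
      real (card Z) + (2 * sqrt x + 1) \<le> x * (1 / ln (ln x))"
    by (intro eventually_conj; real_asymp)
  then obtain x5 :: real where x5: "\<And>x. x \<ge> x5 \<Longrightarrow> x \<ge> 2 \<and> ln (ln x) > 0 \<and> ln x \<le> x \<and>
      real (card Z) + (2 * sqrt x + 1) \<le> x * (1 / ln (ln x))"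
    unfolding eventually_at_top_linorder by blast
  define K where "K = 2 + 680 * C + K1 + K2 + K3"
  have main: "norm (correlation_mean f P g Q x - (\<Prod>p | prime p \<and> real p \<le> x. local_correlation p f P g Q))
      \<le> K * (pretentious_dist P (\<lambda>_. 1) f (ln x) x + pretentious_dist Q (\<lambda>_. 1) g (ln x) x + 1 / ln (ln x))"
    if mf: "multiplicative f" and f: "unit_disc_valued f" and mg: "multiplicative g" and g: "unit_disc_valued g"
      and x: "x \<ge> Max {x1, x2, x3, x4, x5}" for f g x
  proof -
    define DP where "DP = pretentious_dist P (\<lambda>_. 1) f (ln x) x"
    define DQ where "DQ = pretentious_dist Q (\<lambda>_. 1) g (ln x) x"
    define \<epsilon> where "\<epsilon> = 1 / ln (ln x)"
    define N where "N = nat \<lfloor>x\<rfloor>"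
    have xx: "x \<ge> x1" "x \<ge> x2" "x \<ge> x3" "x \<ge> x4" "x \<ge> x5" using x by auto
    have x2: "x \<ge> 2" and lnx: "ln (ln x) > 0" and Lx: "ln x \<le> x"
      and rest: "real (card Z) + (2 * sqrt x + 1) \<le> x * \<epsilon>"
      using x5[OF xx(5)] by (auto simp: \<epsilon>_def)
    have e0: "\<epsilon> > 0" using lnx by (simp add: \<epsilon>_def)
    have D0: "DP \<ge> 0" "DQ \<ge> 0"
      unfolding DP_def DQ_def using x2 by (intro pretentious_dist_bounds(1) f g; simp)+
    define M where "M = {p. prime p \<and> real p \<le> x}"
    define S where "S = {p. prime p \<and> real p \<le> ln x}"
    define R where "R = {p. prime p \<and> ln x < real p \<and> real p \<le> x}"
    have fM: "finite M" unfolding M_def by (rule finite_primes_le)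
    have MSR: "M = S \<union> R" "S \<inter> R = {}" using Lx by (auto simp: M_def S_def R_def)
    have fS: "finite S" and fR: "finite R" using fM MSR(1) by auto
    have prM: "prime p" if "p \<in> M" for p using that by (simp add: M_def)
    have prS: "prime p" if "p \<in> S" for p using that by (simp add: S_def)
    define L where "L p = local_correlation p f P g Q" for p
    have nL: "norm (L p) \<le> 1" if "p \<in> M" for p
      unfolding L_def by (rule norm_local_correlation_le[OF P P0 Q Q0 f g prM[OF that]])
    show ?thesis
    proof (cases "DP \<le> 1 \<and> DQ \<le> 1")
      \<comment> \<open>If a distance exceeds 1, the trivial bound 2 suffices.\<close>
      case False
      have "norm (correlation_mean f P g Q x - (\<Prod>p\<in>M. L p)) \<le> 1 + 1"
        using norm_correlation_mean_le[OF f g, of x P Q] norm_prod_le_1[of M L, OF nL] x2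
        by (intro order_trans[OF norm_triangle_ineq4 add_mono]) auto
      also have "\<dots> \<le> 2 * (DP + DQ + \<epsilon>)" using False D0 e0 by auto
      also have "\<dots> \<le> K * (DP + DQ + \<epsilon>)"
        using C K1(1) K2(1) K3(1) D0 e0 by (intro mult_right_mono) (auto simp: K_def)
      finally show ?thesis by (simp only: M_def L_def DP_def DQ_def \<epsilon>_def)
    next
      case True
      obtain a :: "nat \<Rightarrow> nat" where a: "(\<Sum>p\<in>M. 1 / real p ^ (a p + 1)) \<le> 170 * \<epsilon>"
        "real (\<Prod>p\<in>S. p ^ a p) \<le> sqrt x" "\<forall>p. ln x < real p \<longrightarrow> a p = 1"
        using x4[OF xx(4)] unfolding M_def S_def \<epsilon>_def by blast
      define E where "E p = trunc_correlation p (a p) f P g Q" for p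
      define \<mu> where "\<mu> = exp (mid_exponent f P x)"
      define \<nu> where "\<nu> = exp (mid_exponent g Q x)"
      define A where "A n = (\<Prod>p\<in>S. trunc_component f p (a p) (pval P n))" for n
      define B where "B n = (\<Prod>p\<in>S. trunc_component g p (a p) (pval Q n))" for n
      have n\<mu>: "norm \<mu> \<le> 1"
        using Re_mid_exponent_le[OF P f, of x] by (simp add: \<mu>_def norm_exp_eq_Re)
      have n\<nu>: "norm \<nu> \<le> 1"
        using Re_mid_exponent_le[OF Q g, of x] by (simp add: \<nu>_def norm_exp_eq_Re)
      have nA: "norm (A n) \<le> 1" and nB: "norm (B n) \<le> 1" for n
        unfolding A_def B_def by (intro norm_prod_le_1 norm_component_le f g prS; assumption)+
      have nE: "norm (E p) \<le> 1" if "p \<in> M" for p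
        unfolding E_def by (rule norm_trunc_correlation_le[OF f g prM[OF that]])
      define W where "W = (\<Sum>n | n \<in> {1..N} \<and> n \<notin> Z. f (pval P n) * g (pval Q n))"
      define V where "V = (\<Sum>n\<in>{1..N}. A n * B n)"
      have "norm (W - (\<Sum>n\<in>{1..N}. (A n * \<mu>) * (B n * \<nu>)))
          \<le> real (card Z) + (\<Sum>n | n \<in> {1..N} \<and> n \<notin> Z. norm (f (pval P n) * g (pval Q n) - (A n * \<mu>) * (B n * \<nu>)))"
        unfolding W_def using nA nB n\<mu> n\<nu> by (intro norm_sum_omit_le fZ) (simp add: norm_mult mult_le_one)
      also have "(\<Sum>n | n \<in> {1..N} \<and> n \<notin> Z. norm (f (pval P n) * g (pval Q n) - (A n * \<mu>) * (B n * \<nu>)))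
          \<le> (\<Sum>n | n \<in> {1..N} \<and> n \<notin> Z. norm (f (pval P n) - A n * \<mu>) + norm (g (pval Q n) - B n * \<nu>))"
      proof (intro sum_mono norm_mult_diff_le)
        fix n assume "n \<in> {n. n \<in> {1..N} \<and> n \<notin> Z}"
        then have "pval Q n > 0" by (auto simp: Z_def pval_def)
        then show "norm (g (pval Q n)) \<le> 1" using g by (simp add: unit_disc_valued_def)
        show "norm (A n * \<mu>) \<le> 1" using nA n\<mu> by (simp add: norm_mult mult_le_one)
      qed
      also have "\<dots> \<le> (\<Sum>n | n \<in> {1..N} \<and> pval P n \<noteq> 0. norm (f (pval P n) - A n * \<mu>))
          + (\<Sum>n | n \<in> {1..N} \<and> pval Q n \<noteq> 0. norm (g (pval Q n) - B n * \<nu>))"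
        unfolding sum.distrib by (intro add_mono sum_mono2) (auto simp: Z_def pval_eq_0_iff)
      also have "\<dots> \<le> K1 * x * (DP + \<epsilon>) + K2 * x * (DQ + \<epsilon>)"
      proof (intro add_mono)
        show "(\<Sum>n | n \<in> {1..N} \<and> pval P n \<noteq> 0. norm (f (pval P n) - A n * \<mu>)) \<le> K1 * x * (DP + \<epsilon>)"
          using K1(2)[OF mf f xx(1), of a] True a(1,3) by (simp only: N_def A_def S_def M_def \<mu>_def DP_def \<epsilon>_def)
        show "(\<Sum>n | n \<in> {1..N} \<and> pval Q n \<noteq> 0. norm (g (pval Q n) - B n * \<nu>)) \<le> K2 * x * (DQ + \<epsilon>)"
          using K2(2)[OF mg g xx(2), of a] True a(1,3) by (simp only: N_def B_def S_def M_def \<nu>_def DQ_def \<epsilon>_def)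
      qed
      also have "(\<Sum>n\<in>{1..N}. (A n * \<mu>) * (B n * \<nu>)) = V * (\<mu> * \<nu>)"
        by (simp add: V_def sum_distrib_left mult_ac)
      finally have s1: "norm (W - V * (\<mu> * \<nu>)) \<le> real (card Z) + (K1 * x * (DP + \<epsilon>) + K2 * x * (DQ + \<epsilon>))"
        by simp
      have s2: "norm (V * (\<mu> * \<nu>) - of_real x * prod E S * (\<mu> * \<nu>)) \<le> 2 * sqrt x + 1"
      proof -
        have "norm (V - of_real x * prod E S) \<le> 2 * real (\<Prod>p\<in>S. p ^ a p) + 1"
          using sum_small_components_approx[OF f g fS prS, of x a P Q] x2
          by (simp add: V_def A_def B_def E_def[abs_def] N_def prod.distrib)
        also have "\<dots> \<le> 2 * sqrt x + 1" using a(2) by simp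
        finally have "norm (V - of_real x * prod E S) * norm (\<mu> * \<nu>) \<le> (2 * sqrt x + 1) * 1"
          using n\<mu> n\<nu> x2 by (intro mult_mono) (auto simp: norm_mult mult_le_one)
        then show ?thesis by (simp add: norm_mult flip: left_diff_distrib)
      qed
      have "norm (W - of_real x * prod E S * (\<mu> * \<nu>))
          \<le> norm (W - V * (\<mu> * \<nu>)) + norm (V * (\<mu> * \<nu>) - of_real x * prod E S * (\<mu> * \<nu>))"
        using norm_triangle_ineq[of "W - V * (\<mu> * \<nu>)" "V * (\<mu> * \<nu>) - of_real x * prod E S * (\<mu> * \<nu>)"] by simp
      also have "\<dots> \<le> x * (\<epsilon> + K1 * (DP + \<epsilon>) + K2 * (DQ + \<epsilon>))"
        using s1 s2 rest by (simp add: algebra_simps)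
      finally have s3: "norm (W - of_real x * prod E S * (\<mu> * \<nu>)) / x \<le> \<epsilon> + K1 * (DP + \<epsilon>) + K2 * (DQ + \<epsilon>)"
        using x2 by (simp add: field_simps)
      have cm: "correlation_mean f P g Q x = (1 / of_real x) * W"
        using x2 by (subst correlation_mean_eq) (auto simp: W_def Z_def N_def)
      have "correlation_mean f P g Q x - prod E S * (\<mu> * \<nu>) = (1 / of_real x) * (W - of_real x * prod E S * (\<mu> * \<nu>))"
        using x2 by (simp add: cm field_simps)
      then have t1: "norm (correlation_mean f P g Q x - prod E S * (\<mu> * \<nu>)) \<le> \<epsilon> + K1 * (DP + \<epsilon>) + K2 * (DQ + \<epsilon>)"
        using s3 x2 by (simp add: norm_mult norm_divide)
      have t2: "norm (prod E S * (\<mu> * \<nu>) - prod E M) \<le> K3 * (DP + DQ + \<epsilon>)"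
      proof -
        have "prod E M = prod E S * prod E R"
          unfolding MSR(1) by (rule prod.union_disjoint[OF fS fR MSR(2)])
        then have "norm (prod E S * (\<mu> * \<nu>) - prod E M) = norm (prod E S) * norm (prod E R - \<mu> * \<nu>)"
          by (simp add: norm_mult norm_minus_commute flip: right_diff_distrib)
        also have "\<dots> \<le> 1 * norm (prod E R - \<mu> * \<nu>)"
          using nE MSR(1) by (intro mult_right_mono norm_prod_le_1) auto
        also have "prod E R = (\<Prod>p\<in>R. trunc_correlation p 1 f P g Q)"
          using a(3) by (intro prod.cong) (auto simp: E_def R_def)
        also have "1 * norm ((\<Prod>p\<in>R. trunc_correlation p 1 f P g Q) - \<mu> * \<nu>) \<le> K3 * (DP + DQ + \<epsilon>)"
          using K3(2)[OF mf f mg g xx(3)] by (simp only: R_def \<mu>_def \<nu>_def DP_def DQ_def \<epsilon>_def mult_1_left exp_add)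
        finally show ?thesis .
      qed
      have t3: "norm (prod E M - prod L M) \<le> 680 * C * \<epsilon>"
      proof -
        have "norm (prod E M - prod L M) \<le> (\<Sum>p\<in>M. norm (E p - L p))"
          by (intro norm_prod_diff nE nL)
        also have "\<dots> \<le> (\<Sum>p\<in>M. 4 * C * (1 / real p ^ (a p + 1)))"
        proof (rule sum_mono)
          fix p assume p: "p \<in> M"
          show "norm (E p - L p) \<le> 4 * C * (1 / real p ^ (a p + 1))"
            using norm_local_minus_trunc_correlation_le[OF P P0 Q Q0 f g prM[OF p], of "a p"]
            by (simp add: E_def L_def norm_minus_commute)
        qed
        also have "\<dots> = 4 * C * (\<Sum>p\<in>M. 1 / real p ^ (a p + 1))" by (simp only: sum_distrib_left)
        also have "\<dots> \<le> 4 * C * (170 * \<epsilon>)" using a(1) C by (intro mult_left_mono) auto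
        finally show ?thesis by simp
      qed
      have "norm (correlation_mean f P g Q x - prod L M)
          \<le> (\<epsilon> + K1 * (DP + \<epsilon>) + K2 * (DQ + \<epsilon>)) + K3 * (DP + DQ + \<epsilon>) + 680 * C * \<epsilon>"
        using norm_triangle_ineq[of "correlation_mean f P g Q x - prod E S * (\<mu> * \<nu>)" "prod E S * (\<mu> * \<nu>) - prod E M"]
          norm_triangle_ineq[of "correlation_mean f P g Q x - prod E M" "prod E M - prod L M"] t1 t2 t3
        by simp
      also have "\<dots> \<le> K * (DP + DQ + \<epsilon>)"
      proof -
        have "K * (DP + DQ + \<epsilon>) - ((\<epsilon> + K1 * (DP + \<epsilon>) + K2 * (DQ + \<epsilon>)) + K3 * (DP + DQ + \<epsilon>) + 680 * C * \<epsilon>)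
            = \<epsilon> + (2 + 680 * C) * (DP + DQ) + K1 * DQ + K2 * DP"
          by (simp add: K_def algebra_simps)
        moreover have "\<dots> \<ge> 0" using C D0 e0 K1(1) K2(1) by (intro add_nonneg_nonneg mult_nonneg_nonneg) auto
        ultimately show ?thesis by linarith
      qed
      finally show ?thesis by (simp only: M_def L_def[abs_def] DP_def DQ_def \<epsilon>_def)
    qed
  qed
  show ?thesis
    by (intro exI[of _ K] exI[of _ "Max {x1, x2, x3, x4, x5}"] allI impI main)
qed

end
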